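(* Let $p$ be a prime and let $\pi$ be the GNS representation of $\mathcal{O}(\mathbb{Z}_p)$ on $L^2(\mathbb{Z}_p)$. Then there does not exist any nontrivial equivariant even spectral triple $$\left(\mathcal{O}(\mathbb{Z}_p),\ \pi\oplus\pi,\ \begin{pmatrix}0 & D \\ D^* & 0\end{pmatrix},\ \begin{pmatrix}1 & 0 \\ 0 & -1\end{pmatrix}\right)$$ of $C(\mathbb{Z}_p)$.
   Context: $\mathbb{Z}_p$ is the compact additive group of $p$-adic integers; $\mathcal{O}(\mathbb{Z}_p)\subset C(\mathbb{Z}_p)$ is the linear span of its continuous characters. The GNS representation $\pi$ is with respect to the Haar state: $\pi(f)$ is multiplication by $f$ on $L^2(\mathbb{Z}_p)$. An even spectral triple of this form is on the Hilbert space $L^2(\mathbb{Z}_p)\oplus L^2(\mathbb{Z}_p)$, graded by the last matrix: the Dirac operator $\mathcal{D}=\begin{pmatrix}0 & D \\ D^* & 0\end{pmatrix}$ is self-adjoint with compact resolvent and has bounded commutators with $(\pi\oplus\pi)(f)$, $f\in\mathcal{O}(\mathbb{Z}_p)$. Equivariant means equivariant with respect to the regular action: $U_x^*DU_x=D$ for all $x\in\mathbb{Z}_p$, where $(U_xf)(y)=f(y-x)$ on $L^2(\mathbb{Z}_p)$. Nontrivial means that its index pairing with $K_0(C(\mathbb{Z}_p))$ is not identically zero; on the class of a projection $q=\mathbf{1}_{x+p^r\mathbb{Z}_p}$ (such classes generate $K_0(C(\mathbb{Z}_p))$) the pairing is $\mathrm{Ind}_{\mathcal{D}}(q)=\mathrm{Index}(qDq)$,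 the Fredholm index of $qDq$ on $qL^2(\mathbb{Z}_p)$. *)

theory Defs
  imports
    "HOL-Probability.Probability"
    "HOL-Library.Function_Algebras"
    "Jordan_Normal_Form.Schur_Decomposition"
begin

section \<open>The group of $p$-adic integers\<close>

text \<open>
  The $p$-adic integers are the inverse limit of the groups Z/p^n, each represented by the
  residues 0, ..., p^n - 1. They carry the subspace topology of the product topology on
  \<^typ>\<open>nat \<Rightarrow> int\<close> (with \<^typ>\<open>int\<close> discrete).
\<close>

type_synonym padic = "nat \<Rightarrow> int"

definition Zp :: "nat \<Rightarrow> padic set" where
  "Zp p = {x. \<forall>n. x n \<in> {0..<int p ^ n} \<and> x (Suc n) mod int p ^ n = x n}"

definition zp_add :: "nat \<Rightarrow> padic \<Rightarrow> padic \<Rightarrow> padic" where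
  "zp_add p x y = (\<lambda>n. (x n + y n) mod int p ^ n)"

definition zp_diff :: "nat \<Rightarrow> padic \<Rightarrow> padic \<Rightarrow> padic" where
  "zp_diff p x y = (\<lambda>n. (x n - y n) mod int p ^ n)"

definition haar_measure :: "nat \<Rightarrow> padic measure \<Rightarrow> bool" where
  "haar_measure p \<mu> \<longleftrightarrow>
     prob_space \<mu> \<and> sets \<mu> = sets (restrict_space borel (Zp p)) \<and>
     (\<forall>x\<in>Zp p. \<forall>A\<in>sets \<mu>. emeasure \<mu> (zp_add p x ` A) = emeasure \<mu> A)"

global_interpretation cfun: vector_space "\<lambda>(c::complex) (f::'a \<Rightarrow> complex) x. c * f x"
  by unfold_locales (auto simp: fun_eq_iff algebra_simps)

definition zp_character :: "nat \<Rightarrow> (padic \<Rightarrow> complex) \<Rightarrow> bool" where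
  "zp_character p \<psi> \<longleftrightarrow>
     continuous_on (Zp p) \<psi> \<and> (\<forall>x\<in>Zp p. cmod (\<psi> x) = 1) \<and>
     (\<forall>x\<in>Zp p. \<forall>y\<in>Zp p. \<psi> (zp_add p x y) = \<psi> x * \<psi> y)"

text \<open>
  Functions on Z_p are represented by total functions whose values off Z_p are irrelevant.
  Every extension of a character counts as a character, so membership in the span below
  only depends on the restriction to Z_p.
\<close>

definition O_Zp :: "nat \<Rightarrow> (padic \<Rightarrow> complex) set" where
  "O_Zp p = cfun.span {\<psi>. zp_character p \<psi>}"


section \<open>Square-integrable functions and unbounded operators\<close>

text \<open>
  Elements of $L^2(M)$ are represented by square-integrable functions, and equality of
  vectors is equality almost everywhere. A (partially defined) operator is represented by its
  graph, a set of pairs (f, Tf) of representatives that is saturated under almost everywhere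
  equality. The relational composition \<open>R O S\<close> of graphs is thus ``first R, then S''.
\<close>

definition L2 :: "'a measure \<Rightarrow> ('a \<Rightarrow> complex) set" where
  "L2 M = {f \<in> borel_measurable M. integrable M (\<lambda>x. (cmod (f x))\<^sup>2)}"

definition L2_inner :: "'a measure \<Rightarrow> ('a \<Rightarrow> complex) \<Rightarrow> ('a \<Rightarrow> complex) \<Rightarrow> complex" where
  "L2_inner M f g = (\<integral>x. f x * cnj (g x) \<partial>M)"

definition L2_norm :: "'a measure \<Rightarrow> ('a \<Rightarrow> complex) \<Rightarrow> real" where
  "L2_norm M f = sqrt (\<integral>x. (cmod (f x))\<^sup>2 \<partial>M)"

definition L2_null :: "'a measure \<Rightarrow> ('a \<Rightarrow> complex) set" where
  "L2_null M = {f \<in> L2 M. AE x in M. f x = 0}"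

type_synonym 'a graph = "(('a \<Rightarrow> complex) \<times> ('a \<Rightarrow> complex)) set"

definition densely_defined_operator :: "'a measure \<Rightarrow> 'a graph \<Rightarrow> bool" where
  "densely_defined_operator M T \<longleftrightarrow>
     T \<subseteq> L2 M \<times> L2 M \<and>
     \<comment> \<open>saturated and single-valued modulo null functions\<close>
     (\<forall>f\<in>L2_null M. \<forall>g\<in>L2 M. (f, g) \<in> T \<longleftrightarrow> g \<in> L2_null M) \<and>
     (\<forall>(f, g)\<in>T. \<forall>(f', g')\<in>T. (f + f', g + g') \<in> T) \<and>
     (\<forall>(f, g)\<in>T. \<forall>c. (\<lambda>x. c * f x, \<lambda>x. c * g x) \<in> T) \<and>
     (\<forall>f\<in>L2 M. \<forall>\<epsilon>>0. \<exists>f'\<in>Domain T. L2_norm M (f - f') < \<epsilon>)"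

definition op_graph :: "'a measure \<Rightarrow> (('a \<Rightarrow> complex) \<Rightarrow> ('a \<Rightarrow> complex)) \<Rightarrow> 'a graph" where
  "op_graph M A = {(f, g). f \<in> L2 M \<and> g \<in> L2 M \<and> (AE x in M. g x = A f x)}"

definition adjoint_graph :: "'a measure \<Rightarrow> 'a graph \<Rightarrow> 'a graph" where
  "adjoint_graph M T =
     {(h, k). h \<in> L2 M \<and> k \<in> L2 M \<and> (\<forall>(f, g)\<in>T. L2_inner M g h = L2_inner M f k)}"

definition self_adjoint_graph :: "'a measure \<Rightarrow> 'a graph \<Rightarrow> bool" where
  "self_adjoint_graph M T \<longleftrightarrow> densely_defined_operator M T \<and> adjoint_graph M T = T"

definition compact_graph :: "'a measure \<Rightarrow> 'a graph \<Rightarrow> bool" where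
  "compact_graph M K \<longleftrightarrow> densely_defined_operator M K \<and> Domain K = L2 M \<and>
     (\<forall>f g. (\<forall>n::nat. (f n, g n) \<in> K \<and> L2_norm M (f n) \<le> 1) \<longrightarrow>
        (\<exists>r h. strict_mono (r :: nat \<Rightarrow> nat) \<and> h \<in> L2 M \<and>
               (\<lambda>n. L2_norm M (g (r n) - h)) \<longlonglongrightarrow> 0))"

definition resolvent_graph :: "'a measure \<Rightarrow> 'a graph \<Rightarrow> complex \<Rightarrow> 'a graph" where
  "resolvent_graph M T z = (\<lambda>(f, g). (\<lambda>x. g x - z * f x, f)) ` T"

text \<open>
  The resolvent of T at z is the graph of the inverse of T - z. Requiring it to be (the graph
  of) an everywhere defined compact operator includes that z lies in the resolvent set.
\<close>

definition has_compact_resolvent :: "'a measure \<Rightarrow> 'a graph \<Rightarrow> bool" where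
  "has_compact_resolvent M T \<longleftrightarrow> (\<exists>z. compact_graph M (resolvent_graph M T z))"

definition bounded_commutator ::
  "'a measure \<Rightarrow> 'a graph \<Rightarrow> (('a \<Rightarrow> complex) \<Rightarrow> ('a \<Rightarrow> complex)) \<Rightarrow> bool" where
  "bounded_commutator M T A \<longleftrightarrow>
     (\<exists>C. \<forall>(f, g)\<in>T. \<exists>h. (A f, h) \<in> T \<and> L2_norm M (h - A g) \<le> C * L2_norm M f)"

text \<open>
  An even spectral triple with Dirac operator T and grading \<open>\<gamma>\<close>. That A is a *-algebra
  and \<open>\<rho>\<close> a *-representation of it by bounded operators on $L^2(M)$ is understood and not
  part of the definition; it holds for \<open>O_Zp p\<close> and \<open>pi_pi\<close> below.
\<close>

definition even_spectral_triple ::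
  "'a measure \<Rightarrow> 'b set \<Rightarrow> ('b \<Rightarrow> ('a \<Rightarrow> complex) \<Rightarrow> ('a \<Rightarrow> complex)) \<Rightarrow> 'a graph \<Rightarrow>
   (('a \<Rightarrow> complex) \<Rightarrow> ('a \<Rightarrow> complex)) \<Rightarrow> bool" where
  "even_spectral_triple M A \<rho> T \<gamma> \<longleftrightarrow>
     self_adjoint_graph M T \<and> has_compact_resolvent M T \<and>
     (\<forall>a\<in>A. bounded_commutator M T (\<rho> a)) \<and>
     self_adjoint_graph M (op_graph M \<gamma>) \<and> op_graph M \<gamma> O op_graph M \<gamma> = op_graph M id \<and>
     (\<forall>a\<in>A. op_graph M \<gamma> O op_graph M (\<rho> a) = op_graph M (\<rho> a) O op_graph M \<gamma>) \<and>
     (\<forall>(f, g)\<in>T. (\<gamma> f, - \<gamma> g) \<in> T)"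


section \<open>Fredholm index\<close>

definition has_quotient_dim :: "('a \<Rightarrow> complex) set \<Rightarrow> ('a \<Rightarrow> complex) set \<Rightarrow> nat \<Rightarrow> bool" where
  "has_quotient_dim V W n \<longleftrightarrow>
     (\<exists>B. finite B \<and> card B = n \<and> cfun.independent B \<and> B \<subseteq> V \<and>
          cfun.span B \<inter> W = {0} \<and> (\<forall>v\<in>V. \<exists>b\<in>cfun.span B. v - b \<in> W))"

text \<open>
  T is an operator in the closed subspace H of $L^2(M)$. It is Fredholm of index k if it has
  closed range and finite-dimensional kernel and cokernel, the dimensions being
  taken modulo null functions.
\<close>

definition has_fredholm_index ::
  "'a measure \<Rightarrow> ('a \<Rightarrow> complex) set \<Rightarrow> 'a graph \<Rightarrow> int \<Rightarrow> bool" where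
  "has_fredholm_index M H T k \<longleftrightarrow>
     (\<forall>g h. (\<forall>n::nat. g n \<in> Range T) \<and> h \<in> H \<and> (\<lambda>n. L2_norm M (g n - h)) \<longlonglongrightarrow> 0
        \<longrightarrow> h \<in> Range T) \<and>
     (\<exists>a b. has_quotient_dim {f \<in> H. (f, 0) \<in> T} (L2_null M) a \<and>
            has_quotient_dim H (Range T) b \<and> k = int a - int b)"


section \<open>Even spectral triples over the $p$-adic integers\<close>

text \<open>
  The n-fold direct sum of $L^2(\mu)$ is realised as $L^2$ of n disjoint copies of \<open>\<mu>\<close>;
  the i-th component of f is \<open>\<lambda>x. f (i, x)\<close>.
\<close>

definition copies :: "nat \<Rightarrow> 'a measure \<Rightarrow> (nat \<times> 'a) measure" where
  "copies n \<mu> = count_space {..<n} \<Otimes>\<^sub>M \<mu>"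

definition pi_pi :: "('a \<Rightarrow> complex) \<Rightarrow> (nat \<times> 'a \<Rightarrow> complex) \<Rightarrow> (nat \<times> 'a \<Rightarrow> complex)" where
  "pi_pi f \<xi> = (\<lambda>(i, x). f x * \<xi> (i, x))"

definition grading :: "(nat \<times> 'a \<Rightarrow> complex) \<Rightarrow> (nat \<times> 'a \<Rightarrow> complex)" where
  "grading \<xi> = (\<lambda>(i, x). if i = 0 then \<xi> (i, x) else - \<xi> (i, x))"

text \<open>The off-diagonal operator matrix with upper right entry D and lower left entry D*.\<close>

definition dirac :: "'a measure \<Rightarrow> 'a graph \<Rightarrow> (nat \<times> 'a) graph" where
  "dirac \<mu> D =
     {(\<xi>, \<eta>). \<xi> \<in> L2 (copies 2 \<mu>) \<and> \<eta> \<in> L2 (copies 2 \<mu>) \<and>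
        (\<lambda>x. \<xi> (1, x), \<lambda>x. \<eta> (0, x)) \<in> D \<and>
        (\<lambda>x. \<xi> (0, x), \<lambda>x. \<eta> (1, x)) \<in> adjoint_graph \<mu> D}"

definition regular :: "nat \<Rightarrow> padic \<Rightarrow> (padic \<Rightarrow> complex) \<Rightarrow> (padic \<Rightarrow> complex)" where
  "regular p x f = (\<lambda>y. f (zp_diff p y x))"

definition equivariant :: "nat \<Rightarrow> padic measure \<Rightarrow> padic graph \<Rightarrow> bool" where
  "equivariant p \<mu> D \<longleftrightarrow>
     (\<forall>x\<in>Zp p. let U = op_graph \<mu> (regular p x) in U O D O adjoint_graph \<mu> U = D)"


section \<open>K-theory and the index pairing\<close>

text \<open>
  A pair (n, q) stands for an n by n matrix q of functions on Z_p, given pointwise.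
\<close>

type_synonym matrix_function = "nat \<times> (padic \<Rightarrow> complex mat)"

definition continuous_entries :: "nat \<Rightarrow> nat \<Rightarrow> nat \<Rightarrow> (padic \<Rightarrow> complex mat) \<Rightarrow> bool" where
  "continuous_entries p m n v \<longleftrightarrow>
     (\<forall>x\<in>Zp p. v x \<in> carrier_mat m n) \<and>
     (\<forall>i<m. \<forall>j<n. continuous_on (Zp p) (\<lambda>x. v x $$ (i, j)))"

definition proj_C :: "nat \<Rightarrow> matrix_function set" where
  "proj_C p = {(n, q). continuous_entries p n n q \<and>
     (\<forall>x\<in>Zp p. q x * q x = q x \<and> mat_adjoint (q x) = q x)}"

definition proj_O :: "nat \<Rightarrow> matrix_function set" where
  "proj_O p = {(n, q) \<in> proj_C p. \<forall>i<n. \<forall>j<n. (\<lambda>x. q x $$ (i, j)) \<in> O_Zp p}"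

definition proj_sum :: "matrix_function \<Rightarrow> matrix_function \<Rightarrow> matrix_function" where
  "proj_sum = (\<lambda>(n, q) (m, s).
     (n + m, \<lambda>x. four_block_mat (q x) (0\<^sub>m n m) (0\<^sub>m m n) (s x)))"

definition murray_von_neumann :: "nat \<Rightarrow> matrix_function \<Rightarrow> matrix_function \<Rightarrow> bool" where
  "murray_von_neumann p = (\<lambda>(n, q) (m, s).
     \<exists>v. continuous_entries p m n v \<and>
         (\<forall>x\<in>Zp p. mat_adjoint (v x) * v x = q x \<and> v x * mat_adjoint (v x) = s x))"

text \<open>
  The class of a pair (q, s) of projections is the formal difference [q] - [s] in K_0(C(Z_p)).
\<close>

definition K0_rel :: "nat \<Rightarrow> ((matrix_function \<times> matrix_function) \<times>
    (matrix_function \<times> matrix_function)) set" where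
  "K0_rel p = {((q, s), (q', s')). {q, s, q', s'} \<subseteq> proj_C p \<and>
     (\<exists>e\<in>proj_C p. murray_von_neumann p
        (proj_sum (proj_sum q s') e) (proj_sum (proj_sum q' s) e))}"

definition K0 :: "nat \<Rightarrow> (matrix_function \<times> matrix_function) set set" where
  "K0 p = (proj_C p \<times> proj_C p) // K0_rel p"

definition mat_action ::
  "nat \<Rightarrow> ('a \<Rightarrow> complex mat) \<Rightarrow> (nat \<times> 'a \<Rightarrow> complex) \<Rightarrow> (nat \<times> 'a \<Rightarrow> complex)" where
  "mat_action n q \<xi> = (\<lambda>(i, x). \<Sum>j<n. q x $$ (i, j) * \<xi> (j, x))"

definition amplification :: "nat \<Rightarrow> 'a measure \<Rightarrow> 'a graph \<Rightarrow> (nat \<times> 'a) graph" where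
  "amplification n \<mu> D = {(\<xi>, \<eta>). \<xi> \<in> L2 (copies n \<mu>) \<and> \<eta> \<in> L2 (copies n \<mu>) \<and>
     (\<forall>i<n. (\<lambda>x. \<xi> (i, x), \<lambda>x. \<eta> (i, x)) \<in> D)}"

text \<open>
  \<open>index_of_projection \<mu> D (n, q) k\<close>: the compression q (D \<open>\<otimes>\<close> 1_n) q, as an operator in
  the Hilbert space q $L^2(\mu)^n$, is Fredholm of index k. For n = 1 and q the indicator
  function of x + p^r Z_p this is the index of qDq.
\<close>

definition index_of_projection ::
  "padic measure \<Rightarrow> padic graph \<Rightarrow> matrix_function \<Rightarrow> int \<Rightarrow> bool" where
  "index_of_projection \<mu> D = (\<lambda>(n, q) k.
     let M = copies n \<mu>; Q = op_graph M (mat_action n q); H = Range Q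
     in has_fredholm_index M H ((Q O amplification n \<mu> D O Q) \<inter> H \<times> H) k)"

text \<open>
  The compression is only defined for projections over \<open>O_Zp p\<close>, whose commutators with D
  are bounded. As O(Z_p) is dense in C(Z_p) and closed under holomorphic functional calculus,
  every class in K_0(C(Z_p)) is a difference of such projections, and the resulting
  value of the pairing does not depend on their choice. The pairing is given as a relation
  between a class c and its value k.
\<close>

definition index_pairing ::
  "nat \<Rightarrow> padic measure \<Rightarrow> padic graph \<Rightarrow> (matrix_function \<times> matrix_function) set \<Rightarrow> int \<Rightarrow> bool"
where
  "index_pairing p \<mu> D c k \<longleftrightarrow>
     (\<exists>q s j l. (q, s) \<in> c \<and> q \<in> proj_O p \<and> s \<in> proj_O p \<and>
        index_of_projection \<mu> D q j \<and> index_of_projection \<mu> D s l \<and> k = j - l)"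

definition nontrivial_pairing :: "nat \<Rightarrow> padic measure \<Rightarrow> padic graph \<Rightarrow> bool" where
  "nontrivial_pairing p \<mu> D \<longleftrightarrow> (\<exists>c\<in>K0 p. \<exists>k. index_pairing p \<mu> D c k \<and> k \<noteq> 0)"

end

theory Submission
  imports Defs
begin

text \<open>
  Averaging over the cosets of $p^N \mathbb{Z}_p$ is a projection of $L^2(\mathbb{Z}_p)$ onto the
  finite-dimensional space of step functions of level N, and it is a strong limit of averages of
  translations. An equivariant D is closed, because the Dirac operator is self-adjoint, so D commutes
  with all these projections; since its domain is dense, it contains every step function.
  The entries of a projection q over \<open>O_Zp p\<close> are locally constant, so for large N the coset averages
  also commute with q. The compression of D by q is then an increasing limit of operators on
  finite-dimensional spaces, each of which has index zero by rank-nullity. If the compression is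
  Fredholm, its kernel and its cokernel already live on one of these spaces, and its index vanishes.
\<close>

text \<open>The main obstacle is that D is unbounded and its closedness is not given outright, so
  commuting with translations does not pass directly to a strong limit of their averages. Membership
  in D is therefore tested weakly: by self-adjointness of the Dirac operator, D contains every pair
  (f, g) with <g, h> = <f, k> for all (h, k) in the adjoint of D, and in such scalar identities
  limits are harmless. A second obstacle is that vectors are functions, equal only almost
  everywhere. A coset average is given by integrals, so it depends only on the class of its argument
  and is an honest step function; the only null step function is 0. On the ranges of the averages,
  relations modulo null functions thus become exact, and rank-nullity is plain linear algebra. Local
  constancy of the entries of q rests on the fact that the circle group has no small subgroups.
  Closedness of the range of the compression is what lets the cokernel be read off at a finite
  level.\<close>

section \<open>Linear maps between spaces of complex functions\<close>

text \<open>\<open>cfun\<close> is an interpretation for one space at a time; facts about maps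
  between two such spaces are exported here from a local interpretation of
  \<open>vector_space_pair\<close>.\<close>

lemma linear_extension:
  fixes f :: "('a \<Rightarrow> complex) \<Rightarrow> ('b \<Rightarrow> complex)"
  assumes "cfun.independent B"
  shows "\<exists>g. Vector_Spaces.linear (\<lambda>c f x. c * f x) (\<lambda>c f x. c * f x) g \<and> (\<forall>x\<in>B. g x = f x)"
proof -
  interpret vector_space_pair
    "\<lambda>(c::complex) (f::'a \<Rightarrow> complex) x. c * f x" "\<lambda>(c::complex) (f::'b \<Rightarrow> complex) x. c * f x"
    by unfold_locales
  show ?thesis using linear_independent_extend[OF assms, of f] by blast
qed

lemma linear_functional_extension:
  fixes f :: "('a \<Rightarrow> complex) \<Rightarrow> complex"
  assumes "cfun.independent B"
  shows "\<exists>g. Vector_Spaces.linear (\<lambda>c f x. c * f x) (*) g \<and> (\<forall>x\<in>B. g x = f x)"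
proof -
  interpret vector_space_pair
    "\<lambda>(c::complex) (f::'a \<Rightarrow> complex) x. c * f x" "(*) :: complex \<Rightarrow> complex \<Rightarrow> complex"
    by unfold_locales (simp_all only: distrib_left distrib_right mult.assoc mult_1_left)
  show ?thesis using linear_independent_extend[OF assms, of f] by blast
qed

lemma independent_image:
  fixes g :: "('a \<Rightarrow> complex) \<Rightarrow> ('b \<Rightarrow> complex)"
  assumes "Vector_Spaces.linear (\<lambda>c f x. c * f x) (\<lambda>c f x. c * f x) g"
    and "cfun.independent B" "inj_on g (cfun.span B)"
  shows "cfun.independent (g ` B)"
proof -
  interpret vector_space_pair
    "\<lambda>(c::complex) (f::'a \<Rightarrow> complex) x. c * f x" "\<lambda>(c::complex) (f::'b \<Rightarrow> complex) x. c * f x"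
    by unfold_locales
  show ?thesis by (rule linear_independent_injective_image[OF assms])
qed

section \<open>Quotient dimensions\<close>

text \<open>The coordinates of x relative to \<open>G\<close> are unique, so they are supported in
  \<open>A\<close> and in \<open>B\<close> at once, hence nowhere.\<close>

lemma independent_span_Int:
  fixes A B G :: "('a \<Rightarrow> complex) set"
  assumes G: "cfun.independent G" "A \<subseteq> G" "B \<subseteq> G" "A \<inter> B = {}"
    and x: "x \<in> cfun.span A" "x \<in> cfun.span B"
  shows "x = 0"
proof -
  let ?r = "cfun.representation G x"
  have "?r = cfun.representation A x" "?r = cfun.representation B x"
    by (rule cfun.representation_extend[OF G(1) x(1) G(2)], rule cfun.representation_extend[OF G(1) x(2) G(3)])
  then have "?r b = 0" for b using cfun.representation_ne_zero[of A x b] cfun.representation_ne_zero[of B x b] G(4) by auto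
  then have sum: "(\<Sum>b | ?r b \<noteq> 0. (\<lambda>z. ?r b * b z)) = 0" by simp
  have "x \<in> cfun.span G" using x(1) cfun.span_mono[OF G(2)] by blast
  from sym[OF cfun.sum_nonzero_representation_eq[OF G(1) this]] sum show "x = 0" by (rule trans)
qed

text \<open>Steinitz bound modulo \<open>W\<close>: choosing for each element of \<open>C\<close> a
  representative in the span of \<open>B\<close> defines a linear map on the span of
  \<open>C\<close>. It moves vectors only within their class modulo \<open>W\<close>, so it is
  injective, and the usual bound for independent sets in a span applies to the image of
  \<open>C\<close>.\<close>

lemma quotient_independent_card_le:
  fixes V W :: "('a \<Rightarrow> complex) set"
  assumes W: "cfun.subspace W" and fB: "finite B"
    and cover: "\<And>v. v \<in> V \<Longrightarrow> \<exists>b\<in>cfun.span B. v - b \<in> W"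
    and C: "cfun.independent C" "C \<subseteq> V" "cfun.span C \<inter> W = {0}"
  shows "finite C \<and> card C \<le> card B"
proof -
  obtain \<phi> where \<phi>: "\<And>v. v \<in> V \<Longrightarrow> \<phi> v \<in> cfun.span B \<and> v - \<phi> v \<in> W"
    using cover by metis
  obtain g where g: "Vector_Spaces.linear (\<lambda>c f x. c * f x) (\<lambda>c f x. c * f x) g"
      "\<And>x. x \<in> C \<Longrightarrow> g x = \<phi> x"
    using linear_extension[OF C(1), of \<phi>] by blast
  interpret g: Vector_Spaces.linear "\<lambda>(c::complex) (f::'a \<Rightarrow> complex) x. c * f x"
      "\<lambda>(c::complex) (f::'a \<Rightarrow> complex) x. c * f x" g by (rule g(1))
  have mod: "g x \<in> cfun.span B \<and> x - g x \<in> W" if "x \<in> cfun.span C" for x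
    using that
  proof (induction rule: cfun.span_induct_alt)
    case base
    show ?case unfolding g.zero diff_self using cfun.subspace_0[OF W] cfun.span_zero[of B] by blast
  next
    case (step c x y)
    have eq: "(\<lambda>z. c * x z) + y - g ((\<lambda>z. c * x z) + y) = (\<lambda>z. c * (x - g x) z) + (y - g y)"
      by (simp add: g.add g.scale fun_eq_iff algebra_simps)
    have "x \<in> V" "g x = \<phi> x" using step g C by auto
    then have 1: "g x \<in> cfun.span B" "x - g x \<in> W" using \<phi> by auto
    have "(\<lambda>z. c * (x - g x) z) + (y - g y) \<in> W"
      using cfun.subspace_add[OF W] cfun.subspace_scale[OF W] 1 step by blast
    moreover have "g ((\<lambda>z. c * x z) + y) \<in> cfun.span B"
      using 1 step by (simp add: g.add g.scale cfun.span_add cfun.span_scale)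
    ultimately show ?case unfolding eq by blast
  qed
  \<comment> \<open>A vector x killed by \<open>g\<close> equals x - g x and so lies in
    \<open>W\<close>, which meets the span of \<open>C\<close> only in 0.\<close>
  have inj: "inj_on g (cfun.span C)"
  proof (rule inj_onI)
    fix x y assume xy: "x \<in> cfun.span C" "y \<in> cfun.span C" "g x = g y"
    then have "x - y \<in> cfun.span C" "g (x - y) = 0" by (auto simp: cfun.span_diff g.diff)
    then have "x - y \<in> cfun.span C \<inter> W" using mod[of "x - y"] by simp
    then show "x = y" using C by simp
  qed
  have "cfun.independent (g ` C)"
    by (rule independent_image[OF g(1) C(1) inj])
  moreover have "g ` C \<subseteq> cfun.span B" using mod cfun.span_base by auto
  ultimately have "finite (g ` C) \<and> card (g ` C) \<le> card B"
    using cfun.independent_span_bound[OF fB] by blast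
  moreover have "inj_on g C" using inj cfun.span_superset by (rule inj_on_subset)
  ultimately show ?thesis by (simp add: card_image finite_image_iff)
qed

text \<open>\<open>has_quotient_dim\<close> only asserts that some complement of the given size
  exists; comparing two complements in both directions makes the size a well-defined number.\<close>

lemma has_quotient_dim_unique:
  assumes "cfun.subspace W" "has_quotient_dim V W m" "has_quotient_dim V W n"
  shows "m = n"
proof -
  have "i \<le> j" if i: "has_quotient_dim V W i" and j: "has_quotient_dim V W j" for i j
  proof -
    obtain C where C: "card C = i" "cfun.independent C" "C \<subseteq> V" "cfun.span C \<inter> W = {0}"
      using i unfolding has_quotient_dim_def by blast
    obtain B where B: "finite B" "card B = j" "\<forall>v\<in>V. \<exists>b\<in>cfun.span B. v - b \<in> W"
      using j unfolding has_quotient_dim_def by blast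
    show ?thesis using quotient_independent_card_le[OF assms(1) B(1) _ C(2-4)] B C by blast
  qed
  then show ?thesis using assms by (meson le_antisym)
qed

text \<open>At most k vectors of V are independent modulo W. A member \<open>U m\<close> of the
  chain that contains the largest possible number of such vectors cannot grow: a vector appearing
  later could be added to them.\<close>

lemma quotient_chain_stabilizes:
  fixes V W :: "('a \<Rightarrow> complex) set" and U :: "nat \<Rightarrow> ('a \<Rightarrow> complex) set"
  assumes W: "cfun.subspace W" and dim: "has_quotient_dim V W k"
    and U: "\<And>n. cfun.subspace (U n)" "\<And>n. W \<subseteq> U n" "\<And>n. U n \<subseteq> V" "incseq U"
  shows "\<exists>m. \<forall>n\<ge>m. U n = U m"
proof -
  \<comment> \<open>\<open>P d\<close>: some member of the chain contains d vectors that are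
    independent modulo W.\<close>
  define P where "P d \<longleftrightarrow> (\<exists>n B. B \<subseteq> U n \<and> card B = d \<and> finite B \<and> cfun.independent B \<and>
      cfun.span B \<inter> W = {0})" for d
  obtain B0 where B0: "finite B0" "card B0 = k" "\<forall>v\<in>V. \<exists>b\<in>cfun.span B0. v - b \<in> W"
    using dim unfolding has_quotient_dim_def by blast
  have bound: "d \<le> k" if "P d" for d
    using that unfolding P_def
  proof (elim exE conjE)
    fix n B assume B: "B \<subseteq> U n" "card B = d" "cfun.independent B" "cfun.span B \<inter> W = {0}"
    have "B \<subseteq> V" using B(1) U(3)[of n] by (rule order_trans)
    then show ?thesis using quotient_independent_card_le[OF W B0(1) _ B(3) _ B(4), of V] B0 B(2) by auto
  qed
  have "P 0" unfolding P_def
    using cfun.subspace_0[OF W] by (intro exI[of _ 0] exI[of _ "{}"]) (auto simp: cfun.independent_empty)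
  define d where "d = Greatest P"
  have "P d" unfolding d_def by (rule GreatestI_nat[where P = P, OF \<open>P 0\<close>]) (use bound in auto)
  have dmax: "e \<le> d" if "P e" for e unfolding d_def by (rule Greatest_le_nat[where P = P, OF that]) (use bound in auto)
  obtain m B where B: "B \<subseteq> U m" "card B = d" "finite B" "cfun.independent B" "cfun.span B \<inter> W = {0}"
    using \<open>P d\<close> unfolding P_def by blast
  have "U n \<subseteq> U m" if "m \<le> n" for n
  proof
    fix x assume x: "x \<in> U n"
    have span_sub: "cfun.span B \<subseteq> U m" using B(1) U(1) by (rule cfun.span_minimal)
    show "x \<in> U m"
    proof (rule ccontr)
      assume nx: "x \<notin> U m"
      have "x \<notin> cfun.span B" using nx span_sub by blast
      then have ind: "cfun.independent (insert x B)" using B(4) by (simp add: cfun.independent_insert)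
      have "x \<notin> B" using \<open>x \<notin> cfun.span B\<close> cfun.span_base by blast
      have "cfun.span (insert x B) \<inter> W = {0}"
      proof -
        have "y = 0" if y: "y \<in> cfun.span (insert x B)" "y \<in> W" for y
        proof -
          obtain c where c: "y - (\<lambda>z. c * x z) \<in> cfun.span B"
            using y(1) unfolding cfun.span_insert by blast
          \<comment> \<open>Otherwise x could be solved for as a combination of a vector of W and
            one of the span of \<open>B\<close>, both of which lie in \<open>U m\<close>.\<close>
          have "c = 0"
          proof (rule ccontr)
            assume "c \<noteq> 0"
            have "y - (y - (\<lambda>z. c * x z)) \<in> U m"
              by (rule cfun.subspace_diff[OF U(1)]) (use c span_sub y(2) U(2)[of m] in blast)+
            then have "(\<lambda>z. inverse c * (y - (y - (\<lambda>z. c * x z))) z) \<in> U m"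
              by (rule cfun.subspace_scale[OF U(1)])
            also have "(\<lambda>z. inverse c * (y - (y - (\<lambda>z. c * x z))) z) = x"
              using \<open>c \<noteq> 0\<close> by (simp add: fun_eq_iff field_simps)
            finally show False using nx by blast
          qed
          then have "y \<in> cfun.span B" using c by (simp add: fun_diff_def)
          then show ?thesis using y(2) B(5) by blast
        qed
        then show ?thesis using cfun.span_zero cfun.subspace_0[OF W] by blast
      qed
      moreover have "insert x B \<subseteq> U n" using x B(1) incseqD[OF U(4) that] by blast
      ultimately have "P (Suc d)"
        unfolding P_def using ind B \<open>x \<notin> B\<close> by (intro exI[of _ n] exI[of _ "insert x B"]) auto
      then show False using dmax by force
    qed
  qed
  then have "\<forall>n\<ge>m. U n = U m" using incseqD[OF U(4)] by blast
  then show ?thesis by blast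
qed

section \<open>The index of an operator approximated by finite-dimensional pieces\<close>

text \<open>The maps \<open>E n\<close> play the role of increasing finite-rank projections of H
  that commute with T, map into its domain and tend strongly to the identity. \<open>E_null\<close>
  and \<open>E_nonnull\<close> say that they choose canonical representatives: a value of
  \<open>E n\<close> that is null is 0.\<close>

locale approximated_operator =
  fixes M :: "'a measure" and H :: "('a \<Rightarrow> complex) set" and T :: "'a graph"
    and E :: "nat \<Rightarrow> ('a \<Rightarrow> complex) \<Rightarrow> ('a \<Rightarrow> complex)"
  assumes H_subspace: "cfun.subspace H" and null_H: "L2_null M \<subseteq> H"
    and null_subspace: "cfun.subspace (L2_null M)"
    and T_sub: "T \<subseteq> H \<times> H"
    and T_add: "\<And>f g f' g'. (f, g) \<in> T \<Longrightarrow> (f', g') \<in> T \<Longrightarrow> (f + f', g + g') \<in> T"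
    and T_scale: "\<And>f g c. (f, g) \<in> T \<Longrightarrow> (\<lambda>x. c * f x, \<lambda>x. c * g x) \<in> T"
    and T_null: "\<And>f g. f \<in> L2_null M \<Longrightarrow> g \<in> L2_null M \<Longrightarrow> (f, g) \<in> T"
    and T_single: "\<And>f g. (f, g) \<in> T \<Longrightarrow> f \<in> L2_null M \<Longrightarrow> g \<in> L2_null M"
    and E_add: "\<And>n f g. f \<in> H \<Longrightarrow> g \<in> H \<Longrightarrow> E n (f + g) = E n f + E n g"
    and E_scale: "\<And>n f c. f \<in> H \<Longrightarrow> E n (\<lambda>x. c * f x) = (\<lambda>x. c * E n f x)"
    and E_H: "\<And>n f. f \<in> H \<Longrightarrow> E n f \<in> H"
    and E_null: "\<And>n f. f \<in> L2_null M \<Longrightarrow> E n f = 0"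
    and E_nonnull: "\<And>n f. f \<in> H \<Longrightarrow> E n f \<in> L2_null M \<Longrightarrow> E n f = 0"
    and E_comp: "\<And>m n f. f \<in> H \<Longrightarrow> m \<le> n \<Longrightarrow> E n (E m f) = E m f"
    and E_comp': "\<And>m n f. f \<in> H \<Longrightarrow> m \<le> n \<Longrightarrow> E m (E n f) = E m f"
    and E_fin: "\<And>n. \<exists>B. finite B \<and> E n ` H \<subseteq> cfun.span B"
    and E_T: "\<And>n f g. (f, g) \<in> T \<Longrightarrow> (E n f, E n g) \<in> T"
    and E_dom: "\<And>n f. f \<in> H \<Longrightarrow> E n f \<in> Domain T"
    and E_lim: "\<And>f. f \<in> H \<Longrightarrow> (\<lambda>n. L2_norm M (E n f - f)) \<longlonglongrightarrow> 0"
    and null_norm: "\<And>f. f \<in> H \<Longrightarrow> L2_norm M f = 0 \<Longrightarrow> f \<in> L2_null M"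
begin

lemma E_diff: "f \<in> H \<Longrightarrow> g \<in> H \<Longrightarrow> E n (f - g) = E n f - E n g"
  using E_add[of f "\<lambda>x. -1 * g x" n] E_scale[of g n "-1"] cfun.subspace_scale[OF H_subspace, of g "-1"]
  by (simp add: fun_eq_iff fun_diff_def plus_fun_def)

text \<open>The subspaces E n V + W increase between W and V, so they stabilize at some m. Writing E
  n v = E m u + w and applying \<open>E m\<close> gives E m v = E m u + E m w, so the difference is
  w - E m w. This serves both the kernel modulo null functions and H modulo the range of T.\<close>

lemma eventually_constant_mod:
  assumes V: "cfun.subspace V" "V \<subseteq> H" and W: "cfun.subspace W" "W \<subseteq> V"
    and EV: "\<And>n f. f \<in> V \<Longrightarrow> E n f \<in> V" and EW: "\<And>n f. f \<in> W \<Longrightarrow> E n f \<in> W"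
    and dim: "has_quotient_dim V W k"
  shows "\<exists>m. \<forall>n\<ge>m. \<forall>v\<in>V. E n v - E m v \<in> W"
proof -
  define U where "U n = {E n u + w |u w. u \<in> V \<and> w \<in> W}" for n
  have "\<exists>m. \<forall>n\<ge>m. U n = U m"
  proof (rule quotient_chain_stabilizes[OF W(1) dim])
    fix n
    show "cfun.subspace (U n)"
    proof (rule cfun.subspaceI)
      have "0 = E n 0 + 0" using E_null[OF cfun.subspace_0[OF null_subspace]] by simp
      then show "0 \<in> U n" unfolding U_def using cfun.subspace_0[OF V(1)] cfun.subspace_0[OF W(1)] by blast
    next
      fix x y assume "x \<in> U n" "y \<in> U n"
      then obtain u w u' w' where *: "x = E n u + w" "y = E n u' + w'" "u \<in> V" "u' \<in> V" "w \<in> W" "w' \<in> W"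
        unfolding U_def by blast
      then have "u \<in> H" "u' \<in> H" using V(2) by auto
      then have "x + y = E n (u + u') + (w + w')" using * by (simp add: E_add)
      then show "x + y \<in> U n" unfolding U_def
        using * cfun.subspace_add[OF V(1)] cfun.subspace_add[OF W(1)] by blast
    next
      fix c x assume "x \<in> U n"
      then obtain u w where *: "x = E n u + w" "u \<in> V" "w \<in> W" unfolding U_def by blast
      then have "(\<lambda>z. c * x z) = E n (\<lambda>z. c * u z) + (\<lambda>z. c * w z)"
        using V(2) E_scale[of u] by (auto simp: algebra_simps fun_eq_iff)
      then show "(\<lambda>z. c * x z) \<in> U n" unfolding U_def
        using * cfun.subspace_scale[OF V(1)] cfun.subspace_scale[OF W(1)] by blast
    qed
    show "W \<subseteq> U n"
    proof
      fix w assume "w \<in> W"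
      moreover have "w = E n 0 + w" using E_null[OF cfun.subspace_0[OF null_subspace]] by simp
      ultimately show "w \<in> U n" unfolding U_def using cfun.subspace_0[OF V(1)] by blast
    qed
    show "U n \<subseteq> V" unfolding U_def using EV W(2) cfun.subspace_add[OF V(1)] by blast
  next
    show "incseq U"
    proof (rule monoI)
      fix m n :: nat assume mn: "m \<le> n"
      show "U m \<subseteq> U n"
      proof
        fix x assume "x \<in> U m"
        then obtain u w where *: "x = E m u + w" "u \<in> V" "w \<in> W" unfolding U_def by blast
        then have "x = E n (E m u) + w" using E_comp[of u m n] mn V(2) by auto
        then show "x \<in> U n" unfolding U_def using * EV by blast
      qed
    qed
  qed
  then obtain m where m: "\<And>n. m \<le> n \<Longrightarrow> U n = U m" by blast
  have "E n v - E m v \<in> W" if "m \<le> n" "v \<in> V" for n v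
  proof -
    have "E n v = E n v + 0" by simp
    then have "E n v \<in> U n" unfolding U_def using that cfun.subspace_0[OF W(1)] by blast
    then have "E n v \<in> U m" unfolding m[OF that(1)] .
    then obtain u w where uw: "E n v = E m u + w" "u \<in> V" "w \<in> W"
      unfolding U_def by blast
    have "E m v = E m (E n v)" using that V(2) by (auto simp: E_comp')
    also have "\<dots> = E m u + E m w"
    proof -
      have "u \<in> H" "w \<in> H" using uw V(2) W(2) by auto
      then show ?thesis using E_H by (simp add: uw(1) E_add E_comp)
    qed
    finally have "E n v - E m v = w - E m w" using uw by simp
    then show ?thesis using uw(3) EW cfun.subspace_diff[OF W(1)] by simp
  qed
  then show ?thesis by blast
qed

section \<open>The operator on the finite-dimensional pieces\<close>

lemma T_diff: "(f, g) \<in> T \<Longrightarrow> (f', g') \<in> T \<Longrightarrow> (f - f', g - g') \<in> T"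
  using T_add[of f g "\<lambda>x. -1 * f' x" "\<lambda>x. -1 * g' x"] T_scale[of f' g' "-1"]
  by (simp add: fun_diff_def plus_fun_def)

text \<open>T determines an image only up to null functions. Inside the range of \<open>E n\<close>
  this ambiguity disappears, because the difference of two candidates is again a value of
  \<open>E n\<close>.\<close>

lemma T_single_on_range:
  assumes "(f, g) \<in> T" "(f, g') \<in> T" "g \<in> E n ` H" "g' \<in> E n ` H"
  shows "g = g'"
proof -
  obtain u u' where u: "u \<in> H" "u' \<in> H" "g = E n u" "g' = E n u'" using assms by blast
  have eq: "g - g' = E n (u - u')" using u by (simp add: E_diff)
  have "(f - f, g - g') \<in> T" using assms T_diff by blast
  then have "g - g' \<in> L2_null M" using T_single cfun.subspace_0[OF null_subspace] by force
  then have "g - g' = 0" using E_nonnull[of "u - u'" n] cfun.subspace_diff[OF H_subspace] u eq by simp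
  then show ?thesis by simp
qed

lemma subspace_range_E: "cfun.subspace (E n ` H)"
proof (rule cfun.subspaceI)
  show "0 \<in> E n ` H"
    using E_null[OF cfun.subspace_0[OF null_subspace], of n] cfun.subspace_0[OF H_subspace] by force
  show "x + y \<in> E n ` H" if "x \<in> E n ` H" "y \<in> E n ` H" for x y
    using that E_add[symmetric] cfun.subspace_add[OF H_subspace] by auto
  show "(\<lambda>z. c * x z) \<in> E n ` H" if "x \<in> E n ` H" for c x
    using that E_scale[symmetric] cfun.subspace_scale[OF H_subspace] by auto
qed

lemma subspace_Range_T: "cfun.subspace (Range T)"
  using T_add T_scale T_null[OF cfun.subspace_0[OF null_subspace] cfun.subspace_0[OF null_subspace]]
  by (intro cfun.subspaceI) blast+

lemma subspace_kernel: "cfun.subspace {f \<in> H. (f, 0) \<in> T}"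
proof (rule cfun.subspaceI)
  show "0 \<in> {f \<in> H. (f, 0) \<in> T}"
    using T_null[OF cfun.subspace_0[OF null_subspace] cfun.subspace_0[OF null_subspace]]
      cfun.subspace_0[OF H_subspace] by simp
  show "x + y \<in> {f \<in> H. (f, 0) \<in> T}" if "x \<in> {f \<in> H. (f, 0) \<in> T}" "y \<in> {f \<in> H. (f, 0) \<in> T}" for x y
    using that T_add[of x 0 y 0] cfun.subspace_add[OF H_subspace] by simp
  show "(\<lambda>z. c * x z) \<in> {f \<in> H. (f, 0) \<in> T}" if "x \<in> {f \<in> H. (f, 0) \<in> T}" for x c
    using that T_scale[of x 0 c] cfun.subspace_scale[OF H_subspace] by (simp add: zero_fun_def)
qed

text \<open>T induces an endomorphism of the finite-dimensional space E n H, whose kernel is spanned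
  by \<open>B\<close> and whose image has a complement spanned by \<open>C\<close>. The complement
  is stated against all of \<open>Range T\<close>, as needed for the cokernel of T; this is the
  same, since an element of E n H in the range of T already has a preimage in E n H.\<close>

lemma finite_rank_nullity:
  "\<exists>B C d. finite B \<and> cfun.independent B \<and> cfun.span B = {f \<in> E n ` H. (f, 0) \<in> T} \<and> card B = d \<and>
     finite C \<and> cfun.independent C \<and> C \<subseteq> E n ` H \<and> card C = d \<and>
     cfun.span C \<inter> {g \<in> E n ` H. g \<in> Range T} = {0} \<and>
     (\<forall>v\<in>E n ` H. \<exists>c\<in>cfun.span C. v - c \<in> Range T)"
proof -
  let ?F = "E n ` H" and ?K = "{f \<in> E n ` H. (f, 0) \<in> T}"
  obtain B0 where B0: "finite B0" "?F \<subseteq> cfun.span B0" using E_fin by blast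
  have fin: "finite B" if "cfun.independent B" "B \<subseteq> ?F" for B
    using that cfun.independent_span_bound[OF B0(1), of B] B0(2) by blast
  have subF: "cfun.subspace ?F" by (rule subspace_range_E)
  have "?K = ?F \<inter> {f \<in> H. (f, 0) \<in> T}" using E_H by auto
  then have subK: "cfun.subspace ?K" using cfun.subspace_inter[OF subF subspace_kernel] by simp
  obtain B where B: "B \<subseteq> ?K" "cfun.independent B" "?K \<subseteq> cfun.span B"
    using cfun.maximal_independent_subset by blast
  have spB: "cfun.span B = ?K" using B cfun.span_minimal[OF B(1) subK] by blast
  obtain A where A: "B \<subseteq> A" "A \<subseteq> ?F" "cfun.independent A" "?F \<subseteq> cfun.span A"
    using cfun.maximal_independent_subset_extend[of B ?F] B by blast
  have spA: "cfun.span A = ?F" using A cfun.span_minimal[OF A(2) subF] by blast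
  \<comment> \<open>\<open>E_dom\<close> provides some image of x in H; applying \<open>E n\<close>
    to the pair moves that image into the range of \<open>E n\<close> and leaves x fixed.\<close>
  have "\<exists>y\<in>?F. (x, y) \<in> T" if x: "x \<in> ?F" for x
  proof -
    obtain u where u: "u \<in> H" "x = E n u" using x by blast
    obtain y where "(x, y) \<in> T" using E_dom[of u n] u by blast
    then have "(E n x, E n y) \<in> T" "y \<in> H" using E_T T_sub by auto
    then show ?thesis using E_comp[of u n n] u by auto
  qed
  then obtain t0 where t0: "\<And>x. x \<in> ?F \<Longrightarrow> t0 x \<in> ?F \<and> (x, t0 x) \<in> T" by metis
  obtain t where t: "Vector_Spaces.linear (\<lambda>c f x. c * f x) (\<lambda>c f x. c * f x) t"
      "\<And>x. x \<in> A \<Longrightarrow> t x = t0 x"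
    using linear_extension[OF A(3), of t0] by blast
  interpret t: Vector_Spaces.linear "\<lambda>(c::complex) (f::'a \<Rightarrow> complex) x. c * f x"
      "\<lambda>(c::complex) (f::'a \<Rightarrow> complex) x. c * f x" t by (rule t(1))
  have tT: "t x \<in> ?F \<and> (x, t x) \<in> T" if "x \<in> ?F" for x
    using that[folded spA]
  proof (induction rule: cfun.span_induct_alt)
    case base
    show ?case unfolding t.zero using cfun.subspace_0[OF subF] T_null cfun.subspace_0[OF null_subspace] by blast
  next
    case (step c x y)
    then have x: "t x \<in> ?F" "(x, t x) \<in> T" using t t0 A by auto
    then have "(\<lambda>z. c * t x z) + t y \<in> ?F" "((\<lambda>z. c * x z) + y, (\<lambda>z. c * t x z) + t y) \<in> T"
      using step T_add T_scale cfun.subspace_add[OF subF] cfun.subspace_scale[OF subF] by auto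
    then show ?case unfolding t.add t.scale by blast
  qed
  have tK: "t x = 0 \<longleftrightarrow> x \<in> ?K" if "x \<in> ?F" for x
    using that tT[OF that] T_single_on_range[of x "t x" 0 n] cfun.subspace_0[OF subF] by auto
  let ?D = "A - B"
  have dec: "\<exists>x\<in>cfun.span B. \<exists>y\<in>cfun.span ?D. v = x + y" if "v \<in> ?F" for v
  proof -
    have "v \<in> cfun.span (B \<union> ?D)" using that spA A(1) by (simp add: Un_absorb1)
    then show ?thesis unfolding cfun.span_Un by blast
  qed
  have inj: "inj_on t (cfun.span ?D)"
  proof (rule inj_onI)
    fix x y assume xy: "x \<in> cfun.span ?D" "y \<in> cfun.span ?D" "t x = t y"
    let ?z = "x - y"
    have zD: "?z \<in> cfun.span ?D" using xy cfun.span_diff by blast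
    then have "?z \<in> ?F" using spA cfun.span_mono[of ?D A] by blast
    then have "?z \<in> cfun.span B" using tK[of ?z] xy spB by (simp add: t.diff)
    then have "?z = 0"
      using zD by (intro independent_span_Int[OF A(3) A(1), of ?D]) blast+
    then show "x = y" by simp
  qed
  let ?R = "t ` ?D"
  have indR: "cfun.independent ?R"
    by (rule independent_image[OF t(1) cfun.independent_mono[OF A(3) Diff_subset] inj])
  have RF: "?R \<subseteq> ?F" using tT A(2) by auto
  \<comment> \<open>A preimage of g may lie outside the finite-dimensional piece; \<open>E n\<close>
    replaces it by one inside, since it fixes g. The part of it in the span of \<open>B\<close> is
    killed by \<open>t\<close>.\<close>
  have ran: "g \<in> cfun.span ?R" if g: "g \<in> ?F" "g \<in> Range T" for g
  proof -
    obtain f where f: "(f, g) \<in> T" using g by blast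
    have "E n g = g" using g(1) E_comp by auto
    then have fg: "(E n f, g) \<in> T" "E n f \<in> ?F" using E_T[OF f, of n] T_sub f by auto
    then have g': "g = t (E n f)" using T_single_on_range[of "E n f" g "t (E n f)" n] tT g by blast
    obtain x y where xy: "x \<in> cfun.span B" "y \<in> cfun.span ?D" "E n f = x + y" using dec fg(2) by blast
    have "t x = 0" using tK xy(1) spB by auto
    then have "g = t y" using g' xy(3) by (simp add: t.add)
    then show ?thesis using xy(2) by (simp add: t.span_image)
  qed
  obtain G where G: "?R \<subseteq> G" "G \<subseteq> ?F" "cfun.independent G" "?F \<subseteq> cfun.span G"
    using cfun.maximal_independent_subset_extend[OF RF indR] by blast
  have spG: "cfun.span G = ?F" using G cfun.span_minimal[OF G(2) subF] by blast
  have finA: "finite A" "finite G" using fin A G by auto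
  \<comment> \<open>\<open>A\<close> and \<open>G\<close> are bases of the same space, and
    \<open>?R\<close> has as many elements as \<open>A - B\<close>; what remains of \<open>G\<close>
    therefore has the cardinality of \<open>B\<close>.\<close>
  have "card A = card G"
    using cfun.independent_span_bound[OF finA(1) G(3)] cfun.independent_span_bound[OF finA(2) A(3)]
      A(2,4) G(2,4) spG spA by force
  moreover have "card ?R = card ?D"
    by (rule card_image[OF inj_on_subset[OF inj cfun.span_superset]])
  moreover have "card ?D = card A - card B" "card B \<le> card A"
    using A(1) finA by (auto simp: card_Diff_subset finite_subset card_mono)
  moreover have "card (G - ?R) = card G - card ?R" "card ?R \<le> card G"
    using G(1) finA by (auto simp: card_Diff_subset finite_subset card_mono)
  ultimately have card: "card (G - ?R) = card B" by simp
  have int: "cfun.span (G - ?R) \<inter> {g \<in> ?F. g \<in> Range T} = {0}"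
  proof -
    have "x = 0" if "x \<in> cfun.span (G - ?R)" "x \<in> cfun.span ?R" for x
      using that by (intro independent_span_Int[OF G(3) G(1), of "G - ?R"]) blast+
    then show ?thesis using ran cfun.span_zero cfun.subspace_0[OF subF] cfun.subspace_0[OF subspace_Range_T] by auto
  qed
  have cov: "\<exists>c\<in>cfun.span (G - ?R). v - c \<in> Range T" if "v \<in> ?F" for v
  proof -
    have "v \<in> cfun.span (?R \<union> (G - ?R))" using that spG G(1) by (simp add: Un_absorb1)
    then obtain x y where xy: "x \<in> cfun.span ?R" "y \<in> cfun.span (G - ?R)" "v = x + y"
      unfolding cfun.span_Un by blast
    have "?R \<subseteq> Range T" using tT A(2) by blast
    then have "x \<in> Range T" using xy(1) cfun.span_minimal[OF _ subspace_Range_T] by blast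
    then show ?thesis using xy by (intro bexI[of _ y]) auto
  qed
  show ?thesis
    by (rule exI[of _ B], rule exI[of _ "G - ?R"], rule exI[of _ "card B"])
      (use finA B(2) spB card int cov G(2) finite_subset[OF A(1) finA(1)] cfun.independent_mono[OF G(3), of "G - ?R"] in auto)
qed

text \<open>The differences E n v - E m v lie in W and converge to v - E m v, so closedness of W
  suffices. It is applied to the range of T, whose closedness is part of being Fredholm.\<close>

lemma approximated_mod:
  assumes closed: "\<And>g h. (\<And>n::nat. g n \<in> W) \<Longrightarrow> h \<in> H \<Longrightarrow> (\<lambda>n. L2_norm M (g n - h)) \<longlonglongrightarrow> 0 \<Longrightarrow> h \<in> W"
    and m: "\<And>n. m \<le> n \<Longrightarrow> E n v - E m v \<in> W" and v: "v \<in> H"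
  shows "v - E m v \<in> W"
proof (rule closed)
  show "E (n + m) v - E m v \<in> W" for n using m by simp
  show "v - E m v \<in> H" using v E_H cfun.subspace_diff[OF H_subspace] by blast
  have "(\<lambda>n. L2_norm M (E (n + m) v - v)) \<longlonglongrightarrow> 0" by (rule LIMSEQ_ignore_initial_segment[OF E_lim[OF v]])
  then show "(\<lambda>n. L2_norm M (E (n + m) v - E m v - (v - E m v))) \<longlonglongrightarrow> 0" by simp
qed

text \<open>For large m every kernel vector agrees with its image under \<open>E m\<close> modulo
  null functions, and every vector of H does so modulo the range of T. The sets \<open>B\<close> and
  \<open>C\<close> of \<open>finite_rank_nullity\<close> at this level then compute both quotient
  dimensions, and they are equally large.\<close>

theorem fredholm_index_zero:
  assumes "has_fredholm_index M H T k"
  shows "k = 0"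
proof -
  let ?K = "{f \<in> H. (f, 0) \<in> T}" and ?Z = "L2_null M" and ?R = "Range T"
  have closed: "h \<in> ?R" if "\<And>n::nat. g n \<in> ?R" "h \<in> H" "(\<lambda>n. L2_norm M (g n - h)) \<longlonglongrightarrow> 0" for g h
    using assms that unfolding has_fredholm_index_def by blast
  obtain a b where ab: "has_quotient_dim ?K ?Z a" "has_quotient_dim H ?R b" "k = int a - int b"
    using assms unfolding has_fredholm_index_def by blast
  have RH: "?R \<subseteq> H" using T_sub by auto
  have ZK: "?Z \<subseteq> ?K" using T_null cfun.subspace_0[OF null_subspace] null_H by auto
  have EK: "E n f \<in> ?K" if "f \<in> ?K" for n f
    using that E_T[of f 0 n] E_H E_null[OF cfun.subspace_0[OF null_subspace]] by auto
  have EZ: "E n f \<in> ?Z" if "f \<in> ?Z" for n f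
    using E_null[OF that] cfun.subspace_0[OF null_subspace] by simp
  have ER: "E n f \<in> ?R" if "f \<in> ?R" for n f using that E_T by blast
  obtain m1 where m1: "\<And>n v. m1 \<le> n \<Longrightarrow> v \<in> ?K \<Longrightarrow> E n v - E m1 v \<in> ?Z"
    using eventually_constant_mod[OF subspace_kernel _ null_subspace ZK EK EZ ab(1)] by auto
  obtain m2 where m2: "\<And>n v. m2 \<le> n \<Longrightarrow> v \<in> H \<Longrightarrow> E n v - E m2 v \<in> ?R"
    using eventually_constant_mod[OF H_subspace _ subspace_Range_T RH E_H ER ab(2)] by auto
  have 1: "v - E m1 v \<in> ?Z" if "v \<in> ?K" for v
  proof -
    have v: "v \<in> H" using that by simp
    \<comment> \<open>E n v - E m1 v is the value of \<open>E n\<close> at v - E m1 v; being null,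
      it is exactly 0.\<close>
    have const: "E n v = E m1 v" if "m1 \<le> n" for n
    proof -
      have "E n (v - E m1 v) = E n v - E m1 v"
        using v that E_H E_comp[of v m1 n] by (simp add: E_diff)
      moreover have "v - E m1 v \<in> H" using v E_H cfun.subspace_diff[OF H_subspace] by blast
      ultimately show ?thesis using E_nonnull[of "v - E m1 v" n] m1[OF that \<open>v \<in> ?K\<close>] by simp
    qed
    have eq: "(\<lambda>n. L2_norm M (E (n + m1) v - v)) = (\<lambda>n. L2_norm M (E m1 v - v))"
      by (intro ext arg_cong[of _ _ "L2_norm M"] arg_cong2[of _ _ v v minus] const) auto
    have "(\<lambda>n::nat. L2_norm M (E m1 v - v)) \<longlonglongrightarrow> 0"
      using LIMSEQ_ignore_initial_segment[OF E_lim[OF v], of m1] unfolding eq .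
    then have "L2_norm M (E m1 v - v) = 0" by (rule LIMSEQ_unique[OF tendsto_const])
    then have "E m1 v - v \<in> ?Z" using null_norm v E_H cfun.subspace_diff[OF H_subspace] by blast
    then show ?thesis using cfun.subspace_neg[OF null_subspace, of "E m1 v - v"] by simp
  qed
  have 2: "v - E m2 v \<in> ?R" if "v \<in> H" for v
  proof (rule approximated_mod)
    show "h \<in> ?R" if "\<And>n::nat. g n \<in> ?R" "h \<in> H" "(\<lambda>n. L2_norm M (g n - h)) \<longlonglongrightarrow> 0" for g h
      using closed that .
  qed (use that m2 in blast)+
  define m where "m = max m1 m2"
  \<comment> \<open>The relations found at \<open>m1\<close> and \<open>m2\<close> persist at the
    common level m: applying \<open>E m\<close> to them compares E m v with E m1 v here, and with E
    m2 v in the next step.\<close>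
  have 3: "v - E m v \<in> ?Z" if "v \<in> ?K" for v
  proof -
    have v: "v \<in> H" and le: "m1 \<le> m" using that by (auto simp: m_def)
    have "E m (v - E m1 v) = 0" using 1[OF that] E_null by simp
    then have "E m v = E m1 v" using v le E_H E_comp[of v m1 m] by (simp add: E_diff)
    then show ?thesis using 1[OF that] by simp
  qed
  have 4: "v - E m v \<in> ?R" if v: "v \<in> H" for v
  proof -
    have le: "m2 \<le> m" by (auto simp: m_def)
    have "E m (v - E m2 v) \<in> ?R" using 2[OF v] ER by blast
    then have "E m v - E m2 v \<in> ?R" using v le E_H E_comp[of v m2 m] by (simp add: E_diff)
    then have "(v - E m2 v) - (E m v - E m2 v) \<in> ?R" using 2[OF v] cfun.subspace_diff[OF subspace_Range_T] by blast
    then show ?thesis by simp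
  qed
  obtain B C d where BC: "finite B" "cfun.independent B" "cfun.span B = {f \<in> E m ` H. (f, 0) \<in> T}" "card B = d"
     "finite C" "cfun.independent C" "C \<subseteq> E m ` H" "card C = d"
     "cfun.span C \<inter> {g \<in> E m ` H. g \<in> Range T} = {0}"
     "\<forall>v\<in>E m ` H. \<exists>c\<in>cfun.span C. v - c \<in> Range T"
    using finite_rank_nullity[of m] by blast
  have FH: "E m ` H \<subseteq> H" using E_H by auto
  have "has_quotient_dim ?K ?Z d"
    unfolding has_quotient_dim_def
  proof (intro exI[of _ B] conjI ballI)
    show "B \<subseteq> ?K" using BC(3) FH cfun.span_superset[of B] by blast
    show "cfun.span B \<inter> ?Z = {0}"
      using BC(3) E_nonnull cfun.span_zero[of B] cfun.subspace_0[OF null_subspace] by auto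
    fix v assume v: "v \<in> ?K"
    have "E m v \<in> cfun.span B" using EK[OF v] v BC(3) by blast
    then show "\<exists>b\<in>cfun.span B. v - b \<in> ?Z" using 3[OF v] by blast
  qed (use BC in auto)
  then have "a = d" using ab(1) has_quotient_dim_unique[OF null_subspace] by blast
  have "has_quotient_dim H ?R d"
    unfolding has_quotient_dim_def
  proof (intro exI[of _ C] conjI ballI)
    show "C \<subseteq> H" using BC(7) FH by blast
    have "cfun.span C \<subseteq> E m ` H" using cfun.span_minimal[OF BC(7) subspace_range_E] .
    then show "cfun.span C \<inter> ?R = {0}" using BC(9) by blast
    fix v assume v: "v \<in> H"
    obtain c where c: "c \<in> cfun.span C" "E m v - c \<in> ?R" using BC(10) v by blast
    have "(v - E m v) + (E m v - c) \<in> ?R" using 4[OF v] c(2) cfun.subspace_add[OF subspace_Range_T] by blast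
    then show "\<exists>c\<in>cfun.span C. v - c \<in> ?R" using c(1) by (intro bexI[of _ c]) auto
  qed (use BC in auto)
  then have "b = d" using ab(2) has_quotient_dim_unique[OF subspace_Range_T] by blast
  then show ?thesis using ab(3) \<open>a = d\<close> by simp
qed

end

section \<open>Square-integrable functions\<close>

lemma L2_measurable [measurable_dest]: "f \<in> L2 M \<Longrightarrow> f \<in> borel_measurable M"
  and L2_integrable: "f \<in> L2 M \<Longrightarrow> integrable M (\<lambda>x. (cmod (f x))\<^sup>2)"
  by (auto simp: L2_def)

lemma L2_I_bound:
  assumes "f \<in> borel_measurable M" "integrable M b" "\<And>x. x \<in> space M \<Longrightarrow> (cmod (f x))\<^sup>2 \<le> b x"
  shows "f \<in> L2 M"
  unfolding L2_def
proof (intro CollectI conjI assms(1) Bochner_Integration.integrable_bound[OF assms(2)])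
  show "(\<lambda>x. (cmod (f x))\<^sup>2) \<in> borel_measurable M" using assms(1) by measurable
  show "AE x in M. norm ((cmod (f x))\<^sup>2) \<le> norm (b x)"
    by (rule AE_I2) (use assms(3) in force)
qed

lemma L2_zero: "0 \<in> L2 M"
  by (rule L2_I_bound[of _ _ "\<lambda>_. 0"]) (auto simp: zero_fun_def)

lemma L2_scale: "f \<in> L2 M \<Longrightarrow> (\<lambda>x. c * f x) \<in> L2 M"
  by (rule L2_I_bound[of _ _ "\<lambda>x. (cmod c)\<^sup>2 * (cmod (f x))\<^sup>2"])
    (auto simp: norm_mult power_mult_distrib L2_integrable L2_measurable)

lemma L2_add:
  assumes "f \<in> L2 M" "g \<in> L2 M"
  shows "f + g \<in> L2 M"
proof (rule L2_I_bound[of _ _ "\<lambda>x. 2 * (cmod (f x))\<^sup>2 + 2 * (cmod (g x))\<^sup>2"])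
  show "f + g \<in> borel_measurable M" unfolding plus_fun_def using assms by (auto simp: L2_measurable)
  show "integrable M (\<lambda>x. 2 * (cmod (f x))\<^sup>2 + 2 * (cmod (g x))\<^sup>2)"
    using assms by (intro Bochner_Integration.integrable_add integrable_mult_right L2_integrable)
  fix x
  have "(cmod (f x + g x))\<^sup>2 \<le> (cmod (f x) + cmod (g x))\<^sup>2"
    by (intro power_mono norm_triangle_ineq norm_ge_zero)
  also have "\<dots> \<le> 2 * (cmod (f x))\<^sup>2 + 2 * (cmod (g x))\<^sup>2"
    using zero_le_power2[of "cmod (f x) - cmod (g x)"] by (simp add: power2_sum power2_diff)
  finally show "(cmod ((f + g) x))\<^sup>2 \<le> 2 * (cmod (f x))\<^sup>2 + 2 * (cmod (g x))\<^sup>2" by simp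
qed

lemma subspace_L2: "cfun.subspace (L2 M)"
  by (rule cfun.subspaceI) (auto intro: L2_zero L2_add L2_scale)

lemmas L2_diff = cfun.subspace_diff[OF subspace_L2]

lemma L2_sum: "(\<And>i. i \<in> I \<Longrightarrow> f i \<in> L2 M) \<Longrightarrow> (\<Sum>i\<in>I. f i) \<in> L2 M"
  by (rule cfun.subspace_sum[OF subspace_L2])

lemma borel_measurable_cnj [measurable]:
  "f \<in> borel_measurable M \<Longrightarrow> (\<lambda>x. cnj (f x)) \<in> borel_measurable M"
  by (rule measurable_compose[OF _ borel_measurable_continuous_onI]) (auto intro: continuous_intros)

lemma L2_cnj: "f \<in> L2 M \<Longrightarrow> (\<lambda>x. cnj (f x)) \<in> L2 M"
  by (rule L2_I_bound[of _ _ "\<lambda>x. (cmod (f x))\<^sup>2"])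
    (auto simp: L2_integrable intro!: borel_measurable_cnj L2_measurable)

lemma L2_mult_integrable:
  assumes "f \<in> L2 M" "g \<in> L2 M"
  shows "integrable M (\<lambda>x. f x * g x)"
proof (rule Bochner_Integration.integrable_bound)
  show "integrable M (\<lambda>x. (cmod (f x))\<^sup>2 + (cmod (g x))\<^sup>2)"
    using assms by (intro Bochner_Integration.integrable_add integrable_mult_right L2_integrable)
  show "(\<lambda>x. f x * g x) \<in> borel_measurable M" using assms by (auto simp: L2_measurable)
  have "norm (f x * g x) \<le> norm ((cmod (f x))\<^sup>2 + (cmod (g x))\<^sup>2)" for x
  proof -
    have "0 \<le> cmod (f x) * cmod (g x)" by simp
    then have "cmod (f x) * cmod (g x) \<le> (cmod (f x))\<^sup>2 + (cmod (g x))\<^sup>2"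
      using sum_squares_bound[of "cmod (f x)" "cmod (g x)"] by linarith
    then show ?thesis by (simp add: norm_mult)
  qed
  then show "AE x in M. norm (f x * g x) \<le> norm ((cmod (f x))\<^sup>2 + (cmod (g x))\<^sup>2)" by simp
qed

lemma L2_inner_integrable: "f \<in> L2 M \<Longrightarrow> g \<in> L2 M \<Longrightarrow> integrable M (\<lambda>x. f x * cnj (g x))"
  using L2_mult_integrable L2_cnj by blast

section \<open>Norm and inner product\<close>

lemma L2_norm_nonneg: "0 \<le> L2_norm M f"
  by (simp add: L2_norm_def integral_nonneg_AE)

lemma L2_norm_square: "(L2_norm M f)\<^sup>2 = (\<integral>x. (cmod (f x))\<^sup>2 \<partial>M)"
  by (simp add: L2_norm_def integral_nonneg_AE)

lemma L2_inner_self: "L2_inner M f f = of_real ((L2_norm M f)\<^sup>2)"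
  by (simp add: L2_inner_def L2_norm_square complex_norm_square[symmetric] flip: integral_complex_of_real)

lemma L2_inner_commute: "L2_inner M f g = cnj (L2_inner M g f)"
proof -
  have "cnj (L2_inner M g f) = (\<integral>x. cnj (g x * cnj (f x)) \<partial>M)"
    unfolding L2_inner_def by (rule Bochner_Integration.integral_cnj[symmetric])
  then show ?thesis by (simp add: L2_inner_def mult.commute)
qed

lemma L2_inner_add_left:
  "f \<in> L2 M \<Longrightarrow> g \<in> L2 M \<Longrightarrow> h \<in> L2 M \<Longrightarrow> L2_inner M (f + g) h = L2_inner M f h + L2_inner M g h"
  by (simp add: L2_inner_def distrib_right L2_inner_integrable)

lemma L2_inner_add_right:
  "f \<in> L2 M \<Longrightarrow> g \<in> L2 M \<Longrightarrow> h \<in> L2 M \<Longrightarrow> L2_inner M h (f + g) = L2_inner M h f + L2_inner M h g"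
  by (simp add: L2_inner_def distrib_left L2_inner_integrable)

lemma L2_inner_scale_right: "L2_inner M h (\<lambda>x. c * f x) = cnj c * L2_inner M h f"
  by (simp add: L2_inner_def mult.left_commute flip: integral_mult_right_zero)

lemma L2_inner_diff_right:
  "f \<in> L2 M \<Longrightarrow> g \<in> L2 M \<Longrightarrow> h \<in> L2 M \<Longrightarrow> L2_inner M h (f - g) = L2_inner M h f - L2_inner M h g"
  by (simp add: L2_inner_def right_diff_distrib L2_inner_integrable)

lemma L2_inner_sum_right:
  assumes "finite I" "\<And>i. i \<in> I \<Longrightarrow> f i \<in> L2 M" "h \<in> L2 M"
  shows "L2_inner M h (\<Sum>i\<in>I. f i) = (\<Sum>i\<in>I. L2_inner M h (f i))"
  using assms
proof (induction I)
  case empty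
  show ?case by (simp add: L2_inner_def)
next
  case (insert a I)
  then show ?case by (simp add: L2_inner_add_right L2_sum del: plus_fun_apply)
qed

lemma L2_inner_cong_AE: "f \<in> borel_measurable M \<Longrightarrow> f' \<in> borel_measurable M \<Longrightarrow>
    g \<in> borel_measurable M \<Longrightarrow> g' \<in> borel_measurable M \<Longrightarrow>
    AE x in M. f x = f' x \<Longrightarrow> AE x in M. g x = g' x \<Longrightarrow> L2_inner M f g = L2_inner M f' g'"
  unfolding L2_inner_def by (intro integral_cong_AE borel_measurable_times borel_measurable_cnj) auto

lemma L2_norm_eq_0_iff:
  assumes "f \<in> L2 M" shows "L2_norm M f = 0 \<longleftrightarrow> (AE x in M. f x = 0)"
  using integral_nonneg_eq_0_iff_AE[OF L2_integrable[OF assms]] by (simp add: L2_norm_def)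

text \<open>The integral of (s |f| - |g|)^2 is a nonnegative quadratic polynomial in s. Working with
  moduli keeps the polynomial real.\<close>

lemma L2_Cauchy_Schwarz:
  assumes f: "f \<in> L2 M" and g: "g \<in> L2 M"
  shows "cmod (L2_inner M f g) \<le> L2_norm M f * L2_norm M g"
proof -
  let ?I = "\<integral>x. cmod (f x) * cmod (g x) \<partial>M"
  let ?A = "(L2_norm M f)\<^sup>2" and ?B = "(L2_norm M g)\<^sup>2"
  have int: "integrable M (\<lambda>x. cmod (f x) * cmod (g x))"
    using integrable_norm[OF L2_mult_integrable[OF f g]] by (simp add: norm_mult)
  have I0: "0 \<le> ?I" by (simp add: integral_nonneg_AE)
  have quad: "0 \<le> s\<^sup>2 * ?A - 2 * s * ?I + ?B" for s
  proof -
    have "0 \<le> (\<integral>x. (s * cmod (f x) - cmod (g x))\<^sup>2 \<partial>M)" by (simp add: integral_nonneg_AE)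
    also have "\<dots> = (\<integral>x. s\<^sup>2 * (cmod (f x))\<^sup>2 - 2 * s * (cmod (f x) * cmod (g x)) + (cmod (g x))\<^sup>2 \<partial>M)"
      by (simp add: power2_diff power_mult_distrib mult.assoc algebra_simps)
    also have "\<dots> = s\<^sup>2 * ?A - 2 * s * ?I + ?B"
      using int L2_integrable[OF f] L2_integrable[OF g] by (simp add: L2_norm_square)
    finally show ?thesis .
  qed
  have "?I \<le> L2_norm M f * L2_norm M g"
  proof (cases "L2_norm M f = 0")
    case True
    then have "AE x in M. cmod (f x) * cmod (g x) = 0" using L2_norm_eq_0_iff[OF f] by auto
    then have "?I = 0" using int by (subst integral_nonneg_eq_0_iff_AE) auto
    then show ?thesis using True by simp
  next
    case False
    then have A: "?A > 0" using L2_norm_nonneg[of M f] by simp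
    \<comment> \<open>The polynomial is evaluated at its minimum s = I / A.\<close>
    have "I\<^sup>2 \<le> A * B" if "0 < A" "0 \<le> (I / A)\<^sup>2 * A - 2 * (I / A) * I + B" for I A B :: real
      using that by (simp add: field_simps power2_eq_square)
    from this[OF A quad] have "?I\<^sup>2 \<le> ?A * ?B" .
    then have "?I\<^sup>2 \<le> (L2_norm M f * L2_norm M g)\<^sup>2" by (simp add: power_mult_distrib)
    then show ?thesis by (rule power2_le_imp_le) (simp add: L2_norm_nonneg)
  qed
  moreover have "cmod (L2_inner M f g) \<le> ?I"
    unfolding L2_inner_def using integral_norm_bound[of M "\<lambda>x. f x * cnj (g x)"] by (simp add: norm_mult)
  ultimately show ?thesis by linarith
qed

lemma L2_norm_triangle:
  assumes f: "f \<in> L2 M" and g: "g \<in> L2 M"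
  shows "L2_norm M (f + g) \<le> L2_norm M f + L2_norm M g"
proof (rule power2_le_imp_le)
  have "complex_of_real ((L2_norm M (f + g))\<^sup>2) =
      of_real ((L2_norm M f)\<^sup>2) + L2_inner M f g + cnj (L2_inner M f g) + of_real ((L2_norm M g)\<^sup>2)"
    using f g
    by (simp add: L2_inner_self[symmetric] L2_inner_add_left L2_inner_add_right L2_add
        L2_inner_commute[of M g f] del: plus_fun_apply of_real_power)
  then have "(L2_norm M (f + g))\<^sup>2 = (L2_norm M f)\<^sup>2 + 2 * Re (L2_inner M f g) + (L2_norm M g)\<^sup>2"
    by (simp add: complex_eq_iff)
  also have "\<dots> \<le> (L2_norm M f)\<^sup>2 + 2 * (L2_norm M f * L2_norm M g) + (L2_norm M g)\<^sup>2"
    using L2_Cauchy_Schwarz[OF f g] complex_Re_le_cmod[of "L2_inner M f g"] by linarith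
  finally show "(L2_norm M (f + g))\<^sup>2 \<le> (L2_norm M f + L2_norm M g)\<^sup>2" by (simp add: power2_sum)
qed (simp add: L2_norm_nonneg)

lemma L2_norm_scale: "L2_norm M (\<lambda>x. c * f x) = cmod c * L2_norm M f"
  by (simp add: L2_norm_def norm_mult power_mult_distrib real_sqrt_mult)

lemma L2_norm_minus_commute: "L2_norm M (f - g) = L2_norm M (g - f)"
  by (simp add: L2_norm_def norm_minus_commute)

lemma L2_norm_zero: "L2_norm M 0 = 0"
  by (simp add: L2_norm_def)

lemma L2_norm_sum_le:
  assumes "finite I" "\<And>i. i \<in> I \<Longrightarrow> f i \<in> L2 M"
  shows "L2_norm M (\<Sum>i\<in>I. f i) \<le> (\<Sum>i\<in>I. L2_norm M (f i))"
  using assms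
proof (induction I)
  case empty
  show ?case unfolding sum.empty L2_norm_zero by simp
next
  case (insert a I)
  then have "L2_norm M (f a + (\<Sum>i\<in>I. f i)) \<le> L2_norm M (f a) + L2_norm M (\<Sum>i\<in>I. f i)"
    by (intro L2_norm_triangle L2_sum) auto
  then show ?case using insert by (simp del: plus_fun_apply)
qed

lemma L2_norm_dominated_convergence:
  assumes s: "\<And>i. s i \<in> borel_measurable M" and f: "f \<in> borel_measurable M"
    and lim: "\<And>x. x \<in> space M \<Longrightarrow> (\<lambda>i. s i x) \<longlonglongrightarrow> f x"
    and w: "integrable M w" "\<And>i x. x \<in> space M \<Longrightarrow> (cmod (s i x - f x))\<^sup>2 \<le> w x"
  shows "(\<lambda>i::nat. L2_norm M (s i - f)) \<longlonglongrightarrow> 0"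
proof -
  have "(\<lambda>i. \<integral>x. (cmod (s i x - f x))\<^sup>2 \<partial>M) \<longlonglongrightarrow> (\<integral>x. 0 \<partial>M)"
  proof (rule integral_dominated_convergence[where w = w])
    show "AE x in M. (\<lambda>i. (cmod (s i x - f x))\<^sup>2) \<longlonglongrightarrow> 0"
    proof (rule AE_I2)
      fix x assume "x \<in> space M"
      from lim[OF this] have "(\<lambda>i. s i x - f x) \<longlonglongrightarrow> 0" by (rule LIM_zero)
      then have "(\<lambda>i. (cmod (s i x - f x))\<^sup>2) \<longlonglongrightarrow> (cmod 0)\<^sup>2" by (intro tendsto_intros)
      then show "(\<lambda>i. (cmod (s i x - f x))\<^sup>2) \<longlonglongrightarrow> 0" by simp
    qed
  qed (use s f w in auto)
  then have "(\<lambda>i. sqrt (\<integral>x. (cmod (s i x - f x))\<^sup>2 \<partial>M)) \<longlonglongrightarrow> sqrt 0"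
    by (intro tendsto_intros) simp
  then show ?thesis by (simp add: L2_norm_def)
qed

lemma L2_null_eq: "L2_null M = {f \<in> L2 M. L2_norm M f = 0}"
  by (auto simp: L2_null_def L2_norm_eq_0_iff)

lemma subspace_L2_null: "cfun.subspace (L2_null M)"
proof (rule cfun.subspaceI)
  show "0 \<in> L2_null M" by (simp add: L2_null_def L2_zero)
  show "x + y \<in> L2_null M" if "x \<in> L2_null M" "y \<in> L2_null M" for x y
    using that by (auto simp: L2_null_def L2_add simp del: plus_fun_apply) (auto elim: AE_mp)
  show "(\<lambda>z. c * x z) \<in> L2_null M" if "x \<in> L2_null M" for c x
    using that by (auto simp: L2_null_def L2_scale elim: AE_mp)
qed

lemma (in finite_measure) L2_bounded:
  assumes "f \<in> borel_measurable M" "\<And>x. x \<in> space M \<Longrightarrow> cmod (f x) \<le> C"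
  shows "f \<in> L2 M"
  by (rule L2_I_bound[OF assms(1), of "\<lambda>_. C\<^sup>2"]) (auto intro!: power_mono assms(2))

text \<open>With this, the Borel sets of the product space of integer sequences are those of the
  product sigma-algebra, so measurability can be checked coordinate by coordinate.\<close>

instance int :: second_countable_topology
proof
  have "generate_topology (range (\<lambda>x::int. {x})) S" for S
    using generate_topology.UN[of "(\<lambda>x. {x}) ` S" "range (\<lambda>x::int. {x})"]
    by (auto intro: generate_topology.Basis)
  then show "\<exists>B::int set set. countable B \<and> open = generate_topology B"
    by (intro exI[of _ "range (\<lambda>x. {x})"]) (auto simp: discrete_topology_class.open_discrete fun_eq_iff)
qed

lemma sum_fun_apply: "(\<Sum>i\<in>I. f i) x = (\<Sum>i\<in>I. f i x)" for f :: "'i \<Rightarrow> 'a \<Rightarrow> 'b::comm_monoid_add"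
  by (induction I rule: infinite_finite_induct) auto

section \<open>Arithmetic of the p-adic integers\<close>

lemma Zp_mod: "x \<in> Zp p \<Longrightarrow> m \<le> n \<Longrightarrow> x n mod int p ^ m = x m"
proof (induction n)
  case 0
  then have "x 0 \<in> {0..<int p ^ 0}" by (simp only: Zp_def mem_Collect_eq)
  then show ?case using 0 by simp
next
  case (Suc n)
  show ?case
  proof (cases "m = Suc n")
    case True
    have "x (Suc n) \<in> {0..<int p ^ Suc n}" using Suc.prems(1) by (simp only: Zp_def mem_Collect_eq)
    then show ?thesis unfolding True by (simp del: power_Suc)
  next
    case False
    then have le: "m \<le> n" using Suc.prems by simp
    have "x (Suc n) mod int p ^ m = x (Suc n) mod int p ^ n mod int p ^ m"
      using le by (simp add: mod_mod_cancel le_imp_power_dvd)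
    also have "\<dots> = x m" using Suc le by (simp add: Zp_def)
    finally show ?thesis .
  qed
qed

lemma Zp_range: "x \<in> Zp p \<Longrightarrow> 0 \<le> x n \<and> x n < int p ^ n"
  by (auto simp: Zp_def)

lemma Zp_mod_self: "x \<in> Zp p \<Longrightarrow> x n mod int p ^ n = x n"
  using Zp_range by simp

lemma Zp_eq_mono: "x \<in> Zp p \<Longrightarrow> y \<in> Zp p \<Longrightarrow> m \<le> n \<Longrightarrow> x n = y n \<Longrightarrow> x m = y m"
  by (metis Zp_mod)

text \<open>The dense copy of the integers in Z_p. For 0 <= a < p^n it supplies the representative
  of \<open>coset p n a\<close> at which step functions are evaluated.\<close>

definition zp_of_int :: "nat \<Rightarrow> int \<Rightarrow> padic" where
  "zp_of_int p a = (\<lambda>n. a mod int p ^ n)"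

text \<open>The ball a + p^n Z_p when a is a reduced residue, and the empty set for every other
  a.\<close>

definition coset :: "nat \<Rightarrow> nat \<Rightarrow> int \<Rightarrow> padic set" where
  "coset p n a = {x \<in> Zp p. x n = a}"

text \<open>Values off Z_p are pinned to 0 so that a step function is determined as a total function
  and equality almost everywhere can become equality.\<close>

definition step :: "nat \<Rightarrow> nat \<Rightarrow> (padic \<Rightarrow> complex) set" where
  "step p n = {g. (\<forall>x. x \<notin> Zp p \<longrightarrow> g x = 0) \<and> (\<forall>x\<in>Zp p. \<forall>y\<in>Zp p. x n = y n \<longrightarrow> g x = g y)}"

lemma step_I:
  assumes "\<And>x. x \<notin> Zp p \<Longrightarrow> g x = 0"
    and "\<And>x y. x \<in> Zp p \<Longrightarrow> y \<in> Zp p \<Longrightarrow> x n = y n \<Longrightarrow> g x = g y"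
  shows "g \<in> step p n"
  unfolding step_def using assms by blast

lemma step_outside: "g \<in> step p n \<Longrightarrow> x \<notin> Zp p \<Longrightarrow> g x = 0"
  and step_eq: "g \<in> step p n \<Longrightarrow> x \<in> Zp p \<Longrightarrow> y \<in> Zp p \<Longrightarrow> x n = y n \<Longrightarrow> g x = g y"
  unfolding step_def by blast+

context
  fixes p :: nat
  assumes p_pos: "0 < p"
begin

lemma zp_of_int_in: "zp_of_int p a \<in> Zp p"
  using p_pos by (auto simp: Zp_def zp_of_int_def mod_mod_cancel le_imp_power_dvd)

lemma zp_add_in: "x \<in> Zp p \<Longrightarrow> y \<in> Zp p \<Longrightarrow> zp_add p x y \<in> Zp p"
proof -
  assume x: "x \<in> Zp p" and y: "y \<in> Zp p"
  have "(x (Suc n) + y (Suc n)) mod int p ^ Suc n mod int p ^ n = (x n + y n) mod int p ^ n" for n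
  proof -
    have "(x (Suc n) + y (Suc n)) mod int p ^ Suc n mod int p ^ n = (x (Suc n) + y (Suc n)) mod int p ^ n"
      by (simp add: mod_mod_cancel)
    also have "\<dots> = (x (Suc n) mod int p ^ n + y (Suc n) mod int p ^ n) mod int p ^ n" by (simp add: mod_add_eq)
    finally show ?thesis using x y Zp_mod[of _ p n "Suc n"] by simp
  qed
  then show ?thesis using p_pos by (simp add: Zp_def zp_add_def)
qed

lemma zp_diff_in: "x \<in> Zp p \<Longrightarrow> y \<in> Zp p \<Longrightarrow> zp_diff p x y \<in> Zp p"
proof -
  assume x: "x \<in> Zp p" and y: "y \<in> Zp p"
  have "(x (Suc n) - y (Suc n)) mod int p ^ Suc n mod int p ^ n = (x n - y n) mod int p ^ n" for n
  proof -
    have "(x (Suc n) - y (Suc n)) mod int p ^ Suc n mod int p ^ n = (x (Suc n) - y (Suc n)) mod int p ^ n"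
      by (simp add: mod_mod_cancel)
    also have "\<dots> = (x (Suc n) mod int p ^ n - y (Suc n) mod int p ^ n) mod int p ^ n" by (simp add: mod_diff_eq)
    finally show ?thesis using x y Zp_mod[of _ p n "Suc n"] by simp
  qed
  then show ?thesis using p_pos by (simp add: Zp_def zp_diff_def)
qed

lemma zp_add_diff: "y \<in> Zp p \<Longrightarrow> zp_add p x (zp_diff p y x) = y"
  by (auto simp: zp_add_def zp_diff_def mod_simps Zp_mod_self)

lemma zp_diff_add: "y \<in> Zp p \<Longrightarrow> zp_diff p (zp_add p x y) x = y"
  by (auto simp: zp_add_def zp_diff_def mod_simps Zp_mod_self)

text \<open>Negation is written as 0 - x throughout; translating by -x and then by x
  cancels.\<close>

lemma zp_diff_neg_diff: "y \<in> Zp p \<Longrightarrow> zp_diff p (zp_diff p y (zp_diff p (zp_of_int p 0) x)) x = y"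
  by (auto simp: zp_of_int_def zp_diff_def mod_simps Zp_mod_self)

text \<open>Haar invariance is stated for images of sets under addition, while transport of measures
  uses preimages; this converts one into the other.\<close>

lemma zp_add_image:
  assumes x: "x \<in> Zp p" and A: "A \<subseteq> Zp p"
  shows "zp_add p x ` A = {y \<in> Zp p. zp_diff p y x \<in> A}"
proof (intro equalityI subsetI)
  fix y assume "y \<in> zp_add p x ` A"
  then obtain a where a: "a \<in> A" "y = zp_add p x a" by blast
  then show "y \<in> {y \<in> Zp p. zp_diff p y x \<in> A}"
    using A zp_add_in[OF x, of a] zp_diff_add[of a x] by auto
next
  fix y assume y: "y \<in> {y \<in> Zp p. zp_diff p y x \<in> A}"
  then have "y = zp_add p x (zp_diff p y x)" using zp_add_diff[of y x] by simp
  then show "y \<in> zp_add p x ` A" using y by blast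
qed

lemma zp_of_int_add_coset: "zp_add p (zp_of_int p a) ` coset p n 0 = coset p n (a mod int p ^ n)"
proof -
  have "zp_diff p y (zp_of_int p a) \<in> coset p n 0 \<longleftrightarrow> y n = a mod int p ^ n" if "y \<in> Zp p" for y
  proof -
    have "(y n - a mod int p ^ n) mod int p ^ n = 0 \<longleftrightarrow> y n mod int p ^ n = (a mod int p ^ n) mod int p ^ n"
      by (simp only: mod_eq_dvd_iff dvd_eq_mod_eq_0)
    then show ?thesis using Zp_mod_self[OF that, of n] zp_diff_in[OF that zp_of_int_in[of a]]
      unfolding coset_def zp_diff_def zp_of_int_def by auto
  qed
  moreover have "zp_add p (zp_of_int p a) ` coset p n 0 =
      {y \<in> Zp p. zp_diff p y (zp_of_int p a) \<in> coset p n 0}"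
    by (rule zp_add_image[OF zp_of_int_in]) (auto simp: coset_def)
  ultimately show ?thesis by (auto simp: coset_def[of p n "a mod int p ^ n"])
qed

lemma coset_disjoint: "a \<noteq> b \<Longrightarrow> coset p n a \<inter> coset p n b = {}"
  by (auto simp: coset_def)

lemma coset_Union: "(\<Union>a\<in>{0..<int p ^ n}. coset p n a) = Zp p"
  using Zp_range by (auto simp: coset_def)

lemma coset_empty: "a \<notin> {0..<int p ^ n} \<Longrightarrow> coset p n a = {}"
  using Zp_range by (auto simp: coset_def)

lemma step_expand:
  assumes g: "g \<in> step p n"
  shows "g = (\<Sum>a\<in>{0..<int p ^ n}. (\<lambda>x. g (zp_of_int p a) * indicator (coset p n a) x))"
proof
  fix x
  show "g x = (\<Sum>a\<in>{0..<int p ^ n}. (\<lambda>x. g (zp_of_int p a) * indicator (coset p n a) x)) x"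
  proof (cases "x \<in> Zp p")
    case True
    have "(\<Sum>a\<in>{0..<int p ^ n}. g (zp_of_int p a) * indicator (coset p n a) x) =
        (\<Sum>a\<in>{0..<int p ^ n}. if a = x n then g (zp_of_int p a) else 0)"
      using True by (intro sum.cong) (auto simp: coset_def)
    also have "\<dots> = g (zp_of_int p (x n))" using Zp_range[OF True, of n] by simp
    also have "\<dots> = g x"
      by (rule step_eq[OF g zp_of_int_in True]) (simp add: zp_of_int_def Zp_mod_self[OF True])
    finally show ?thesis by (simp add: sum_fun_apply)
  next
    case False
    then show ?thesis using step_outside[OF g] by (simp add: sum_fun_apply coset_def)
  qed
qed

lemma subspace_step: "cfun.subspace (step p n)"
proof (rule cfun.subspaceI)
  show "x + y \<in> step p n" if "x \<in> step p n" "y \<in> step p n" for x y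
    using that by (intro step_I) (auto simp: step_outside intro!: arg_cong2[of _ _ _ _ plus] intro: step_eq)
  show "(\<lambda>z. c * x z) \<in> step p n" if "x \<in> step p n" for c x
    using that by (intro step_I) (auto simp: step_outside intro!: arg_cong2[of _ _ _ _ times] intro: step_eq)
qed (simp add: step_def)

lemma step_mono: "m \<le> n \<Longrightarrow> step p m \<subseteq> step p n"
  by (auto intro!: step_I dest: step_outside intro: step_eq Zp_eq_mono)

lemma indicator_coset_step: "indicator (coset p n a) \<in> step p n"
  by (rule step_I) (auto simp: coset_def indicator_def)

end

section \<open>Haar measure and averages over cosets\<close>

text \<open>The conditional expectation onto the cosets of p^n Z_p; the factor p^n is the reciprocal
  of the measure of a coset.\<close>

definition coset_average ::
  "nat \<Rightarrow> padic measure \<Rightarrow> nat \<Rightarrow> (padic \<Rightarrow> complex) \<Rightarrow> (padic \<Rightarrow> complex)" where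
  "coset_average p \<mu> n f = (\<lambda>y. if y \<in> Zp p
     then of_nat (p ^ n) * (\<integral>z. indicator (coset p n (y n)) z * f z \<partial>\<mu>) else 0)"

locale haar_padic = prob_space \<mu> for \<mu> :: "padic measure" +
  fixes p :: nat
  assumes p_pos: "0 < p" and haar: "haar_measure p \<mu>"
begin

lemma sets_\<mu>: "sets \<mu> = sets (restrict_space borel (Zp p))"
  using haar by (simp add: haar_measure_def)

lemma space_\<mu>: "space \<mu> = Zp p"
  using sets_eq_imp_space_eq[OF sets_\<mu>] by (simp add: space_restrict_space)

lemma measurable_coordinate: "(\<lambda>x. x n) \<in> \<mu> \<rightarrow>\<^sub>M (borel :: int measure)"
proof -
  have "(\<lambda>x. x n) \<in> restrict_space borel (Zp p) \<rightarrow>\<^sub>M (borel :: int measure)"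
    by (rule measurable_restrict_space1) (rule measurable_product_coordinates)
  then show ?thesis using measurable_cong_sets[OF sets_\<mu> refl] by blast
qed

lemma coset_sets [measurable]: "coset p n a \<in> sets \<mu>"
proof -
  have "(\<lambda>x. x n) -` {a} \<inter> space \<mu> \<in> sets \<mu>"
    by (rule measurable_sets[OF measurable_coordinate]) simp
  also have "(\<lambda>x. x n) -` {a} \<inter> space \<mu> = coset p n a" by (auto simp: space_\<mu> coset_def)
  finally show ?thesis .
qed

text \<open>The Borel sets of sequences are generated by conditions on single coordinates, and the
  trace of such a condition on Z_p is a countable union of cosets because the integers are
  countable.\<close>

lemma sets_generated: "sets \<mu> \<subseteq> sigma_sets (Zp p) {coset p n a |n a. True}"
proof -
  let ?G = "{coset p n a |n a. True}"
  let ?S = "{{f \<in> \<Pi>\<^sub>E i\<in>UNIV. space (borel :: int measure). f i \<in> A} | i A. i \<in> UNIV \<and> A \<in> sets (borel :: int measure)}"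
  have "sets (borel :: padic measure) = sets (\<Pi>\<^sub>M i\<in>UNIV. borel)"
    by (rule sets_PiM_equal_borel[symmetric])
  also have "\<dots> = sigma_sets UNIV ?S" by (subst sets_PiM_single) simp
  finally have gen: "sets (borel :: padic measure) = sigma_sets UNIV ?S" .
  have "Zp p \<inter> Y \<in> sigma_sets (Zp p) ?G" if "Y \<in> sigma_sets UNIV ?S" for Y
    using that
  proof (induction rule: sigma_sets.induct)
    case (Basic Y)
    then obtain i A where "Zp p \<inter> Y = (\<Union>a\<in>A. coset p i a)" by (auto simp: coset_def)
    moreover have "(\<Union>a\<in>A. coset p i a) \<in> sigma_sets (Zp p) ?G"
    proof -
      interpret sigma_algebra "Zp p" "sigma_sets (Zp p) ?G"
        by (rule sigma_algebra_sigma_sets) (auto simp: coset_def)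
      show ?thesis by (rule countable_UN'') (auto intro: sigma_sets.Basic)
    qed
    ultimately show ?case by simp
  next
    case (Compl Y)
    have "Zp p \<inter> (UNIV - Y) = Zp p - (Zp p \<inter> Y)" by blast
    then show ?case using sigma_sets.Compl[OF Compl.IH] by simp
  next
    case (Union Y)
    have "Zp p \<inter> (\<Union>i. Y i) = (\<Union>i. Zp p \<inter> Y i)" by blast
    then show ?case using sigma_sets.Union[of "\<lambda>i. Zp p \<inter> Y i", OF Union.IH] by simp
  qed (simp add: sigma_sets.Empty)
  then show ?thesis unfolding sets_\<mu> sets_restrict_space gen by blast
qed

lemma translation_measurable:
  assumes "x \<in> Zp p" shows "(\<lambda>y. zp_diff p y x) \<in> \<mu> \<rightarrow>\<^sub>M \<mu>"
proof -
  have "(\<lambda>y. zp_diff p y x) \<in> \<mu> \<rightarrow>\<^sub>M borel"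
  proof (rule measurable_coordinatewise_then_product)
    fix n
    have "(\<lambda>k. (k - x n) mod int p ^ n) \<in> borel \<rightarrow>\<^sub>M (borel :: int measure)"
      by (rule borel_measurable_continuous_onI) (simp add: continuous_on_open_vimage discrete_topology_class.open_discrete)
    then show "(\<lambda>y. zp_diff p y x n) \<in> \<mu> \<rightarrow>\<^sub>M borel"
      unfolding zp_diff_def using measurable_compose[OF measurable_coordinate[of n]] by blast
  qed
  then have "(\<lambda>y. zp_diff p y x) \<in> \<mu> \<rightarrow>\<^sub>M restrict_space borel (Zp p)"
    using assms zp_diff_in[OF p_pos] by (intro measurable_restrict_space2) (auto simp: space_\<mu>)
  then show ?thesis using measurable_cong_sets[OF refl sets_\<mu>] by blast
qed

lemma distr_translation:
  assumes x: "x \<in> Zp p" shows "distr \<mu> \<mu> (\<lambda>y. zp_diff p y x) = \<mu>"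
proof (rule measure_eqI)
  fix A assume "A \<in> sets (distr \<mu> \<mu> (\<lambda>y. zp_diff p y x))"
  then have A: "A \<in> sets \<mu>" by simp
  then have sub: "A \<subseteq> Zp p" using sets.sets_into_space space_\<mu> by blast
  have "emeasure (distr \<mu> \<mu> (\<lambda>y. zp_diff p y x)) A = emeasure \<mu> ((\<lambda>y. zp_diff p y x) -` A \<inter> space \<mu>)"
    by (rule emeasure_distr[OF translation_measurable[OF x] A])
  also have "(\<lambda>y. zp_diff p y x) -` A \<inter> space \<mu> = zp_add p x ` A"
    by (auto simp: zp_add_image[OF p_pos x sub] space_\<mu>)
  also have "emeasure \<mu> (zp_add p x ` A) = emeasure \<mu> A"
    using haar x A by (simp add: haar_measure_def)
  finally show "emeasure (distr \<mu> \<mu> (\<lambda>y. zp_diff p y x)) A = emeasure \<mu> A" .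
qed simp

lemma integral_translation:
  fixes f :: "padic \<Rightarrow> 'b::{banach, second_countable_topology}"
  assumes "x \<in> Zp p" "f \<in> borel_measurable \<mu>"
  shows "(\<integral>y. f (zp_diff p y x) \<partial>\<mu>) = (\<integral>y. f y \<partial>\<mu>)"
  using integral_distr[OF translation_measurable[OF assms(1)] assms(2)] distr_translation[OF assms(1)]
  by simp

lemma integral_indicator_complex:
  "A \<in> sets \<mu> \<Longrightarrow> (\<integral>x. indicator A x \<partial>\<mu>) = complex_of_real (measure \<mu> A)"
proof -
  assume A: "A \<in> sets \<mu>"
  have "(\<integral>x. indicator A x \<partial>\<mu>) = (\<integral>x. complex_of_real (indicator A x) \<partial>\<mu>)"
    by (intro Bochner_Integration.integral_cong) (auto simp: indicator_def)
  also have "\<dots> = complex_of_real (measure \<mu> A)" using A by simp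
  finally show ?thesis .
qed

text \<open>The p^n cosets of level n are translates of one another and partition a space of measure
  1.\<close>

lemma measure_coset:
  assumes "a \<in> {0..<int p ^ n}" shows "measure \<mu> (coset p n a) = 1 / p ^ n"
proof -
  have eq: "measure \<mu> (coset p n b) = measure \<mu> (coset p n 0)" if "b \<in> {0..<int p ^ n}" for b
  proof -
    have "zp_add p (zp_of_int p b) ` coset p n 0 = coset p n b"
      using that by (simp add: zp_of_int_add_coset[OF p_pos])
    moreover have "emeasure \<mu> (zp_add p (zp_of_int p b) ` coset p n 0) = emeasure \<mu> (coset p n 0)"
      using haar coset_sets zp_of_int_in[OF p_pos] by (simp add: haar_measure_def)
    ultimately show ?thesis by (simp add: measure_def)
  qed
  have "1 = measure \<mu> (\<Union>a\<in>{0..<int p ^ n}. coset p n a)"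
    by (simp add: coset_Union[OF p_pos] prob_space flip: space_\<mu>)
  also have "\<dots> = (\<Sum>a\<in>{0..<int p ^ n}. measure \<mu> (coset p n a))"
    by (rule finite_measure_finite_Union) (auto simp: disjoint_family_on_def coset_disjoint[OF p_pos])
  also have "\<dots> = real p ^ n * measure \<mu> (coset p n 0)" using eq by simp
  finally show ?thesis using eq[OF assms] p_pos by (simp add: field_simps)
qed

lemma step_L2: assumes "g \<in> step p n" shows "g \<in> L2 \<mu>"
proof -
  have "(\<lambda>x. c * indicator (coset p n a) x) \<in> L2 \<mu>" for c :: complex and a
    by (rule L2_bounded[of _ "cmod c"]) (auto simp: indicator_def)
  then have "(\<Sum>a\<in>{0..<int p ^ n}. (\<lambda>x. g (zp_of_int p a) * indicator (coset p n a) x)) \<in> L2 \<mu>"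
    by (intro L2_sum)
  then show ?thesis using step_expand[OF p_pos assms] by simp
qed

lemma integral_step_mult:
  assumes g: "g \<in> step p n" and f: "f \<in> L2 \<mu>"
  shows "(\<integral>x. g x * f x \<partial>\<mu>) =
    (\<Sum>a\<in>{0..<int p ^ n}. g (zp_of_int p a) * (\<integral>x. indicator (coset p n a) x * f x \<partial>\<mu>))"
proof -
  have ind: "integrable \<mu> (\<lambda>x. indicator (coset p n a) x * f x)" for a
    by (rule L2_mult_integrable[OF step_L2[OF indicator_coset_step[OF p_pos]] f])
  have "g x * f x = (\<Sum>a\<in>{0..<int p ^ n}. g (zp_of_int p a) * (indicator (coset p n a) x * f x))" for x
  proof -
    have "g x = (\<Sum>a\<in>{0..<int p ^ n}. g (zp_of_int p a) * indicator (coset p n a) x)"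
      using arg_cong[OF step_expand[OF p_pos g], of "\<lambda>h. h x"] by (simp add: sum_fun_apply)
    then show ?thesis by (simp only: sum_distrib_right mult.assoc)
  qed
  then show ?thesis using ind by (simp add: Bochner_Integration.integral_sum)
qed

section \<open>Coset averages as orthogonal projections\<close>

lemma coset_average_step: "coset_average p \<mu> n f \<in> step p n"
  by (rule step_I) (auto simp: coset_average_def)

lemma coset_average_of_step:
  assumes g: "g \<in> step p n" shows "coset_average p \<mu> n g = g"
proof
  fix y
  show "coset_average p \<mu> n g y = g y"
  proof (cases "y \<in> Zp p")
    case True
    have "(\<integral>z. indicator (coset p n (y n)) z * g z \<partial>\<mu>) = (\<integral>z. indicator (coset p n (y n)) z * g y \<partial>\<mu>)"
      using step_eq[OF g _ True] by (intro Bochner_Integration.integral_cong) (auto simp: indicator_def coset_def)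
    also have "\<dots> = measure \<mu> (coset p n (y n)) * g y" by (simp add: integral_indicator_complex)
    also have "\<dots> = g y / p ^ n" using measure_coset Zp_range[OF True, of n] by simp
    finally show ?thesis using True p_pos by (simp add: coset_average_def)
  next
    case False
    then show ?thesis using step_outside[OF g] by (simp add: coset_average_def)
  qed
qed

lemma coset_average_L2: "coset_average p \<mu> n f \<in> L2 \<mu>"
  by (rule step_L2[OF coset_average_step])

lemma coset_average_add:
  assumes "f \<in> L2 \<mu>" "g \<in> L2 \<mu>"
  shows "coset_average p \<mu> n (f + g) = coset_average p \<mu> n f + coset_average p \<mu> n g"
proof -
  have "integrable \<mu> (\<lambda>x. indicator (coset p n a) x * h x)" if "h \<in> L2 \<mu>" for a h
    by (rule L2_mult_integrable[OF step_L2[OF indicator_coset_step[OF p_pos]] that])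
  then show ?thesis using assms by (simp add: coset_average_def fun_eq_iff distrib_left)
qed

lemma coset_average_scale: "coset_average p \<mu> n (\<lambda>x. c * f x) = (\<lambda>x. c * coset_average p \<mu> n f x)"
  by (auto simp: coset_average_def fun_eq_iff mult.left_commute)

lemma coset_average_cnj: "coset_average p \<mu> n (\<lambda>x. cnj (f x)) = (\<lambda>x. cnj (coset_average p \<mu> n f x))"
proof -
  have "(\<integral>z. indicator A z * cnj (f z) \<partial>\<mu>) = cnj (\<integral>z. indicator A z * f z \<partial>\<mu>)" for A
  proof -
    have "(\<integral>z. indicator A z * cnj (f z) \<partial>\<mu>) = (\<integral>z. cnj (indicator A z * f z) \<partial>\<mu>)"
      by (intro Bochner_Integration.integral_cong) (auto simp: indicator_def)
    then show ?thesis by (simp only: Bochner_Integration.integral_cnj)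
  qed
  then show ?thesis by (auto simp: coset_average_def fun_eq_iff)
qed

lemma coset_average_cong_AE:
  assumes "f \<in> L2 \<mu>" "g \<in> L2 \<mu>" "AE x in \<mu>. f x = g x"
  shows "coset_average p \<mu> n f = coset_average p \<mu> n g"
proof -
  have "(\<integral>z. indicator (coset p n a) z * f z \<partial>\<mu>) = (\<integral>z. indicator (coset p n a) z * g z \<partial>\<mu>)" for a
  proof (rule integral_cong_AE)
    show "AE x in \<mu>. indicator (coset p n a) x * f x = indicator (coset p n a) x * g x"
      using assms(3) by eventually_elim simp
  qed (use assms(1,2) L2_measurable in measurable)
  then show ?thesis unfolding coset_average_def by (simp only:)
qed

text \<open>The defining property of a conditional expectation. By linearity it is enough to
  integrate over one coset, where the average is constant and its factor p^n cancels the
  measure.\<close>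

lemma integral_coset_average:
  assumes g: "g \<in> step p n" and f: "f \<in> L2 \<mu>"
  shows "(\<integral>x. g x * coset_average p \<mu> n f x \<partial>\<mu>) = (\<integral>x. g x * f x \<partial>\<mu>)"
proof -
  have "(\<integral>x. indicator (coset p n a) x * coset_average p \<mu> n f x \<partial>\<mu>) = (\<integral>x. indicator (coset p n a) x * f x \<partial>\<mu>)"
    if a: "a \<in> {0..<int p ^ n}" for a
  proof -
    let ?I = "\<integral>x. indicator (coset p n a) x * f x \<partial>\<mu>"
    have "(\<integral>x. indicator (coset p n a) x * coset_average p \<mu> n f x \<partial>\<mu>) =
        (\<integral>x. indicator (coset p n a) x * (of_nat (p ^ n) * ?I) \<partial>\<mu>)"
      by (intro Bochner_Integration.integral_cong) (auto simp: indicator_def coset_def coset_average_def)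
    also have "\<dots> = measure \<mu> (coset p n a) * (of_nat (p ^ n) * ?I)"
      by (simp add: integral_indicator_complex)
    also have "\<dots> = ?I" using p_pos by (simp add: measure_coset[OF a])
    finally show ?thesis .
  qed
  then show ?thesis
    by (simp add: integral_step_mult[OF g f] integral_step_mult[OF g coset_average_L2])
qed

text \<open>Both sides equal the inner product of the two averages, since averaging one factor
  changes nothing when the other is a step function.\<close>

lemma coset_average_selfadjoint:
  assumes f: "f \<in> L2 \<mu>" and h: "h \<in> L2 \<mu>"
  shows "L2_inner \<mu> (coset_average p \<mu> n f) h = L2_inner \<mu> f (coset_average p \<mu> n h)"
proof -
  let ?E = "coset_average p \<mu> n" and ?h = "\<lambda>x. cnj (h x)"
  have "(\<integral>x. ?E f x * ?h x \<partial>\<mu>) = (\<integral>x. ?E f x * ?E ?h x \<partial>\<mu>)"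
    by (rule integral_coset_average[symmetric, OF coset_average_step L2_cnj[OF h]])
  also have "\<dots> = (\<integral>x. ?E ?h x * ?E f x \<partial>\<mu>)" by (simp add: mult.commute)
  also have "\<dots> = (\<integral>x. ?E ?h x * f x \<partial>\<mu>)"
    by (rule integral_coset_average[OF coset_average_step f])
  finally show ?thesis by (simp add: L2_inner_def coset_average_cnj mult.commute)
qed

lemma coset_average_coarser:
  "m \<le> n \<Longrightarrow> coset_average p \<mu> n (coset_average p \<mu> m f) = coset_average p \<mu> m f"
  using coset_average_of_step coset_average_step step_mono[OF p_pos] by blast

text \<open>Tower property: the indicator of a coarse coset is also a step function of the finer
  level, so its integral against f sees only the finer average.\<close>

lemma coset_average_finer:
  assumes f: "f \<in> L2 \<mu>" and mn: "m \<le> n"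
  shows "coset_average p \<mu> m (coset_average p \<mu> n f) = coset_average p \<mu> m f"
proof -
  have "indicator (coset p m a) \<in> step p n" for a
    using indicator_coset_step[OF p_pos] step_mono[OF p_pos mn] by blast
  then have "(\<integral>z. indicator (coset p m a) z * coset_average p \<mu> n f z \<partial>\<mu>) =
      (\<integral>z. indicator (coset p m a) z * f z \<partial>\<mu>)" for a
    by (rule integral_coset_average[OF _ f])
  then show ?thesis unfolding coset_average_def[of p \<mu> m] by (simp only:)
qed

text \<open>An orthogonal projection is a contraction: the squared norm of E f is <f, E f>, to which
  Cauchy-Schwarz applies.\<close>

lemma coset_average_norm_le:
  assumes f: "f \<in> L2 \<mu>" shows "L2_norm \<mu> (coset_average p \<mu> n f) \<le> L2_norm \<mu> f"
proof -
  let ?E = "coset_average p \<mu> n"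
  have "complex_of_real ((L2_norm \<mu> (?E f))\<^sup>2) = L2_inner \<mu> f (?E (?E f))"
    by (simp add: L2_inner_self[symmetric] coset_average_selfadjoint[OF f coset_average_L2] del: of_real_power)
  also have "?E (?E f) = ?E f" by (rule coset_average_coarser) simp
  finally have "(L2_norm \<mu> (?E f))\<^sup>2 = cmod (L2_inner \<mu> f (?E f))"
    by (metis norm_of_real abs_power2)
  also have "\<dots> \<le> L2_norm \<mu> f * L2_norm \<mu> (?E f)" by (rule L2_Cauchy_Schwarz[OF f coset_average_L2])
  finally show ?thesis
    using L2_norm_nonneg[of \<mu> "?E f"] L2_norm_nonneg[of \<mu> f]
    by (cases "L2_norm \<mu> (?E f) = 0") (auto simp: power2_eq_square)
qed

text \<open>A step function is its own average, and the average depends only on the class almost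
  everywhere. This is the source of all exact equalities on the ranges of the averages.\<close>

lemma step_null_eq_0:
  assumes g: "g \<in> step p n" and null: "AE x in \<mu>. g x = 0" shows "g = 0"
proof -
  have "coset_average p \<mu> n g = coset_average p \<mu> n 0"
    by (rule coset_average_cong_AE) (use step_L2[OF g] L2_zero null in auto)
  then show ?thesis using coset_average_of_step[OF g] coset_average_of_step[OF cfun.subspace_0[OF subspace_step[OF p_pos]], of n]
    by simp
qed

end

section \<open>Strong convergence of the coset averages and density in finite dimension\<close>

context haar_padic
begin

lemma coset_average_diff:
  assumes "f \<in> L2 \<mu>" "g \<in> L2 \<mu>"
  shows "coset_average p \<mu> n (f - g) = coset_average p \<mu> n f - coset_average p \<mu> n g"
proof -
  have "coset_average p \<mu> n ((f - g) + g) = coset_average p \<mu> n (f - g) + coset_average p \<mu> n g"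
    by (rule coset_average_add[OF L2_diff[OF assms] assms(2)])
  then show ?thesis by simp
qed

text \<open>The vectors on which the averages converge form a closed subspace containing all step
  functions; showing that it is everything proceeds through indicators and simple functions.\<close>

definition approximable :: "(padic \<Rightarrow> complex) set" where
  "approximable = {f \<in> L2 \<mu>. (\<lambda>n. L2_norm \<mu> (coset_average p \<mu> n f - f)) \<longlonglongrightarrow> 0}"

text \<open>A three-epsilon argument; that the averages are contractions makes the estimate uniform
  in n.\<close>

lemma approximable_limit:
  assumes f: "f \<in> L2 \<mu>" and close: "\<And>e. e > 0 \<Longrightarrow> \<exists>g\<in>approximable. L2_norm \<mu> (f - g) < e"
  shows "f \<in> approximable"
proof -
  let ?E = "coset_average p \<mu>"
  have "(\<lambda>n. L2_norm \<mu> (?E n f - f)) \<longlonglongrightarrow> 0"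
  proof (rule LIMSEQ_I)
    fix e :: real assume "e > 0"
    then obtain g where g: "g \<in> L2 \<mu>" "(\<lambda>n. L2_norm \<mu> (?E n g - g)) \<longlonglongrightarrow> 0" "L2_norm \<mu> (f - g) < e / 3"
      using close[of "e / 3"] by (auto simp: approximable_def)
    obtain N where N: "\<And>n. n \<ge> N \<Longrightarrow> L2_norm \<mu> (?E n g - g) < e / 3"
      using LIMSEQ_D[OF g(2), of "e / 3"] \<open>e > 0\<close> by (auto simp: abs_of_nonneg[OF L2_norm_nonneg])
    have "L2_norm \<mu> (?E n f - f) < e" if "n \<ge> N" for n
    proof -
      have "?E n f - f = ?E n (f - g) + ((?E n g - g) + (g - f))"
        by (simp add: coset_average_diff[OF f g(1)] algebra_simps)
      then have "L2_norm \<mu> (?E n f - f) \<le> L2_norm \<mu> (?E n (f - g)) + L2_norm \<mu> ((?E n g - g) + (g - f))"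
        using f g by (metis L2_norm_triangle coset_average_L2 L2_add L2_diff)
      also have "L2_norm \<mu> ((?E n g - g) + (g - f)) \<le> L2_norm \<mu> (?E n g - g) + L2_norm \<mu> (g - f)"
        by (intro L2_norm_triangle L2_diff coset_average_L2 f g)
      also have "L2_norm \<mu> (?E n (f - g)) \<le> L2_norm \<mu> (f - g)"
        by (intro coset_average_norm_le L2_diff f g)
      also have "L2_norm \<mu> (g - f) = L2_norm \<mu> (f - g)" by (rule L2_norm_minus_commute)
      finally show ?thesis using N[OF that] g(3) by linarith
    qed
    then show "\<exists>N. \<forall>n\<ge>N. norm (L2_norm \<mu> (?E n f - f) - 0) < e" by (auto simp: L2_norm_nonneg)
  qed
  then show ?thesis using f by (simp add: approximable_def)
qed

lemma subspace_approximable: "cfun.subspace approximable"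
proof (rule cfun.subspaceI)
  let ?E = "coset_average p \<mu>"
  show "0 \<in> approximable"
    unfolding approximable_def using coset_average_of_step[OF cfun.subspace_0[OF subspace_step[OF p_pos]]]
    by (simp add: L2_zero L2_norm_zero del: func_zero)
  show "f + g \<in> approximable" if f: "f \<in> approximable" and g: "g \<in> approximable" for f g
  proof -
    have L: "f \<in> L2 \<mu>" "g \<in> L2 \<mu>" using f g by (auto simp: approximable_def)
    have lim: "(\<lambda>n. L2_norm \<mu> (?E n f - f) + L2_norm \<mu> (?E n g - g)) \<longlonglongrightarrow> 0 + 0"
      using f g by (intro tendsto_add) (auto simp: approximable_def)
    have le: "L2_norm \<mu> (?E n (f + g) - (f + g)) \<le> L2_norm \<mu> (?E n f - f) + L2_norm \<mu> (?E n g - g)" for n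
    proof -
      have eq: "?E n (f + g) - (f + g) = (?E n f - f) + (?E n g - g)"
        by (simp add: coset_average_add[OF L])
      show ?thesis unfolding eq by (intro L2_norm_triangle L2_diff coset_average_L2 L)
    qed
    have "(\<lambda>n. L2_norm \<mu> (?E n (f + g) - (f + g))) \<longlonglongrightarrow> 0"
    proof (rule real_tendsto_sandwich[where f = "\<lambda>_. 0"
          and h = "\<lambda>n. L2_norm \<mu> (?E n f - f) + L2_norm \<mu> (?E n g - g)"])
      show "(\<lambda>n. L2_norm \<mu> (?E n f - f) + L2_norm \<mu> (?E n g - g)) \<longlonglongrightarrow> 0" using lim unfolding add_0 .
      show "\<forall>\<^sub>F n in sequentially. 0 \<le> L2_norm \<mu> (?E n (f + g) - (f + g))" by (rule always_eventually) (intro allI L2_norm_nonneg)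
      show "\<forall>\<^sub>F n in sequentially. L2_norm \<mu> (?E n (f + g) - (f + g)) \<le> L2_norm \<mu> (?E n f - f) + L2_norm \<mu> (?E n g - g)"
        using le by (rule always_eventually[rule_format])
    qed (rule tendsto_const)
    then show ?thesis using L2_add[OF L] by (simp add: approximable_def)
  qed
  show "(\<lambda>x. c * f x) \<in> approximable" if f: "f \<in> approximable" for c f
  proof -
    have "(\<lambda>n. cmod c * L2_norm \<mu> (?E n f - f)) \<longlonglongrightarrow> cmod c * 0"
      using f by (intro tendsto_mult_left) (auto simp: approximable_def)
    moreover have "L2_norm \<mu> (?E n (\<lambda>x. c * f x) - (\<lambda>x. c * f x)) = cmod c * L2_norm \<mu> (?E n f - f)" for n
    proof -
      have "?E n (\<lambda>x. c * f x) - (\<lambda>x. c * f x) = (\<lambda>x. c * (?E n f - f) x)"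
        by (simp add: coset_average_scale fun_eq_iff right_diff_distrib)
      then show ?thesis by (simp only: L2_norm_scale)
    qed
    ultimately have "(\<lambda>n. L2_norm \<mu> (?E n (\<lambda>x. c * f x) - (\<lambda>x. c * f x))) \<longlonglongrightarrow> 0" by (simp only: mult_zero_right)
    then show ?thesis using f by (simp add: approximable_def L2_scale)
  qed
qed

lemma step_approximable: assumes g: "g \<in> step p m" shows "g \<in> approximable"
proof -
  have "coset_average p \<mu> n g = g" if "m \<le> n" for n
    using coset_average_of_step step_mono[OF p_pos that] g by blast
  then have "eventually (\<lambda>n. L2_norm \<mu> (coset_average p \<mu> n g - g) = 0) sequentially"
    using L2_norm_zero[of \<mu>] by (intro eventually_sequentiallyI[of m]) simp
  then have "(\<lambda>n. L2_norm \<mu> (coset_average p \<mu> n g - g)) \<longlonglongrightarrow> 0" by (rule tendsto_eventually)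
  then show ?thesis using step_L2[OF g] by (simp add: approximable_def)
qed

lemma indicator_L2: "A \<in> sets \<mu> \<Longrightarrow> indicator A \<in> L2 \<mu>"
  by (rule L2_bounded[of _ 1]) (auto simp: indicator_def)

lemma indicator_approximable:
  assumes "A \<in> sets \<mu>" shows "indicator A \<in> approximable"
proof -
  let ?G = "{coset p n a |n a. True}"
  have sub: "sigma_sets (Zp p) ?G \<subseteq> sets \<mu>"
  proof -
    have "?G \<subseteq> sets \<mu>" using coset_sets by auto
    then have "sigma_sets (space \<mu>) ?G \<subseteq> sets \<mu>" by (rule sets.sigma_sets_subset)
    then show ?thesis by (simp add: space_\<mu>)
  qed
  have A: "A \<in> sigma_sets (Zp p) ?G" using assms sets_generated by blast
  have stable: "Int_stable ?G"
  proof (rule Int_stableI)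
    fix X Y assume "X \<in> ?G" "Y \<in> ?G"
    then obtain m a n b where XY: "X = coset p m a" "Y = coset p n b" by blast
    have main: "\<exists>k c. coset p m a \<inter> coset p n b = coset p k c" if "m \<le> n" for m a n b
    proof (cases "b mod int p ^ m = a")
      case True
      then have "coset p m a \<inter> coset p n b = coset p n b"
        using Zp_mod[OF _ that] by (auto simp: coset_def)
      then show ?thesis by blast
    next
      case False
      then have "coset p m a \<inter> coset p n b = {}"
        using Zp_mod[OF _ that] by (auto simp: coset_def)
      \<comment> \<open>An empty intersection must itself be presented as a coset; the residue -1 is
        out of range at level 0.\<close>
      also have "{} = coset p 0 (-1)" using coset_empty[OF p_pos, of "-1" 0] by simp
      finally show ?thesis by blast
    qed
    show "X \<inter> Y \<in> ?G"
    proof (cases "m \<le> n")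
      case True
      then show ?thesis using main[of m n a b] XY by auto
    next
      case False
      then show ?thesis using main[of n m b a] XY by (auto simp: Int_commute)
    qed
  qed
  have "?G \<subseteq> Pow (Zp p)" by (auto simp: coset_def)
  from stable this A show ?thesis
  proof (induction rule: sigma_sets_induct_disjoint)
    case (basic A)
    then show ?case using step_approximable indicator_coset_step[OF p_pos] by blast
  next
    case empty
    have eq: "indicator {} = (0 :: padic \<Rightarrow> complex)" by (simp add: fun_eq_iff)
    show ?case unfolding eq by (rule cfun.subspace_0[OF subspace_approximable])
  next
    case (compl A)
    have "indicator (Zp p) \<in> approximable"
      by (rule step_approximable[of _ 0]) (auto intro: step_I simp: indicator_def)
    then have "indicator (Zp p) - indicator A \<in> approximable"
      using compl cfun.subspace_diff[OF subspace_approximable] by blast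
    moreover have "A \<subseteq> Zp p" using compl(1) sub sets.sets_into_space space_\<mu> by blast
    then have "indicator (Zp p) - indicator A = (indicator (Zp p - A) :: padic \<Rightarrow> complex)"
      by (auto simp: indicator_def fun_eq_iff)
    ultimately show ?case by simp
  next
    case (union A)
    have A: "A i \<in> sets \<mu>" for i using union(2) sub by blast
    have sums: "(\<Sum>i<k. indicator (A i)) = (indicator (\<Union>i<k. A i) :: padic \<Rightarrow> complex)" for k
    proof
      fix x
      have "disjoint_family_on A {..<k}" using union(1) by (auto simp: disjoint_family_on_def)
      then show "(\<Sum>i<k. indicator (A i)) x = (indicator (\<Union>i<k. A i) x :: complex)"
        by (simp add: sum_fun_apply indicator_UN_disjoint)
    qed
    have 1: "(indicator (\<Union>i<k. A i) :: padic \<Rightarrow> complex) \<in> approximable" for k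
      unfolding sums[symmetric] by (rule cfun.subspace_sum[OF subspace_approximable]) (use union in auto)
    \<comment> \<open>Finite unions approximate the countable one in norm, by dominated convergence
      with bound 1.\<close>
    have 2: "(\<lambda>k. L2_norm \<mu> (indicator (\<Union>i<k. A i) - indicator (\<Union>i. A i))) \<longlonglongrightarrow> 0"
    proof (rule L2_norm_dominated_convergence[where w = "\<lambda>_. 1"])
      show "(\<lambda>k. indicator (\<Union>i<k. A i) x :: complex) \<longlonglongrightarrow> indicator (\<Union>i. A i) x" for x
        by (rule LIMSEQ_indicator_UN)
    qed (use A in \<open>auto simp: indicator_def\<close>)
    show ?case
    proof (rule approximable_limit)
      show "indicator (\<Union>i. A i) \<in> L2 \<mu>" using A by (intro indicator_L2) auto
      fix e :: real assume "e > 0"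
      then obtain k where "L2_norm \<mu> (indicator (\<Union>i<k. A i) - indicator (\<Union>i. A i)) < e"
        using LIMSEQ_D[OF 2, of e] by (auto simp: abs_of_nonneg[OF L2_norm_nonneg])
      then show "\<exists>g\<in>approximable. L2_norm \<mu> (indicator (\<Union>i. A i) - g) < e"
        using 1[of k] by (intro bexI[of _ "indicator (\<Union>i<k. A i)"]) (simp_all add: L2_norm_minus_commute)
    qed
  qed
qed

text \<open>Simple functions are combinations of indicators up to values off the space, and every
  square-integrable function is a norm limit of simple ones, so closedness of
  \<open>approximable\<close> finishes.\<close>

theorem coset_average_tendsto:
  assumes f: "f \<in> L2 \<mu>"
  shows "(\<lambda>n. L2_norm \<mu> (coset_average p \<mu> n f - f)) \<longlonglongrightarrow> 0"
proof -
  have simple: "s \<in> approximable" if s: "simple_function \<mu> s" for s :: "padic \<Rightarrow> complex"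
  proof (rule approximable_limit)
    have fin: "finite (s ` space \<mu>)" using s by (rule simple_functionD)
    show sL: "s \<in> L2 \<mu>"
    proof (rule L2_bounded)
      show "s \<in> borel_measurable \<mu>" using s by (rule borel_measurable_simple_function)
      show "cmod (s x) \<le> Max (cmod ` s ` space \<mu>)" if "x \<in> space \<mu>" for x
        using fin that by (intro Max_ge) auto
    qed
    fix e :: real assume "e > 0"
    let ?g = "\<Sum>y\<in>s ` space \<mu>. (\<lambda>x. y * indicator (s -` {y} \<inter> space \<mu>) x)"
    have "?g \<in> approximable"
      by (intro cfun.subspace_sum[OF subspace_approximable] cfun.subspace_scale[OF subspace_approximable]
          indicator_approximable simple_functionD(2)[OF s])
    moreover have "L2_norm \<mu> (s - ?g) = 0"
    proof -
      have eq: "s x = ?g x" if "x \<in> space \<mu>" for x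
        by (rule trans[OF simple_function_indicator_representation_banach[OF s that]])
          (simp only: sum_fun_apply scaleR_conv_of_real mult.commute of_real_indicator)
      have "(s - ?g) x = 0" if "x \<in> space \<mu>" for x
        unfolding minus_apply eq[OF that] by (rule diff_self)
      then have "L2_norm \<mu> (s - ?g) = L2_norm \<mu> 0"
        unfolding L2_norm_def
        by (intro arg_cong[of _ _ sqrt] Bochner_Integration.integral_cong refl) (simp only: zero_fun_apply)
      then show ?thesis by (simp only: L2_norm_zero)
    qed
    ultimately show "\<exists>g\<in>approximable. L2_norm \<mu> (s - g) < e"
      using \<open>e > 0\<close> by (intro bexI[of _ ?g]) (simp_all only:)
  qed
  have fm: "f \<in> borel_measurable \<mu>" using f by (rule L2_measurable)
  obtain F where F: "\<And>i. simple_function \<mu> (F i)" "\<And>x. x \<in> space \<mu> \<Longrightarrow> (\<lambda>i. F i x) \<longlonglongrightarrow> f x"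
      "\<And>i x. x \<in> space \<mu> \<Longrightarrow> dist (F i x) 0 \<le> 2 * dist (f x) 0"
    using borel_measurable_implies_sequence_metric[OF fm, of 0] by blast
  \<comment> \<open>The simple functions satisfy |F i| <= 2 |f|, so the error is at most 3 |f| and
    its square at most 9 |f|^2.\<close>
  have lim: "(\<lambda>i. L2_norm \<mu> (F i - f)) \<longlonglongrightarrow> 0"
  proof (rule L2_norm_dominated_convergence[where w = "\<lambda>x. 9 * (cmod (f x))\<^sup>2"])
    show "integrable \<mu> (\<lambda>x. 9 * (cmod (f x))\<^sup>2)" using L2_integrable[OF f] by simp
    fix i x assume x: "x \<in> space \<mu>"
    have "cmod (F i x - f x) \<le> cmod (F i x) + cmod (f x)" by (rule norm_triangle_ineq4)
    also have "\<dots> \<le> 3 * cmod (f x)" using F(3)[OF x, of i] by simp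
    finally have "(cmod (F i x - f x))\<^sup>2 \<le> (3 * cmod (f x))\<^sup>2" by (intro power_mono) auto
    then show "(cmod (F i x - f x))\<^sup>2 \<le> 9 * (cmod (f x))\<^sup>2" by (simp add: power_mult_distrib)
  qed (use F(2) fm borel_measurable_simple_function[OF F(1)] in auto)
  have "f \<in> approximable"
  proof (rule approximable_limit[OF f])
    fix e :: real assume "e > 0"
    then obtain i where "L2_norm \<mu> (F i - f) < e" using LIMSEQ_D[OF lim, of e] by (auto simp: abs_of_nonneg[OF L2_norm_nonneg])
    then show "\<exists>g\<in>approximable. L2_norm \<mu> (f - g) < e"
      using simple[OF F(1)] by (intro bexI[of _ "F i"]) (simp_all add: L2_norm_minus_commute)
  qed
  then show ?thesis by (simp add: approximable_def)
qed

text \<open>If h were missed by V, some linear functional would vanish on V and take the value 1 at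
  h. On the finite-dimensional space of step functions every functional is bounded, so h could not
  be approximated from V.\<close>

lemma dense_subspace_step:
  assumes V: "cfun.subspace V" "V \<subseteq> step p n"
    and dense: "\<And>h e. h \<in> step p n \<Longrightarrow> e > 0 \<Longrightarrow> \<exists>v\<in>V. L2_norm \<mu> (h - v) < e"
  shows "V = step p n"
proof (rule ccontr)
  assume "V \<noteq> step p n"
  then obtain h where h: "h \<in> step p n" "h \<notin> V" using V by blast
  obtain B where B: "B \<subseteq> V" "cfun.independent B" "V \<subseteq> cfun.span B"
    using cfun.maximal_independent_subset by blast
  have spB: "cfun.span B \<subseteq> V" using cfun.span_minimal[OF B(1) V(1)] .
  then have hB: "h \<notin> cfun.span B" using h(2) by blast
  then have ind: "cfun.independent (insert h B)" using B(2) by (simp add: cfun.independent_insert)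
  obtain \<phi> where \<phi>: "Vector_Spaces.linear (\<lambda>c f x. c * f x) (*) \<phi>"
      "\<And>x. x \<in> insert h B \<Longrightarrow> \<phi> x = (if x = h then 1 else 0)"
    using linear_functional_extension[OF ind, of "\<lambda>x. if x = h then 1 else 0"] by blast
  interpret \<phi>: Vector_Spaces.linear "\<lambda>(c::complex) (f::padic \<Rightarrow> complex) x. c * f x"
      "(*) :: complex \<Rightarrow> complex \<Rightarrow> complex" \<phi> by (rule \<phi>(1))
  have "h \<notin> B" using hB cfun.span_base by blast
  have zero: "\<phi> v = 0" if "v \<in> V" for v
  proof -
    have "v \<in> cfun.span B" using that B(3) by blast
    then show ?thesis
    proof (induction rule: cfun.span_induct_alt)
      case base
      show ?case by (rule \<phi>.zero)
    next
      case (step c x y)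
      have "\<phi> x = 0" using \<phi>(2)[of x] step(1) \<open>h \<notin> B\<close> by auto
      then show ?case unfolding \<phi>.add \<phi>.scale step by simp
    qed
  qed
  \<comment> \<open>The value of a step function g on a coset is p^n times its inner product with
    the indicator of that coset; Cauchy-Schwarz then bounds the contribution of the coset to \<phi>
    g by \<open>K a\<close> times the norm of g.\<close>
  define K where "K a = cmod (\<phi> (indicator (coset p n a))) * (real p ^ n * L2_norm \<mu> (indicator (coset p n a)))" for a
  define C where "C = (\<Sum>a\<in>{0..<int p ^ n}. K a)"
  have K0: "0 \<le> K a" for a by (simp add: K_def L2_norm_nonneg)
  have bound: "cmod (\<phi> g) \<le> C * L2_norm \<mu> g" if g: "g \<in> step p n" for g
  proof -
    have "\<phi> g = \<phi> (\<Sum>a\<in>{0..<int p ^ n}. (\<lambda>x. g (zp_of_int p a) * indicator (coset p n a) x))"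
      using step_expand[OF p_pos g] by (rule arg_cong)
    also have "\<dots> = (\<Sum>a\<in>{0..<int p ^ n}. g (zp_of_int p a) * \<phi> (indicator (coset p n a)))"
      unfolding \<phi>.sum by (intro sum.cong refl \<phi>.scale)
    finally have "cmod (\<phi> g) \<le> (\<Sum>a\<in>{0..<int p ^ n}. cmod (g (zp_of_int p a) * \<phi> (indicator (coset p n a))))"
      by (simp only: norm_sum)
    also have "\<dots> \<le> (\<Sum>a\<in>{0..<int p ^ n}. K a * L2_norm \<mu> g)"
    proof (rule sum_mono)
      fix a assume a: "a \<in> {0..<int p ^ n}"
      let ?I = "indicator (coset p n a) :: padic \<Rightarrow> complex"
      have "L2_inner \<mu> g ?I = (\<integral>x. g (zp_of_int p a) * ?I x \<partial>\<mu>)"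
        unfolding L2_inner_def
      proof (intro Bochner_Integration.integral_cong refl)
        fix x
        have "g x = g (zp_of_int p a)" if "x \<in> coset p n a"
          using that a by (intro step_eq[OF g _ zp_of_int_in[OF p_pos]]) (auto simp: coset_def zp_of_int_def)
        then show "g x * cnj (?I x) = g (zp_of_int p a) * ?I x" by (auto simp: indicator_def)
      qed
      also have "\<dots> = g (zp_of_int p a) / p ^ n"
        using measure_coset[OF a] by (simp add: integral_indicator_complex)
      finally have "g (zp_of_int p a) = p ^ n * L2_inner \<mu> g ?I" using p_pos by simp
      then have "cmod (g (zp_of_int p a)) = real p ^ n * cmod (L2_inner \<mu> g ?I)"
        by (simp add: norm_mult norm_power)
      also have "\<dots> \<le> real p ^ n * (L2_norm \<mu> g * L2_norm \<mu> ?I)"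
        by (intro mult_left_mono L2_Cauchy_Schwarz step_L2[OF g] indicator_L2) auto
      finally have "cmod (g (zp_of_int p a)) * cmod (\<phi> ?I) \<le> real p ^ n * (L2_norm \<mu> g * L2_norm \<mu> ?I) * cmod (\<phi> ?I)"
        by (rule mult_right_mono) simp
      then show "cmod (g (zp_of_int p a) * \<phi> ?I) \<le> K a * L2_norm \<mu> g"
        by (simp add: norm_mult K_def mult_ac)
    qed
    also have "\<dots> = C * L2_norm \<mu> g" by (simp add: C_def sum_distrib_right)
    finally show ?thesis .
  qed
  have C0: "0 \<le> C" using K0 by (simp add: C_def sum_nonneg)
  \<comment> \<open>The tolerance 1 / (C + 1) makes the bound C / (C + 1) less than 1, also when C =
    0.\<close>
  obtain v where v: "v \<in> V" "L2_norm \<mu> (h - v) < 1 / (C + 1)"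
    using dense[OF h(1), of "1 / (C + 1)"] C0 by auto
  have "\<phi> (h - v) = \<phi> h - \<phi> v" by (rule \<phi>.diff)
  then have "\<phi> (h - v) = 1" using zero[OF v(1)] \<phi>(2)[of h] by simp
  then have "1 \<le> C * L2_norm \<mu> (h - v)"
    using bound[of "h - v"] cfun.subspace_diff[OF subspace_step[OF p_pos] h(1)] v(1) V(2)
    by (metis norm_one subset_iff)
  also have "\<dots> \<le> C * (1 / (C + 1))" using v(2) C0 by (intro mult_left_mono) auto
  also have "\<dots> < 1" using C0 by (simp add: field_simps)
  finally show False by simp
qed

end

section \<open>Direct sums of copies of an L2 space\<close>

lemma copies_measurable_iff:
  "f \<in> borel_measurable (copies n M) \<longleftrightarrow> (\<forall>i<n. (\<lambda>x. f (i, x)) \<in> borel_measurable M)"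
proof (intro iffI allI impI)
  fix i assume f: "f \<in> borel_measurable (copies n M)" and i: "i < n"
  show "(\<lambda>x. f (i, x)) \<in> borel_measurable M"
    by (rule measurable_compose[OF measurable_Pair1' f[unfolded copies_def]]) (use i in simp)
next
  assume "\<forall>i<n. (\<lambda>x. f (i, x)) \<in> borel_measurable M"
  then show "f \<in> borel_measurable (copies n M)"
    unfolding copies_def by (intro measurable_pair_measure_countable1) auto
qed

context finite_measure
begin

lemma copies_integrable_iff:
  fixes f :: "nat \<times> 'a \<Rightarrow> 'b::{banach, second_countable_topology}"
  assumes f: "f \<in> borel_measurable (copies n M)"
  shows "integrable (copies n M) f \<longleftrightarrow> (\<forall>i<n. integrable M (\<lambda>x. f (i, x)))"
proof -
  have fi: "(\<lambda>x. f (i, x)) \<in> borel_measurable M" if "i < n" for i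
    using f that by (simp add: copies_measurable_iff)
  have f': "f \<in> borel_measurable (count_space {..<n} \<Otimes>\<^sub>M M)" using f by (simp add: copies_def)
  have "(\<integral>\<^sup>+ z. norm (f z) \<partial>copies n M) = (\<integral>\<^sup>+ i. \<integral>\<^sup>+ x. norm (f (i, x)) \<partial>M \<partial>count_space {..<n})"
    unfolding copies_def using f' by (intro nn_integral_fst[symmetric]) measurable
  also have "\<dots> = (\<Sum>i<n. \<integral>\<^sup>+ x. norm (f (i, x)) \<partial>M)" by (simp add: nn_integral_count_space_finite)
  finally have eq: "(\<integral>\<^sup>+ z. norm (f z) \<partial>copies n M) = (\<Sum>i<n. \<integral>\<^sup>+ x. norm (f (i, x)) \<partial>M)" .
  have "(\<Sum>i\<in>I. g i) < \<infinity> \<longleftrightarrow> (\<forall>i\<in>I. g i < \<infinity>)" if "finite I" for I and g :: "nat \<Rightarrow> ennreal"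
    using that by induction auto
  then show ?thesis using f fi eq by (auto simp: integrable_iff_bounded)
qed

lemma copies_integral:
  fixes f :: "nat \<times> 'a \<Rightarrow> 'b::{banach, second_countable_topology}"
  assumes "integrable (copies n M) f"
  shows "(\<integral>z. f z \<partial>copies n M) = (\<Sum>i<n. \<integral>x. f (i, x) \<partial>M)"
proof -
  interpret P: pair_sigma_finite "count_space {..<n}" M
    by (intro pair_sigma_finite.intro sigma_finite_measure_count_space_finite sigma_finite_measure_axioms) simp
  have "(\<integral>i. \<integral>x. f (i, x) \<partial>M \<partial>count_space {..<n}) = (\<integral>z. f z \<partial>copies n M)"
    unfolding copies_def by (rule P.integral_fst'[OF assms[unfolded copies_def]])
  then show ?thesis by (simp add: lebesgue_integral_count_space_finite)
qed

text \<open>Counting measure has no null points, so an exceptional set is null exactly when each of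
  its n slices is.\<close>

lemma copies_AE_eq_iff:
  assumes f: "f \<in> borel_measurable (copies n M)" and g: "g \<in> borel_measurable (copies n M)"
  shows "(AE z in copies n M. f z = (g z :: complex)) \<longleftrightarrow> (\<forall>i<n. AE x in M. f (i, x) = g (i, x))"
proof -
  interpret P: pair_sigma_finite "count_space {..<n}" M
    by (intro pair_sigma_finite.intro sigma_finite_measure_count_space_finite sigma_finite_measure_axioms) simp
  have *: "{z \<in> space (count_space {..<n} \<Otimes>\<^sub>M M). f z = g z} \<in> sets (count_space {..<n} \<Otimes>\<^sub>M M)"
    using f g unfolding copies_def by measurable
  show ?thesis
    using P.AE_pair[of "\<lambda>z. f z = g z"] P.AE_pair_measure[OF *]
    unfolding copies_def by (auto simp: AE_count_space)
qed

lemma L2_copies_iff: "\<xi> \<in> L2 (copies n M) \<longleftrightarrow> (\<forall>i<n. (\<lambda>x. \<xi> (i, x)) \<in> L2 M)"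
proof (cases "\<xi> \<in> borel_measurable (copies n M)")
  case True
  then have "(\<lambda>z. (cmod (\<xi> z))\<^sup>2) \<in> borel_measurable (copies n M)" by measurable
  then show ?thesis using True by (auto simp: L2_def copies_integrable_iff copies_measurable_iff)
next
  case False
  then show ?thesis by (auto simp: L2_def copies_measurable_iff)
qed

lemma L2_norm_copies:
  assumes "\<xi> \<in> L2 (copies n M)"
  shows "L2_norm (copies n M) \<xi> = sqrt (\<Sum>i<n. (L2_norm M (\<lambda>x. \<xi> (i, x)))\<^sup>2)"
  by (simp add: L2_norm_square) (simp add: L2_norm_def copies_integral[OF L2_integrable[OF assms]])

lemma L2_inner_copies:
  assumes "\<xi> \<in> L2 (copies n M)" "\<eta> \<in> L2 (copies n M)"
  shows "L2_inner (copies n M) \<xi> \<eta> = (\<Sum>i<n. L2_inner M (\<lambda>x. \<xi> (i, x)) (\<lambda>x. \<eta> (i, x)))"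
  unfolding L2_inner_def by (rule copies_integral[OF L2_inner_integrable[OF assms]])

lemma L2_null_copies_iff: "\<xi> \<in> L2_null (copies n M) \<longleftrightarrow> (\<forall>i<n. (\<lambda>x. \<xi> (i, x)) \<in> L2_null M)"
  using copies_AE_eq_iff[of \<xi> n "\<lambda>_. 0"] L2_measurable[of \<xi> "copies n M"]
  by (auto simp: L2_null_def L2_copies_iff)

end

section \<open>Characters are locally constant\<close>

text \<open>z^2 - 1 = (z + 1)(z - 1), and close to 1 the factor z + 1 has modulus at least 3/2.
  Repeated squaring thus drives any z other than 1 out of the disc of radius 1/2.\<close>

lemma square_minus_one_expanding:
  assumes "cmod (z - 1) \<le> 1 / 2"
  shows "3 / 2 * cmod (z - 1) \<le> cmod (z * z - 1)"
proof -
  have "2 \<le> cmod (z + 1) + cmod (z - 1)"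
    using norm_triangle_ineq4[of "z + 1" "z - 1"] by simp
  then have "3 / 2 * cmod (z - 1) \<le> cmod (z + 1) * cmod (z - 1)"
    using assms by (intro mult_right_mono) auto
  also have "\<dots> = cmod (z * z - 1)" by (simp add: norm_mult[symmetric] algebra_simps)
  finally show ?thesis .
qed

text \<open>By continuity some subgroup p^r Z_p is sent into the disc of radius 1/2 around 1. Its
  image is closed under squaring, which expands distances to 1, so it is trivial.\<close>

lemma zp_character_locally_constant:
  assumes p: "0 < p" and \<psi>: "zp_character p \<psi>"
  shows "\<exists>r. \<forall>x\<in>Zp p. \<forall>y\<in>Zp p. x r = y r \<longrightarrow> \<psi> x = \<psi> y"
proof -
  let ?o = "zp_of_int p 0"
  have cont: "continuous_on (Zp p) \<psi>" and unit: "\<And>x. x \<in> Zp p \<Longrightarrow> cmod (\<psi> x) = 1"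
    and hom: "\<And>x y. x \<in> Zp p \<Longrightarrow> y \<in> Zp p \<Longrightarrow> \<psi> (zp_add p x y) = \<psi> x * \<psi> y"
    using \<psi> by (auto simp: zp_character_def)
  have o: "?o \<in> Zp p" by (rule zp_of_int_in[OF p])
  have "zp_add p ?o ?o = ?o" by (simp add: zp_add_def zp_of_int_def)
  then have "\<psi> ?o * \<psi> ?o = \<psi> ?o * 1" using hom[OF o o] by simp
  moreover have "\<psi> ?o \<noteq> 0" using unit[OF o] by auto
  ultimately have \<psi>0: "\<psi> ?o = 1" by (simp only: mult_cancel_left) simp
  \<comment> \<open>Otherwise each p^r Z_p contains a bad point \<open>X r\<close>; these points
    tend to 0 in every coordinate, against continuity at 0.\<close>
  obtain r where r: "\<And>x. x \<in> Zp p \<Longrightarrow> x r = 0 \<Longrightarrow> cmod (\<psi> x - 1) \<le> 1 / 2"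
  proof (rule ccontr)
    assume "\<not> thesis"
    then have "\<forall>r. \<exists>x. x \<in> Zp p \<and> x r = 0 \<and> 1 / 2 < cmod (\<psi> x - 1)" using that by (metis not_le)
    then obtain X where X: "\<And>r. X r \<in> Zp p" "\<And>r. X r r = 0" "\<And>r. 1 / 2 < cmod (\<psi> (X r) - 1)" by metis
    have "limitin (product_topology (\<lambda>i. euclidean) UNIV) X ?o sequentially"
      unfolding limitin_componentwise
    proof (intro conjI ballI)
      fix k
      have "X n k = ?o k" if "k \<le> n" for n
        using Zp_mod[OF X(1) that, of n] X(2)[of n] by (simp add: zp_of_int_def)
      then have "eventually (\<lambda>n. X n k = ?o k) sequentially" by (rule eventually_sequentiallyI)
      then show "limitin euclidean (\<lambda>n. X n k) (?o k) sequentially"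
        unfolding limitin_canonical_iff by (rule tendsto_eventually)
    qed auto
    then have "X \<longlonglongrightarrow> ?o" unfolding euclidean_product_topology limitin_canonical_iff .
    then have "(\<lambda>r. \<psi> (X r)) \<longlonglongrightarrow> \<psi> ?o"
      using X(1) by (intro continuous_on_tendsto_compose[OF cont _ o]) auto
    then obtain n where "dist (\<psi> (X n)) 1 < 1 / 2"
      unfolding \<psi>0 using metric_LIMSEQ_D[of _ 1 "1 / 2"] by force
    then show False using X(3)[of n] by (simp add: dist_norm)
  qed
  have one: "\<psi> x = 1" if x: "x \<in> Zp p" "x r = 0" for x
  proof (rule ccontr)
    assume ne: "\<psi> x \<noteq> 1"
    \<comment> \<open>The witness is y = 2^k x, obtained by repeated doubling, which never leaves
      p^r Z_p.\<close>
    have "\<exists>y. y \<in> Zp p \<and> y r = 0 \<and> (3 / 2) ^ k * cmod (\<psi> x - 1) \<le> cmod (\<psi> y - 1)" for k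
    proof (induction k)
      case 0
      show ?case using x by (intro exI[of _ x]) simp
    next
      case (Suc k)
      then obtain y where y: "y \<in> Zp p" "y r = 0" "(3 / 2) ^ k * cmod (\<psi> x - 1) \<le> cmod (\<psi> y - 1)" by blast
      have "(3 / 2) ^ Suc k * cmod (\<psi> x - 1) \<le> 3 / 2 * cmod (\<psi> y - 1)" using y(3) by (simp add: mult.commute)
      also have "\<dots> \<le> cmod (\<psi> (zp_add p y y) - 1)"
        using square_minus_one_expanding[OF r[OF y(1,2)]] hom[OF y(1) y(1)] by simp
      finally show ?case using zp_add_in[OF p y(1) y(1)] y(2)
        by (intro exI[of _ "zp_add p y y"]) (simp add: zp_add_def)
    qed
    then have "(3 / 2) ^ k * cmod (\<psi> x - 1) \<le> 1 / 2" for k using r by (meson order_trans)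
    moreover obtain k where "1 / (2 * cmod (\<psi> x - 1)) < (3 / 2) ^ k"
      using real_arch_pow[of "3 / 2" "1 / (2 * cmod (\<psi> x - 1))"] by auto
    moreover have "0 < cmod (\<psi> x - 1)" using ne by simp
    ultimately show False by (simp add: field_simps) (smt (verit))
  qed
  have "\<psi> x = \<psi> y" if xy: "x \<in> Zp p" "y \<in> Zp p" "x r = y r" for x y
  proof -
    have "zp_diff p x y \<in> Zp p" "zp_diff p x y r = 0"
      using zp_diff_in[OF p xy(1,2)] xy(3) by (auto simp: zp_diff_def)
    then have "\<psi> (zp_add p y (zp_diff p x y)) = \<psi> y" using hom[OF xy(2)] one by simp
    then show ?thesis using zp_add_diff[OF p xy(1), of y] by simp
  qed
  then show ?thesis by blast
qed

lemma O_Zp_locally_constant: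
  assumes p: "0 < p" and f: "f \<in> O_Zp p"
  shows "\<exists>r. \<forall>x\<in>Zp p. \<forall>y\<in>Zp p. x r = y r \<longrightarrow> f x = f y"
  using f unfolding O_Zp_def
proof (induction rule: cfun.span_induct_alt)
  case base
  show ?case by simp
next
  case (step c \<psi> g)
  obtain r where r: "\<forall>x\<in>Zp p. \<forall>y\<in>Zp p. x r = y r \<longrightarrow> \<psi> x = \<psi> y"
    using zp_character_locally_constant[OF p] step(1) by blast
  obtain s where s: "\<forall>x\<in>Zp p. \<forall>y\<in>Zp p. x s = y s \<longrightarrow> g x = g y" using step(2) by blast
  have "((\<lambda>x. c * \<psi> x) + g) x = ((\<lambda>x. c * \<psi> x) + g) y"
    if xy: "x \<in> Zp p" "y \<in> Zp p" "x (max r s) = y (max r s)" for x y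
  proof -
    have "x r = y r" "x s = y s" using Zp_eq_mono[OF xy(1,2) _ xy(3)] by auto
    then have "\<psi> x = \<psi> y" "g x = g y" using r s xy by blast+
    then show ?thesis by simp
  qed
  then show ?case by blast
qed

section \<open>Equivariant operators commute with averages\<close>

context haar_padic
begin

lemma regular_L2:
  assumes x: "x \<in> Zp p" and f: "f \<in> L2 \<mu>"
  shows "regular p x f \<in> L2 \<mu>"
proof -
  have "regular p x f \<in> borel_measurable \<mu>"
    unfolding regular_def by (rule measurable_compose[OF translation_measurable[OF x] L2_measurable[OF f]])
  moreover have "integrable \<mu> (\<lambda>y. (cmod (f (zp_diff p y x)))\<^sup>2)"
  proof (rule integrable_distr[OF translation_measurable[OF x]])
    show "integrable (distr \<mu> \<mu> (\<lambda>y. zp_diff p y x)) (\<lambda>y. (cmod (f y))\<^sup>2)"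
      unfolding distr_translation[OF x] by (rule L2_integrable[OF f])
  qed
  ultimately show ?thesis by (simp add: L2_def regular_def)
qed

lemma regular_norm:
  assumes x: "x \<in> Zp p" and f: "f \<in> L2 \<mu>"
  shows "L2_norm \<mu> (regular p x f) = L2_norm \<mu> f"
proof -
  have "(\<lambda>y. (cmod (f y))\<^sup>2) \<in> borel_measurable \<mu>" using L2_measurable[OF f] by measurable
  from integral_translation[OF x this] show ?thesis by (simp add: L2_norm_def regular_def)
qed

text \<open>The adjoint of a translation is the opposite translation, by shifting the variable of
  integration.\<close>

lemma regular_inner:
  assumes y: "y \<in> Zp p" and f: "f \<in> L2 \<mu>" and k: "k \<in> L2 \<mu>"
  shows "L2_inner \<mu> (regular p (zp_diff p (zp_of_int p 0) y) f) k = L2_inner \<mu> f (regular p y k)"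
proof -
  let ?x = "zp_diff p (zp_of_int p 0) y"
  have x: "?x \<in> Zp p" by (rule zp_diff_in[OF p_pos zp_of_int_in[OF p_pos] y])
  let ?F = "\<lambda>w. f w * cnj (regular p y k w)"
  have "?F \<in> borel_measurable \<mu>"
    by (intro borel_measurable_times borel_measurable_cnj L2_measurable f regular_L2 y k)
  from integral_translation[OF x this]
  have "L2_inner \<mu> f (regular p y k) = (\<integral>z. ?F (zp_diff p z ?x) \<partial>\<mu>)" by (simp add: L2_inner_def)
  also have "\<dots> = L2_inner \<mu> (regular p ?x f) k"
    unfolding L2_inner_def regular_def
    by (intro Bochner_Integration.integral_cong refl) (simp add: zp_diff_neg_diff[OF p_pos] space_\<mu>)
  finally show ?thesis by simp
qed

text \<open>Sums translates over the representatives p^m j of p^m Z_p modulo p^n Z_p. The sum is not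
  divided by their number p^(n - m), which appears explicitly wherever it matters.\<close>

definition finite_average :: "nat \<Rightarrow> nat \<Rightarrow> (padic \<Rightarrow> complex) \<Rightarrow> (padic \<Rightarrow> complex)" where
  "finite_average m n h = (\<Sum>j\<in>{0..<int p ^ (n - m)}. regular p (zp_of_int p (int p ^ m * j)) h)"

lemma finite_average_L2: "h \<in> L2 \<mu> \<Longrightarrow> finite_average m n h \<in> L2 \<mu>"
  unfolding finite_average_def by (intro L2_sum regular_L2 zp_of_int_in[OF p_pos])

lemma finite_average_norm_le:
  assumes h: "h \<in> L2 \<mu>"
  shows "L2_norm \<mu> (finite_average m n h) \<le> real p ^ (n - m) * L2_norm \<mu> h"
proof -
  have "L2_norm \<mu> (finite_average m n h) \<le>
      (\<Sum>j\<in>{0..<int p ^ (n - m)}. L2_norm \<mu> (regular p (zp_of_int p (int p ^ m * j)) h))"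
    unfolding finite_average_def by (intro L2_norm_sum_le regular_L2 zp_of_int_in[OF p_pos] h) simp
  also have "\<dots> = real p ^ (n - m) * L2_norm \<mu> h"
    by (simp add: regular_norm[OF zp_of_int_in[OF p_pos] h])
  finally show ?thesis .
qed

lemma finite_average_diff: "finite_average m n (f - g) = finite_average m n f - finite_average m n g"
  by (simp add: finite_average_def fun_eq_iff sum_fun_apply regular_def sum_subtractf)

text \<open>Subtracting the multiples p^m j from y enumerates the cosets of level n inside the coset
  of y of level m.\<close>

lemma residues_bij_betw:
  assumes mn: "m \<le> n" and y: "y \<in> Zp p"
  shows "bij_betw (\<lambda>j. (y n - int p ^ m * j) mod int p ^ n) {0..<int p ^ (n - m)}
    {a \<in> {0..<int p ^ n}. a mod int p ^ m = y m}"
proof -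
  have pn: "int p ^ n = int p ^ m * int p ^ (n - m)" using mn by (simp flip: power_add)
  have pos: "0 < int p ^ k" for k using p_pos by simp
  show ?thesis
    unfolding bij_betw_def
  proof (intro conjI equalityI subsetI)
    show "inj_on (\<lambda>j. (y n - int p ^ m * j) mod int p ^ n) {0..<int p ^ (n - m)}"
    proof (rule inj_onI)
      fix i j assume ij: "i \<in> {0..<int p ^ (n - m)}" "j \<in> {0..<int p ^ (n - m)}"
        and "(y n - int p ^ m * i) mod int p ^ n = (y n - int p ^ m * j) mod int p ^ n"
      then have "int p ^ n dvd (y n - int p ^ m * i) - (y n - int p ^ m * j)" by (simp only: mod_eq_dvd_iff)
      then have "int p ^ m * int p ^ (n - m) dvd int p ^ m * (j - i)" by (simp add: pn algebra_simps)
      then have "int p ^ (n - m) dvd j - i" using p_pos by simp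
      then have "j mod int p ^ (n - m) = i mod int p ^ (n - m)" by (simp only: mod_eq_dvd_iff)
      then show "i = j" using ij by simp
    qed
  next
    fix a assume "a \<in> (\<lambda>j. (y n - int p ^ m * j) mod int p ^ n) ` {0..<int p ^ (n - m)}"
    then obtain j where a: "a = (y n - int p ^ m * j) mod int p ^ n" by blast
    have "a mod int p ^ m = (y n - int p ^ m * j) mod int p ^ m" unfolding a pn by (simp add: mod_mod_cancel)
    also have "\<dots> = (y n - int p ^ m * j mod int p ^ m) mod int p ^ m" by (rule mod_diff_right_eq[symmetric])
    also have "\<dots> = y n mod int p ^ m" by simp
    also have "\<dots> = y m" by (rule Zp_mod[OF y mn])
    finally show "a \<in> {a \<in> {0..<int p ^ n}. a mod int p ^ m = y m}" using a pos[of n] by simp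
  next
    fix a assume a: "a \<in> {a \<in> {0..<int p ^ n}. a mod int p ^ m = y m}"
    then have "y n mod int p ^ m = a mod int p ^ m" using Zp_mod[OF y mn] by simp
    then have "int p ^ m dvd y n - a" by (simp only: mod_eq_dvd_iff)
    then obtain t where t: "y n - a = int p ^ m * t" by blast
    let ?j = "t mod int p ^ (n - m)"
    have "int p ^ m * ?j mod int p ^ n = int p ^ m * t mod int p ^ n" 
      unfolding pn by (simp only: mult_mod_right mod_mod_trivial)
    then have "(y n - int p ^ m * ?j) mod int p ^ n = (y n - int p ^ m * t) mod int p ^ n"
      by (rule mod_diff_cong[OF refl])
    also have "y n - int p ^ m * t = a" using t by simp
    finally have "a = (y n - int p ^ m * ?j) mod int p ^ n" using a by simp
    moreover have "?j \<in> {0..<int p ^ (n - m)}" using pos[of "n - m"] by simp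
    ultimately show "a \<in> (\<lambda>j. (y n - int p ^ m * j) mod int p ^ n) ` {0..<int p ^ (n - m)}" by blast
  qed
qed

text \<open>For a step function of level n the integral over y + p^m Z_p is a finite sum over the
  p^(n - m) smaller cosets, and the translations visit each of these once.\<close>

lemma finite_average_step:
  assumes mn: "m \<le> n" and h: "h \<in> step p n" and y: "y \<in> Zp p"
  shows "finite_average m n h y = of_nat (p ^ (n - m)) * coset_average p \<mu> m h y"
proof -
  have pn: "p ^ n = p ^ m * p ^ (n - m)" using mn by (simp flip: power_add)
  have coeff: "(\<integral>z. indicator (coset p n a) z * h z \<partial>\<mu>) = h (zp_of_int p a) / p ^ n"
    if a: "a \<in> {0..<int p ^ n}" for a
  proof -
    have "h z = h (zp_of_int p a)" if "z \<in> coset p n a" for z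
      using that a by (intro step_eq[OF h _ zp_of_int_in[OF p_pos]]) (auto simp: coset_def zp_of_int_def)
    then have "(\<integral>z. indicator (coset p n a) z * h z \<partial>\<mu>) = (\<integral>z. indicator (coset p n a) z * h (zp_of_int p a) \<partial>\<mu>)"
      by (intro Bochner_Integration.integral_cong) (auto simp: indicator_def)
    then show ?thesis using measure_coset[OF a] by (simp add: integral_indicator_complex)
  qed
  have ind: "indicator (coset p m (y m)) \<in> step p n"
    using indicator_coset_step[OF p_pos] step_mono[OF p_pos mn] by blast
  let ?A = "{a \<in> {0..<int p ^ n}. a mod int p ^ m = y m}"
  have "(\<integral>z. indicator (coset p m (y m)) z * h z \<partial>\<mu>) =
      (\<Sum>a\<in>{0..<int p ^ n}. indicator (coset p m (y m)) (zp_of_int p a) * (h (zp_of_int p a) / p ^ n))"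
    unfolding integral_step_mult[OF ind step_L2[OF h]] using coeff by (intro sum.cong) auto
  also have "\<dots> = (\<Sum>a\<in>?A. h (zp_of_int p a) / p ^ n)"
    using zp_of_int_in[OF p_pos]
    by (intro sum.mono_neutral_cong_right) (auto simp: indicator_def coset_def zp_of_int_def)
  also have "\<dots> = (\<Sum>a\<in>?A. h (zp_of_int p a)) / p ^ n" by (simp add: sum_divide_distrib)
  finally have "of_nat (p ^ (n - m)) * coset_average p \<mu> m h y =
      of_nat (p ^ n) * ((\<Sum>a\<in>?A. h (zp_of_int p a)) / p ^ n)"
    using y unfolding pn by (simp add: coset_average_def mult_ac)
  also have "\<dots> = (\<Sum>a\<in>?A. h (zp_of_int p a))" using p_pos by simp
  also have "\<dots> = (\<Sum>j\<in>{0..<int p ^ (n - m)}. h (zp_of_int p ((y n - int p ^ m * j) mod int p ^ n)))"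
    by (rule sum.reindex_bij_betw[OF residues_bij_betw[OF mn y], symmetric])
  also have "\<dots> = finite_average m n h y"
    unfolding finite_average_def sum_fun_apply regular_def
  proof (intro sum.cong refl step_eq[OF h] zp_of_int_in[OF p_pos] zp_diff_in[OF p_pos y])
    fix j
    show "zp_of_int p ((y n - int p ^ m * j) mod int p ^ n) n = zp_diff p y (zp_of_int p (int p ^ m * j)) n"
      by (simp add: zp_of_int_def zp_diff_def mod_diff_right_eq)
  qed
  finally show ?thesis by simp
qed

text \<open>Replacing h by its average of level n makes the finite average exact; translations are
  isometries, so the replacement costs at most the norm of the difference. A bound on inner products
  is enough, because D is tested only against its adjoint.\<close>

lemma finite_average_inner_bound:
  assumes g: "g \<in> L2 \<mu>" and h: "h \<in> L2 \<mu>" and mn: "m \<le> n"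
  shows "cmod (L2_inner \<mu> g (coset_average p \<mu> m h) - L2_inner \<mu> g (finite_average m n h) / p ^ (n - m))
    \<le> L2_norm \<mu> g * L2_norm \<mu> (coset_average p \<mu> n h - h)"
proof -
  let ?h = "coset_average p \<mu> n h" and ?P = "real p ^ (n - m)"
  have P: "0 < ?P" using p_pos by simp
  have d: "?h - h \<in> L2 \<mu>" by (intro L2_diff coset_average_L2 h)
  have "L2_inner \<mu> g (finite_average m n ?h) = L2_inner \<mu> g (\<lambda>y. of_nat (p ^ (n - m)) * coset_average p \<mu> m h y)"
    unfolding L2_inner_def
    by (intro Bochner_Integration.integral_cong refl)
      (simp add: space_\<mu> finite_average_step[OF mn coset_average_step] coset_average_finer[OF h mn])
  then have "of_real ?P * L2_inner \<mu> g (coset_average p \<mu> m h) = L2_inner \<mu> g (finite_average m n ?h)"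
    by (simp add: L2_inner_scale_right)
  then have "of_real ?P * L2_inner \<mu> g (coset_average p \<mu> m h) - L2_inner \<mu> g (finite_average m n h) =
      L2_inner \<mu> g (finite_average m n (?h - h))"
    unfolding finite_average_diff
    using L2_inner_diff_right[OF finite_average_L2[OF coset_average_L2] finite_average_L2[OF h] g] by simp
  then have "cmod (of_real ?P * L2_inner \<mu> g (coset_average p \<mu> m h) - L2_inner \<mu> g (finite_average m n h))
      \<le> L2_norm \<mu> g * L2_norm \<mu> (finite_average m n (?h - h))"
    using L2_Cauchy_Schwarz[OF g finite_average_L2[OF d]] by simp
  also have "\<dots> \<le> L2_norm \<mu> g * (?P * L2_norm \<mu> (?h - h))"
    by (intro mult_left_mono finite_average_norm_le[OF d] L2_norm_nonneg)
  finally have le: "cmod (of_real ?P * L2_inner \<mu> g (coset_average p \<mu> m h) - L2_inner \<mu> g (finite_average m n h)) / ?P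
      \<le> L2_norm \<mu> g * L2_norm \<mu> (?h - h)"
    using P by (simp add: field_simps)
  have "L2_inner \<mu> g (coset_average p \<mu> m h) - L2_inner \<mu> g (finite_average m n h) / p ^ (n - m) =
      (of_real ?P * L2_inner \<mu> g (coset_average p \<mu> m h) - L2_inner \<mu> g (finite_average m n h)) / of_real ?P"
    using p_pos by (simp add: diff_divide_distrib)
  then show ?thesis using le P by (simp add: norm_divide norm_power)
qed

end

section \<open>Multiplication by step functions\<close>

context haar_padic
begin

lemma coset_average_cong:
  assumes "\<And>x. x \<in> Zp p \<Longrightarrow> f x = g x"
  shows "coset_average p \<mu> n f = coset_average p \<mu> n g"
proof -
  have "(\<integral>z. indicator (coset p n a) z * f z \<partial>\<mu>) = (\<integral>z. indicator (coset p n a) z * g z \<partial>\<mu>)" for a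
    using assms by (intro Bochner_Integration.integral_cong refl) (auto simp: indicator_def coset_def)
  then show ?thesis unfolding coset_average_def by (simp only:)
qed

text \<open>The factor s is constant on each coset that is averaged over. This is what makes
  averages commute with a locally constant projection.\<close>

lemma coset_average_step_mult:
  assumes s: "s \<in> step p n" and y: "y \<in> Zp p"
  shows "coset_average p \<mu> n (\<lambda>x. s x * f x) y = s y * coset_average p \<mu> n f y"
proof -
  have "(\<integral>z. indicator (coset p n (y n)) z * (s z * f z) \<partial>\<mu>) =
      (\<integral>z. s y * (indicator (coset p n (y n)) z * f z) \<partial>\<mu>)"
    using step_eq[OF s _ y] by (intro Bochner_Integration.integral_cong refl) (auto simp: indicator_def coset_def)
  then show ?thesis using y by (simp add: coset_average_def mult.left_commute)
qed

text \<open>A step function takes finitely many values on Z_p, and the sum of their moduli bounds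
  it.\<close>

lemma L2_step_mult:
  assumes s: "s \<in> step p n" and f: "f \<in> L2 \<mu>"
  shows "(\<lambda>x. s x * f x) \<in> L2 \<mu>"
proof -
  define C where "C = (\<Sum>a\<in>{0..<int p ^ n}. cmod (s (zp_of_int p a)))"
  have C: "cmod (s x) \<le> C" if x: "x \<in> Zp p" for x
  proof -
    have "s x = s (zp_of_int p (x n))"
      by (rule step_eq[OF s x zp_of_int_in[OF p_pos]]) (simp add: zp_of_int_def Zp_mod_self[OF x])
    also have "cmod (s (zp_of_int p (x n))) \<le> C"
      unfolding C_def using Zp_range[OF x, of n]
      by (intro member_le_sum[of "x n" _ "\<lambda>a. cmod (s (zp_of_int p a))"]) auto
    finally show ?thesis .
  qed
  show ?thesis
  proof (rule L2_I_bound[of _ _ "\<lambda>x. C\<^sup>2 * (cmod (f x))\<^sup>2"])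
    show "(\<lambda>x. s x * f x) \<in> borel_measurable \<mu>"
      by (intro borel_measurable_times L2_measurable[OF step_L2[OF s]] L2_measurable[OF f])
    show "(cmod (s x * f x))\<^sup>2 \<le> C\<^sup>2 * (cmod (f x))\<^sup>2" if "x \<in> space \<mu>" for x
      using C[of x] that by (auto simp: norm_mult power_mult_distrib space_\<mu> intro!: mult_right_mono power_mono)
  qed (use L2_integrable[OF f] in simp)
qed

lemma L2_cong:
  assumes "f \<in> L2 \<mu>" "\<And>x. x \<in> Zp p \<Longrightarrow> f x = g x"
  shows "g \<in> L2 \<mu>"
proof (rule L2_I_bound[OF _ L2_integrable[OF assms(1)]])
  show "g \<in> borel_measurable \<mu>"
    using L2_measurable[OF assms(1)] assms(2) measurable_cong[of \<mu> f g] by (simp add: space_\<mu>)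
qed (use assms(2) in \<open>simp add: space_\<mu>\<close>)

end

section \<open>Closedness and domain of an equivariant operator\<close>

locale equivariant_operator = haar_padic +
  fixes D :: "padic graph"
  assumes dense: "densely_defined_operator \<mu> D"
    and dirac_self_adjoint: "self_adjoint_graph (copies 2 \<mu>) (dirac \<mu> D)"
    and equi: "equivariant p \<mu> D"
begin

lemma D_L2: "(f, g) \<in> D \<Longrightarrow> f \<in> L2 \<mu> \<and> g \<in> L2 \<mu>"
  using dense by (auto simp: densely_defined_operator_def)

lemma D_add: "(f, g) \<in> D \<Longrightarrow> (f', g') \<in> D \<Longrightarrow> (f + f', g + g') \<in> D"
  using dense unfolding densely_defined_operator_def by blast

lemma D_scale: "(f, g) \<in> D \<Longrightarrow> (\<lambda>x. c * f x, \<lambda>x. c * g x) \<in> D"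
  using dense unfolding densely_defined_operator_def by blast

lemma D_null: "f \<in> L2_null \<mu> \<Longrightarrow> g \<in> L2_null \<mu> \<Longrightarrow> (f, g) \<in> D"
  using dense unfolding densely_defined_operator_def by (metis (no_types, lifting) L2_null_def mem_Collect_eq)

lemma D_single: "(f, g) \<in> D \<Longrightarrow> f \<in> L2_null \<mu> \<Longrightarrow> g \<in> L2_null \<mu>"
  using dense D_L2 unfolding densely_defined_operator_def by blast

text \<open>Adds the pair (f' - f, 0), which belongs to D because both entries are null.\<close>

lemma D_cong_AE:
  assumes "(f, g) \<in> D" "f' \<in> L2 \<mu>" "AE x in \<mu>. f x = f' x"
  shows "(f', g) \<in> D"
proof -
  have "f' - f \<in> L2_null \<mu>"
    using assms D_L2[OF assms(1)] by (auto simp: L2_null_def L2_diff simp del: minus_apply) (auto elim: AE_mp)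
  from D_add[OF assms(1) D_null[OF this cfun.subspace_0[OF subspace_L2_null]]]
  have "(f + (f' - f), g + 0) \<in> D" .
  then show ?thesis by simp
qed

text \<open>The assumption \<open>adj\<close> says that (f, g) lies in the double adjoint of D.
  Placing f in component 1 and g in component 0, the slots that \<open>dirac\<close> reserves for D,
  gives a pair in the adjoint of the Dirac operator, hence in the Dirac operator itself.\<close>

lemma D_closed:
  assumes f: "f \<in> L2 \<mu>" and g: "g \<in> L2 \<mu>"
    and adj: "\<And>h k. (h, k) \<in> adjoint_graph \<mu> D \<Longrightarrow> L2_inner \<mu> g h = L2_inner \<mu> f k"
  shows "(f, g) \<in> D"
proof -
  define \<xi> where "\<xi> = (\<lambda>(i::nat, x::padic). if i = 1 then f x else 0)"
  define \<eta> where "\<eta> = (\<lambda>(i::nat, x::padic). if i = 0 then g x else 0)"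
  have z: "(\<lambda>x::padic. 0 :: complex) \<in> L2 \<mu>" using L2_zero[of \<mu>] by (simp add: zero_fun_def)
  have L: "\<xi> \<in> L2 (copies 2 \<mu>)" "\<eta> \<in> L2 (copies 2 \<mu>)"
  proof -
    have "(\<lambda>x. \<xi> (i, x)) \<in> L2 \<mu>" for i using f z by (cases "i = 1") (simp_all add: \<xi>_def)
    moreover have "(\<lambda>x. \<eta> (i, x)) \<in> L2 \<mu>" for i using g z by (cases "i = 0") (simp_all add: \<eta>_def)
    ultimately show "\<xi> \<in> L2 (copies 2 \<mu>)" "\<eta> \<in> L2 (copies 2 \<mu>)" by (simp_all add: L2_copies_iff)
  qed
  have "(\<xi>, \<eta>) \<in> adjoint_graph (copies 2 \<mu>) (dirac \<mu> D)"
    unfolding adjoint_graph_def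
  proof (intro CollectI case_prodI conjI L ballI, clarify)
    fix a b assume ab: "(a, b) \<in> dirac \<mu> D"
    then have aL: "a \<in> L2 (copies 2 \<mu>)" "b \<in> L2 (copies 2 \<mu>)"
      and *: "(\<lambda>x. a (0, x), \<lambda>x. b (1, x)) \<in> adjoint_graph \<mu> D" by (auto simp: dirac_def)
    have two: "{..<2::nat} = {0, 1}" by auto
    have "L2_inner (copies 2 \<mu>) b \<xi> = L2_inner \<mu> (\<lambda>x. b (1, x)) f"
      by (simp add: L2_inner_copies aL L two) (simp add: L2_inner_def \<xi>_def)
    moreover have "L2_inner (copies 2 \<mu>) a \<eta> = L2_inner \<mu> (\<lambda>x. a (0, x)) g"
      by (simp add: L2_inner_copies aL L two) (simp add: L2_inner_def \<eta>_def)
    moreover have "L2_inner \<mu> (\<lambda>x. b (1, x)) f = L2_inner \<mu> (\<lambda>x. a (0, x)) g"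
      using adj[OF *] L2_inner_commute by metis
    ultimately show "L2_inner (copies 2 \<mu>) b \<xi> = L2_inner (copies 2 \<mu>) a \<eta>" by simp
  qed
  then have "(\<xi>, \<eta>) \<in> dirac \<mu> D" using dirac_self_adjoint by (simp add: self_adjoint_graph_def)
  then show ?thesis by (simp add: dirac_def \<xi>_def \<eta>_def)
qed

text \<open>The weak form of commuting with translations: equivariance of D lets a pair of its
  adjoint be translated while (f, g) stays fixed.\<close>

lemma adjoint_translation:
  assumes fg: "(f, g) \<in> D" and hk: "(h, k) \<in> adjoint_graph \<mu> D" and y: "y \<in> Zp p"
  shows "L2_inner \<mu> g (regular p y h) = L2_inner \<mu> f (regular p y k)"
proof -
  \<comment> \<open>Equivariance is used for -y, so that the translation in \<open>?U\<close>
    carries \<open>regular p y h\<close> back to h.\<close>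
  let ?x = "zp_diff p (zp_of_int p 0) y"
  have x: "?x \<in> Zp p" by (rule zp_diff_in[OF p_pos zp_of_int_in[OF p_pos] y])
  let ?U = "op_graph \<mu> (regular p ?x)"
  have h: "h \<in> L2 \<mu>" "k \<in> L2 \<mu>" using hk by (auto simp: adjoint_graph_def)
  have fgL: "f \<in> L2 \<mu>" "g \<in> L2 \<mu>" using D_L2[OF fg] by auto
  have "?U O D O adjoint_graph \<mu> ?U = D" using equi x by (auto simp: equivariant_def Let_def)
  then obtain f' g' where 1: "(f, f') \<in> ?U" and 2: "(f', g') \<in> D" and 3: "(g', g) \<in> adjoint_graph \<mu> ?U"
    using fg by blast
  have "(regular p y h, h) \<in> ?U"
    unfolding op_graph_def using regular_L2[OF y h(1)] h(1)
    by (auto simp: regular_def zp_diff_neg_diff[OF p_pos] space_\<mu> intro!: AE_I2)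
  then have "L2_inner \<mu> h g' = L2_inner \<mu> (regular p y h) g"
    using 3 by (auto simp: adjoint_graph_def)
  then have "L2_inner \<mu> g (regular p y h) = L2_inner \<mu> g' h" using L2_inner_commute by metis
  also have "\<dots> = L2_inner \<mu> f' k" using 2 hk by (auto simp: adjoint_graph_def)
  also have "\<dots> = L2_inner \<mu> (regular p ?x f) k"
    using 1 h regular_L2[OF x fgL(1)] by (intro L2_inner_cong_AE) (auto simp: op_graph_def L2_measurable)
  also have "\<dots> = L2_inner \<mu> f (regular p y k)" by (rule regular_inner[OF y fgL(1) h(2)])
  finally show ?thesis .
qed

text \<open>By \<open>D_closed\<close> only an identity of inner products with adjoint pairs is
  needed. It holds for the finite averages by \<open>adjoint_translation\<close>, and the errors
  vanish because the coset averages of h and k converge in norm.\<close>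

lemma coset_average_commutes:
  assumes fg: "(f, g) \<in> D"
  shows "(coset_average p \<mu> m f, coset_average p \<mu> m g) \<in> D"
proof (rule D_closed[OF coset_average_L2 coset_average_L2])
  fix h k assume hk: "(h, k) \<in> adjoint_graph \<mu> D"
  let ?E = "coset_average p \<mu>"
  have L: "f \<in> L2 \<mu>" "g \<in> L2 \<mu>" "h \<in> L2 \<mu>" "k \<in> L2 \<mu>"
    using D_L2[OF fg] hk by (auto simp: adjoint_graph_def)
  let ?d = "cmod (L2_inner \<mu> g (?E m h) - L2_inner \<mu> f (?E m k))"
  let ?b = "\<lambda>n. L2_norm \<mu> g * L2_norm \<mu> (?E n h - h) + L2_norm \<mu> f * L2_norm \<mu> (?E n k - k)"
  have "?d \<le> ?b n" if "m \<le> n" for n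
  proof -
    have "L2_inner \<mu> g (finite_average m n h) = L2_inner \<mu> f (finite_average m n k)"
      unfolding finite_average_def
      by (simp add: L2_inner_sum_right regular_L2 zp_of_int_in[OF p_pos] L adjoint_translation[OF fg hk])
    then have "L2_inner \<mu> g (?E m h) - L2_inner \<mu> f (?E m k) =
        (L2_inner \<mu> g (?E m h) - L2_inner \<mu> g (finite_average m n h) / p ^ (n - m)) -
        (L2_inner \<mu> f (?E m k) - L2_inner \<mu> f (finite_average m n k) / p ^ (n - m))" by simp
    then have "?d \<le> cmod (L2_inner \<mu> g (?E m h) - L2_inner \<mu> g (finite_average m n h) / p ^ (n - m)) +
        cmod (L2_inner \<mu> f (?E m k) - L2_inner \<mu> f (finite_average m n k) / p ^ (n - m))"
      by (simp only: norm_triangle_ineq4)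
    also have "\<dots> \<le> ?b n" by (intro add_mono finite_average_inner_bound L that)
    finally show ?thesis .
  qed
  moreover have "?b \<longlonglongrightarrow> L2_norm \<mu> g * 0 + L2_norm \<mu> f * 0"
    by (intro tendsto_add tendsto_mult_left coset_average_tendsto L)
  ultimately have "?d \<le> L2_norm \<mu> g * 0 + L2_norm \<mu> f * 0"
    by (intro LIMSEQ_le_const) auto
  then have "L2_inner \<mu> g (?E m h) = L2_inner \<mu> f (?E m k)" by simp
  then show "L2_inner \<mu> (?E m g) h = L2_inner \<mu> (?E m f) k"
    by (simp add: coset_average_selfadjoint L)
qed

text \<open>Averaging an approximation of g from the domain keeps it in the domain, makes it a step
  function and, by contractivity, does not worsen it. So the domain is dense within the
  finite-dimensional step space, hence contains it.\<close>

lemma step_in_domain: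
  assumes h: "h \<in> step p n" shows "h \<in> Domain D"
proof -
  let ?E = "coset_average p \<mu> n"
  have dom: "cfun.subspace (Domain D)"
  proof (rule cfun.subspaceI)
    show "0 \<in> Domain D" using D_null cfun.subspace_0[OF subspace_L2_null] by blast
  qed (use D_add D_scale in blast)+
  have "step p n \<inter> Domain D = step p n"
  proof (rule dense_subspace_step)
    show "cfun.subspace (step p n \<inter> Domain D)"
      by (intro cfun.subspace_inter subspace_step[OF p_pos] dom)
    fix g and e :: real assume g: "g \<in> step p n" and e: "e > 0"
    then obtain f where f: "f \<in> Domain D" "L2_norm \<mu> (g - f) < e"
      using dense step_L2[OF g] unfolding densely_defined_operator_def by blast
    then have fL: "f \<in> L2 \<mu>" using D_L2 by auto
    have mem: "?E f \<in> step p n \<inter> Domain D" using f coset_average_commutes coset_average_step by blast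
    have "g - ?E f = ?E (g - f)"
      by (simp only: coset_average_diff[OF step_L2[OF g] fL] coset_average_of_step[OF g])
    then have "L2_norm \<mu> (g - ?E f) \<le> L2_norm \<mu> (g - f)"
      using coset_average_norm_le[OF L2_diff[OF step_L2[OF g] fL]] by metis
    then have "L2_norm \<mu> (g - ?E f) < e" using f(2) by (rule order_le_less_trans)
    then show "\<exists>v\<in>step p n \<inter> Domain D. L2_norm \<mu> (g - v) < e" using mem by (rule bexI)
  qed simp
  then show ?thesis using h by blast
qed

end

section \<open>Compressions have index zero\<close>

locale locally_constant_projection = equivariant_operator +
  fixes n r :: nat and q :: "padic \<Rightarrow> complex mat"
  assumes q_carrier: "\<And>x. x \<in> Zp p \<Longrightarrow> q x \<in> carrier_mat n n"
    and q_idem: "\<And>x. x \<in> Zp p \<Longrightarrow> q x * q x = q x"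
    and q_const: "\<And>x y i j. x \<in> Zp p \<Longrightarrow> y \<in> Zp p \<Longrightarrow> x r = y r \<Longrightarrow> i < n \<Longrightarrow> j < n \<Longrightarrow>
      q x $$ (i, j) = q y $$ (i, j)"
begin

abbreviation (input) "M \<equiv> copies n \<mu>"
abbreviation (input) "A \<equiv> mat_action n q"
abbreviation (input) "Q \<equiv> op_graph M A"
abbreviation (input) "H \<equiv> Range Q"
abbreviation (input) "T \<equiv> (Q O amplification n \<mu> D O Q) \<inter> H \<times> H"

text \<open>The level N + r instead of N makes every average commute with q. Components outside
  \<open>copies n\<close> are set to 0 so that values are determined as total functions.\<close>

definition average :: "nat \<Rightarrow> (nat \<times> padic \<Rightarrow> complex) \<Rightarrow> (nat \<times> padic \<Rightarrow> complex)" where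
  "average N \<xi> = (\<lambda>(i, x). if i < n then coset_average p \<mu> (N + r) (\<lambda>x. \<xi> (i, x)) x else 0)"

lemma average_component: "i < n \<Longrightarrow> (\<lambda>x. average N \<xi> (i, x)) = coset_average p \<mu> (N + r) (\<lambda>x. \<xi> (i, x))"
  by (simp add: average_def)

lemma average_eqI:
  assumes "\<And>i. i < n \<Longrightarrow> coset_average p \<mu> (N + r) (\<lambda>x. \<xi> (i, x)) = (\<lambda>x. \<eta> (i, x))"
    and "\<And>i x. \<not> i < n \<Longrightarrow> \<eta> (i, x) = 0"
  shows "average N \<xi> = \<eta>"
  using assms by (auto simp: average_def fun_eq_iff)

text \<open>Entries of q are constrained on Z_p only; extension by 0 turns them into step
  functions.\<close>

definition entry :: "nat \<Rightarrow> nat \<Rightarrow> padic \<Rightarrow> complex" where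
  "entry i j = (\<lambda>x. if x \<in> Zp p then q x $$ (i, j) else 0)"

lemma entry_step:
  assumes "i < n" "j < n" shows "entry i j \<in> step p (N + r)"
proof (rule subsetD[OF step_mono[OF p_pos, of r "N + r"]])
  show "entry i j \<in> step p r"
  proof (rule step_I)
    fix x y assume "x \<in> Zp p" "y \<in> Zp p" "x r = y r"
    then show "entry i j x = entry i j y" using q_const[of x y i j] assms by (simp add: entry_def)
  qed (simp add: entry_def)
qed simp

lemma action_component:
  "x \<in> Zp p \<Longrightarrow> A \<xi> (i, x) = (\<Sum>j<n. (\<lambda>x. entry i j x * \<xi> (j, x))) x"
  by (simp add: mat_action_def entry_def sum_fun_apply)

lemma component_L2: "\<xi> \<in> L2 M \<Longrightarrow> i < n \<Longrightarrow> (\<lambda>x. \<xi> (i, x)) \<in> L2 \<mu>"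
  by (simp add: L2_copies_iff)

lemma action_L2: assumes \<xi>: "\<xi> \<in> L2 M" shows "A \<xi> \<in> L2 M"
  unfolding L2_copies_iff
proof (intro allI impI)
  fix i assume i: "i < n"
  have "(\<Sum>j<n. (\<lambda>x. entry i j x * \<xi> (j, x))) \<in> L2 \<mu>"
    by (intro L2_sum L2_step_mult[OF entry_step[OF i, of _ 0]] component_L2[OF \<xi>]) auto
  then show "(\<lambda>x. A \<xi> (i, x)) \<in> L2 \<mu>" by (rule L2_cong) (simp add: action_component)
qed

lemma action_idem: assumes x: "x \<in> Zp p" and i: "i < n" shows "A (A \<xi>) (i, x) = A \<xi> (i, x)"
proof -
  have "A (A \<xi>) (i, x) = (\<Sum>j<n. \<Sum>k<n. q x $$ (i, j) * (q x $$ (j, k) * \<xi> (k, x)))"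
    by (simp add: mat_action_def sum_distrib_left)
  also have "\<dots> = (\<Sum>k<n. \<Sum>j<n. q x $$ (i, j) * (q x $$ (j, k) * \<xi> (k, x)))" by (rule sum.swap)
  also have "\<dots> = (\<Sum>k<n. (q x * q x) $$ (i, k) * \<xi> (k, x))"
  proof (rule sum.cong[OF refl])
    fix k assume "k \<in> {..<n}"
    then have "(q x * q x) $$ (i, k) = (\<Sum>j<n. q x $$ (i, j) * q x $$ (j, k))"
      using q_carrier[OF x] i by (auto simp: scalar_prod_def lessThan_atLeast0 intro!: sum.cong)
    then show "(\<Sum>j<n. q x $$ (i, j) * (q x $$ (j, k) * \<xi> (k, x))) = (q x * q x) $$ (i, k) * \<xi> (k, x)"
      by (simp add: sum_distrib_right mult.assoc)
  qed
  finally show ?thesis by (simp add: q_idem[OF x] mat_action_def)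
qed

lemma AE_component:
  assumes "\<xi> \<in> L2 M" "\<eta> \<in> L2 M"
  shows "(AE z in M. \<xi> z = \<eta> z) \<longleftrightarrow> (\<forall>i<n. AE x in \<mu>. \<xi> (i, x) = \<eta> (i, x))"
  by (intro copies_AE_eq_iff L2_measurable assms)

lemma action_cong_AE:
  assumes L: "\<xi> \<in> L2 M" "\<eta> \<in> L2 M" and eq: "AE z in M. \<xi> z = \<eta> z"
  shows "AE z in M. A \<xi> z = A \<eta> z"
proof -
  have "\<forall>i\<in>{..<n}. AE x in \<mu>. \<xi> (i, x) = \<eta> (i, x)" using eq AE_component[OF L] by simp
  then have all: "AE x in \<mu>. \<forall>i\<in>{..<n}. \<xi> (i, x) = \<eta> (i, x)" by (subst AE_ball_countable) auto
  have "AE x in \<mu>. A \<xi> (i, x) = A \<eta> (i, x)" for i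
    using all by eventually_elim (simp add: mat_action_def)
  then show ?thesis using AE_component[OF action_L2[OF L(1)] action_L2[OF L(2)]] by blast
qed

text \<open>The range of an idempotent is its fixed space, here up to null functions.\<close>

lemma H_iff: "\<xi> \<in> H \<longleftrightarrow> \<xi> \<in> L2 M \<and> (AE z in M. \<xi> z = A \<xi> z)"
proof
  assume "\<xi> \<in> H"
  then obtain \<zeta> where z: "\<zeta> \<in> L2 M" "\<xi> \<in> L2 M" "AE z in M. \<xi> z = A \<zeta> z" by (auto simp: op_graph_def)
  have "AE z in M. A \<xi> z = A (A \<zeta>) z" by (rule action_cong_AE[OF z(2) action_L2[OF z(1)] z(3)])
  moreover have "AE z in M. A (A \<zeta>) z = A \<zeta> z"
    unfolding AE_component[OF action_L2[OF action_L2[OF z(1)]] action_L2[OF z(1)]]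
    using action_idem by (auto simp: space_\<mu> intro!: AE_I2)
  ultimately have "AE z in M. \<xi> z = A \<xi> z" using z(3) by eventually_elim simp
  then show "\<xi> \<in> L2 M \<and> (AE z in M. \<xi> z = A \<xi> z)" using z(2) by blast
qed (auto simp: op_graph_def)

lemma action_in_H:
  assumes "\<omega> \<in> L2 M" "\<eta> \<in> L2 M" "AE z in M. \<eta> z = A \<omega> z" shows "\<eta> \<in> H"
  using assms by (auto simp: op_graph_def)

lemma H_L2: "\<xi> \<in> H \<Longrightarrow> \<xi> \<in> L2 M"
  by (simp add: H_iff)

text \<open>On H the first application of q acts as the identity up to null functions, so the
  compression amounts to the amplified D followed by q.\<close>

lemma T_iff: "(\<xi>, \<eta>) \<in> T \<longleftrightarrow> \<xi> \<in> H \<and> \<eta> \<in> L2 M \<and>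
    (\<exists>\<omega>. (\<xi>, \<omega>) \<in> amplification n \<mu> D \<and> (AE z in M. \<eta> z = A \<omega> z))"
proof (intro iffI conjI)
  assume T: "(\<xi>, \<eta>) \<in> T"
  then show H: "\<xi> \<in> H" by blast
  show "\<eta> \<in> L2 M" using T H_L2 by blast
  obtain \<zeta> \<omega> where z: "(\<xi>, \<zeta>) \<in> Q" "(\<zeta>, \<omega>) \<in> amplification n \<mu> D" "(\<omega>, \<eta>) \<in> Q" using T by blast
  have L: "\<zeta> \<in> L2 M" "\<xi> \<in> L2 M" using z(1) by (auto simp: op_graph_def)
  have "AE z in M. \<zeta> z = A \<xi> z" using z(1) by (simp add: op_graph_def)
  moreover have "AE z in M. \<xi> z = A \<xi> z" using H by (simp add: H_iff)
  ultimately have "AE z in M. \<zeta> z = \<xi> z" by eventually_elim simp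
  then have ae: "AE x in \<mu>. \<zeta> (i, x) = \<xi> (i, x)" if "i < n" for i
    using AE_component[OF L] that by blast
  have "(\<lambda>x. \<xi> (i, x), \<lambda>x. \<omega> (i, x)) \<in> D" if "i < n" for i
    using z(2) that by (intro D_cong_AE[OF _ component_L2[OF L(2) that] ae[OF that]]) (simp add: amplification_def)
  then have "(\<xi>, \<omega>) \<in> amplification n \<mu> D" using z(2) L(2) by (simp add: amplification_def)
  then show "\<exists>\<omega>. (\<xi>, \<omega>) \<in> amplification n \<mu> D \<and> (AE z in M. \<eta> z = A \<omega> z)"
    using z(3) by (auto simp: op_graph_def)
next
  assume R: "\<xi> \<in> H \<and> \<eta> \<in> L2 M \<and> (\<exists>\<omega>. (\<xi>, \<omega>) \<in> amplification n \<mu> D \<and> (AE z in M. \<eta> z = A \<omega> z))"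
  then obtain \<omega> where w: "(\<xi>, \<omega>) \<in> amplification n \<mu> D" "AE z in M. \<eta> z = A \<omega> z" by blast
  have wL: "\<omega> \<in> L2 M" using w by (auto simp: amplification_def)
  have "\<xi> \<in> L2 M" "AE z in M. \<xi> z = A \<xi> z" using R H_iff[of \<xi>] by blast+
  then have "(\<xi>, \<xi>) \<in> Q" by (simp add: op_graph_def)
  moreover have "(\<omega>, \<eta>) \<in> Q" using R w wL by (auto simp: op_graph_def)
  ultimately show "(\<xi>, \<eta>) \<in> T" using w R by blast
qed

lemma action_add: "A (\<xi> + \<eta>) = A \<xi> + A \<eta>"
  by (auto simp: mat_action_def fun_eq_iff distrib_left sum.distrib)

lemma action_scale: "A (\<lambda>z. c * \<xi> z) = (\<lambda>z. c * A \<xi> z)"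
  by (auto simp: mat_action_def fun_eq_iff sum_distrib_left mult.left_commute)

lemma action_zero: "A 0 = 0"
  by (auto simp: mat_action_def fun_eq_iff)

lemma average_cong_AE:
  assumes "\<xi> \<in> L2 M" "\<eta> \<in> L2 M" "AE z in M. \<xi> z = \<eta> z"
  shows "average N \<xi> = average N \<eta>"
proof (rule average_eqI)
  fix i assume i: "i < n"
  have "coset_average p \<mu> (N + r) (\<lambda>x. \<xi> (i, x)) = coset_average p \<mu> (N + r) (\<lambda>x. \<eta> (i, x))"
    by (rule coset_average_cong_AE) (use assms AE_component[OF assms(1,2)] component_L2 i in auto)
  then show "coset_average p \<mu> (N + r) (\<lambda>x. \<xi> (i, x)) = (\<lambda>x. average N \<eta> (i, x))"
    by (simp add: average_component[OF i])
qed (simp add: average_def)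

lemma average_L2: "average N \<xi> \<in> L2 M"
  by (simp add: L2_copies_iff average_component coset_average_L2)

text \<open>Each entry of q is a step function of level N + r and can be pulled out of the
  average.\<close>

lemma average_action:
  assumes \<xi>: "\<xi> \<in> L2 M" shows "AE z in M. A (average N \<xi>) z = average N (A \<xi>) z"
  unfolding AE_component[OF action_L2[OF average_L2] average_L2]
proof (intro allI impI AE_I2)
  fix i x assume i: "i < n" and "x \<in> space \<mu>"
  then have x: "x \<in> Zp p" by (simp add: space_\<mu>)
  let ?E = "coset_average p \<mu> (N + r)"
  let ?t = "\<lambda>j x. entry i j x * \<xi> (j, x)"
  have tL: "?t j \<in> L2 \<mu>" if "j < n" for j
    by (rule L2_step_mult[OF entry_step[OF i that, of 0] component_L2[OF \<xi> that]])
  have sum: "?E (\<Sum>j\<in>J. ?t j) = (\<Sum>j\<in>J. ?E (?t j))" if "finite J" "J \<subseteq> {..<n}" for J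
    using that
  proof (induction J)
    case empty
    show ?case unfolding sum.empty
      by (rule coset_average_of_step[OF cfun.subspace_0[OF subspace_step[OF p_pos]]])
  next
    case (insert j J)
    then have "(\<Sum>j\<in>J. ?t j) \<in> L2 \<mu>" by (intro L2_sum tL) auto
    then have "?E (?t j + (\<Sum>j\<in>J. ?t j)) = ?E (?t j) + ?E (\<Sum>j\<in>J. ?t j)"
      using insert tL by (intro coset_average_add) auto
    moreover have "?E (\<Sum>j\<in>J. ?t j) = (\<Sum>j\<in>J. ?E (?t j))" using insert.IH insert.prems by blast
    ultimately show ?case unfolding sum.insert[OF insert.hyps] by (simp only:)
  qed
  have "average N (A \<xi>) (i, x) = ?E (\<lambda>x. A \<xi> (i, x)) x" using i by (simp add: average_def)
  also have "?E (\<lambda>x. A \<xi> (i, x)) = ?E (\<Sum>j<n. ?t j)"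
    by (rule coset_average_cong) (rule action_component)
  also have "\<dots> = (\<Sum>j<n. ?E (?t j))" by (rule sum) auto
  also have "\<dots> x = (\<Sum>j<n. entry i j x * ?E (\<lambda>x. \<xi> (j, x)) x)"
    unfolding sum_fun_apply using i x by (intro sum.cong refl coset_average_step_mult entry_step) auto
  also have "\<dots> = A (average N \<xi>) (i, x)"
    by (simp add: action_component[OF x] sum_fun_apply average_def)
  finally show "A (average N \<xi>) (i, x) = average N (A \<xi>) (i, x)" by simp
qed

lemma average_H: assumes "\<xi> \<in> H" shows "average N \<xi> \<in> H"
proof -
  have L: "\<xi> \<in> L2 M" and eq: "AE z in M. \<xi> z = A \<xi> z" using assms by (auto simp: H_iff)
  have E: "average N \<xi> = average N (A \<xi>)" by (rule average_cong_AE[OF L action_L2[OF L] eq])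
  have "AE z in M. A (average N \<xi>) z = average N \<xi> z"
    using average_action[OF L, of N] unfolding E[symmetric] .
  then have "AE z in M. average N \<xi> z = A (average N \<xi>) z" by eventually_elim (rule sym)
  then show ?thesis using average_L2 by (simp add: H_iff)
qed

definition embed :: "nat \<Rightarrow> (padic \<Rightarrow> complex) \<Rightarrow> (nat \<times> padic \<Rightarrow> complex)" where
  "embed i g = (\<lambda>(k, x). if k = i then g x else 0)"

lemma average_finite_rank: "\<exists>B. finite B \<and> range (average N) \<subseteq> cfun.span B"
proof (intro exI conjI subsetI)
  let ?B = "(\<lambda>(i, a). embed i (indicator (coset p (N + r) a))) ` ({..<n} \<times> {0..<int p ^ (N + r)})"
  show "finite ?B" by simp
  fix \<eta> assume "\<eta> \<in> range (average N)"
  then obtain \<xi> where \<eta>: "\<eta> = average N \<xi>" by blast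
  let ?g = "\<lambda>i. coset_average p \<mu> (N + r) (\<lambda>x. \<xi> (i, x))"
  have "\<eta> = (\<Sum>i<n. \<Sum>a\<in>{0..<int p ^ (N + r)}.
      (\<lambda>z. ?g i (zp_of_int p a) * embed i (indicator (coset p (N + r) a)) z))"
  proof
    fix z :: "nat \<times> padic"
    obtain k x where z: "z = (k, x)" by (cases z)
    have "(\<Sum>i<n. \<Sum>a\<in>{0..<int p ^ (N + r)}.
        (\<lambda>z. ?g i (zp_of_int p a) * embed i (indicator (coset p (N + r) a)) z)) z =
        (\<Sum>i<n. if i = k then (\<Sum>a\<in>{0..<int p ^ (N + r)}.
          (\<lambda>x. ?g i (zp_of_int p a) * indicator (coset p (N + r) a) x)) x else 0)"
      unfolding sum_fun_apply by (intro sum.cong refl) (auto simp: embed_def z)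
    also have "\<dots> = (\<Sum>i<n. if i = k then ?g i x else 0)"
      by (intro sum.cong refl if_cong fun_cong[OF step_expand[OF p_pos coset_average_step, symmetric]])
    also have "\<dots> = \<eta> z" by (simp add: \<eta> z average_def)
    finally show "\<eta> z = (\<Sum>i<n. \<Sum>a\<in>{0..<int p ^ (N + r)}.
        (\<lambda>z. ?g i (zp_of_int p a) * embed i (indicator (coset p (N + r) a)) z)) z" by simp
  qed
  also have "\<dots> \<in> cfun.span ?B"
    by (intro cfun.span_sum cfun.span_scale cfun.span_base) auto
  finally show "\<eta> \<in> cfun.span ?B" .
qed

lemma average_domain: assumes "\<xi> \<in> H" shows "average N \<xi> \<in> Domain T"
proof -
  have "\<exists>w. (coset_average p \<mu> (N + r) (\<lambda>x. \<xi> (i, x)), w) \<in> D" for i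
    using step_in_domain[OF coset_average_step] by blast
  then obtain w where w: "\<And>i. (coset_average p \<mu> (N + r) (\<lambda>x. \<xi> (i, x)), w i) \<in> D" by metis
  let ?w = "\<lambda>(i, x). w i x"
  have "w i \<in> L2 \<mu>" for i using D_L2[OF w] by blast
  then have L: "?w \<in> L2 M" by (simp add: L2_copies_iff)
  have "(average N \<xi>, ?w) \<in> amplification n \<mu> D"
    using w L average_L2 by (simp add: amplification_def average_component)
  then have "(average N \<xi>, A ?w) \<in> T"
    unfolding T_iff using average_H[OF assms] action_L2[OF L] by blast
  then show ?thesis by blast
qed

text \<open>The average is moved past D by \<open>coset_average_commutes\<close> and past q by
  \<open>average_action\<close>.\<close>

lemma average_commutes: assumes "(\<xi>, \<eta>) \<in> T" shows "(average N \<xi>, average N \<eta>) \<in> T"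
proof -
  obtain \<omega> where w: "\<xi> \<in> H" "\<eta> \<in> L2 M" "(\<xi>, \<omega>) \<in> amplification n \<mu> D" "AE z in M. \<eta> z = A \<omega> z"
    using assms unfolding T_iff by blast
  have wL: "\<omega> \<in> L2 M" using w(3) by (simp add: amplification_def)
  have "(average N \<xi>, average N \<omega>) \<in> amplification n \<mu> D"
    using w(3) coset_average_commutes by (simp add: amplification_def average_L2 average_component)
  moreover have "average N \<eta> = average N (A \<omega>)" by (rule average_cong_AE[OF w(2) action_L2[OF wL] w(4)])
  then have "AE z in M. average N \<eta> z = A (average N \<omega>) z"
    using average_action[OF wL, of N] by (simp add: eq_commute)
  ultimately show ?thesis unfolding T_iff using average_H[OF w(1)] average_L2 by blast
qed

lemma average_tendsto: assumes "\<xi> \<in> H" shows "(\<lambda>N. L2_norm M (average N \<xi> - \<xi>)) \<longlonglongrightarrow> 0"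
proof -
  have L: "\<xi> \<in> L2 M" using assms by (rule H_L2)
  have "L2_norm M (average N \<xi> - \<xi>) =
      sqrt (\<Sum>i<n. (L2_norm \<mu> (coset_average p \<mu> (N + r) (\<lambda>x. \<xi> (i, x)) - (\<lambda>x. \<xi> (i, x))))\<^sup>2)" for N
    unfolding L2_norm_copies[OF L2_diff[OF average_L2 L]]
    by (intro arg_cong[of _ _ sqrt] sum.cong refl arg_cong[of _ _ "\<lambda>f. (L2_norm \<mu> f)\<^sup>2"])
      (simp add: average_def fun_eq_iff)
  moreover have "(\<lambda>N. sqrt (\<Sum>i<n. (L2_norm \<mu> (coset_average p \<mu> (N + r) (\<lambda>x. \<xi> (i, x)) - (\<lambda>x. \<xi> (i, x))))\<^sup>2))
      \<longlonglongrightarrow> sqrt (\<Sum>i<n. 0\<^sup>2)"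
    by (intro tendsto_real_sqrt tendsto_sum tendsto_power
        LIMSEQ_ignore_initial_segment[OF coset_average_tendsto] component_L2[OF L]) simp
  ultimately show ?thesis by simp
qed

lemma average_null:
  assumes "\<xi> \<in> L2_null M" shows "average N \<xi> = 0"
proof (rule average_eqI)
  fix i assume i: "i < n"
  have n: "(\<lambda>x. \<xi> (i, x)) \<in> L2_null \<mu>" using assms i by (simp add: L2_null_copies_iff)
  have "coset_average p \<mu> (N + r) (\<lambda>x. \<xi> (i, x)) = coset_average p \<mu> (N + r) 0"
    by (rule coset_average_cong_AE) (use n L2_zero in \<open>auto simp: L2_null_def\<close>)
  also have "\<dots> = 0" by (rule coset_average_of_step[OF cfun.subspace_0[OF subspace_step[OF p_pos]]])
  finally show "coset_average p \<mu> (N + r) (\<lambda>x. \<xi> (i, x)) = (\<lambda>x. 0 (i, x))" by (simp add: fun_eq_iff)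
qed simp

lemma average_eq_0:
  assumes "average N \<xi> \<in> L2_null M" shows "average N \<xi> = 0"
proof (rule average_eqI)
  fix i assume i: "i < n"
  have "coset_average p \<mu> (N + r) (\<lambda>x. \<xi> (i, x)) \<in> L2_null \<mu>"
    using assms i by (simp add: L2_null_copies_iff average_component)
  then have "coset_average p \<mu> (N + r) (\<lambda>x. \<xi> (i, x)) = 0"
    by (intro step_null_eq_0[OF coset_average_step]) (simp add: L2_null_def)
  then show "coset_average p \<mu> (N + r) (\<lambda>x. \<xi> (i, x)) = (\<lambda>x. 0 (i, x))" by (simp add: fun_eq_iff)
qed simp

lemma average_add: "\<xi> \<in> L2 M \<Longrightarrow> \<eta> \<in> L2 M \<Longrightarrow> average N (\<xi> + \<eta>) = average N \<xi> + average N \<eta>"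
proof (rule average_eqI)
  fix i assume L: "\<xi> \<in> L2 M" "\<eta> \<in> L2 M" and i: "i < n"
  have eq: "(\<lambda>x. (\<xi> + \<eta>) (i, x)) = (\<lambda>x. \<xi> (i, x)) + (\<lambda>x. \<eta> (i, x))" by (simp add: fun_eq_iff)
  show "coset_average p \<mu> (N + r) (\<lambda>x. (\<xi> + \<eta>) (i, x)) = (\<lambda>x. (average N \<xi> + average N \<eta>) (i, x))"
    unfolding eq coset_average_add[OF component_L2[OF L(1) i] component_L2[OF L(2) i]]
    using i by (simp add: average_def fun_eq_iff)
qed (simp add: average_def)

lemma average_scale: "average N (\<lambda>z. c * \<xi> z) = (\<lambda>z. c * average N \<xi> z)"
  by (rule average_eqI) (simp_all add: average_def coset_average_scale)

section \<open>The compression as an approximated operator\<close>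

lemma subspace_H: "cfun.subspace H"
proof (rule cfun.subspaceI)
  show "0 \<in> H" by (simp add: H_iff L2_zero action_zero)
  show "\<xi> + \<eta> \<in> H" if "\<xi> \<in> H" "\<eta> \<in> H" for \<xi> \<eta>
    using that by (auto simp: H_iff L2_add action_add simp del: plus_fun_apply) (auto elim: AE_mp)
  show "(\<lambda>z. c * \<xi> z) \<in> H" if "\<xi> \<in> H" for c \<xi>
    using that by (auto simp: H_iff L2_scale action_scale elim: AE_mp)
qed

lemma null_H: "L2_null M \<subseteq> H"
proof
  fix \<xi> assume "\<xi> \<in> L2_null M"
  then have "\<xi> \<in> L2 M" "AE z in M. \<xi> z = A 0 z" by (auto simp: L2_null_def action_zero)
  then show "\<xi> \<in> H" by (intro action_in_H[OF L2_zero])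
qed

lemma T_add: assumes "(f, g) \<in> T" "(f', g') \<in> T" shows "(f + f', g + g') \<in> T"
proof -
  obtain w w' where w: "f \<in> H" "g \<in> L2 M" "(f, w) \<in> amplification n \<mu> D" "AE z in M. g z = A w z"
    "f' \<in> H" "g' \<in> L2 M" "(f', w') \<in> amplification n \<mu> D" "AE z in M. g' z = A w' z"
    using assms unfolding T_iff by blast
  have "(\<lambda>x. (f + f') (i, x), \<lambda>x. (w + w') (i, x)) \<in> D" if "i < n" for i
    using D_add[of "\<lambda>x. f (i, x)" "\<lambda>x. w (i, x)" "\<lambda>x. f' (i, x)" "\<lambda>x. w' (i, x)"] w(3,7) that
    by (simp add: amplification_def plus_fun_def)
  then have "(f + f', w + w') \<in> amplification n \<mu> D"
    using w(3,7) by (simp add: amplification_def L2_add del: plus_fun_apply)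
  moreover have "AE z in M. (g + g') z = A (w + w') z"
    using w(4,8) unfolding action_add by eventually_elim simp
  ultimately show ?thesis unfolding T_iff
    using w(1,2,5,6) cfun.subspace_add[OF subspace_H] L2_add by blast
qed

lemma T_scale: assumes "(f, g) \<in> T" shows "(\<lambda>z. c * f z, \<lambda>z. c * g z) \<in> T"
proof -
  obtain w where w: "f \<in> H" "g \<in> L2 M" "(f, w) \<in> amplification n \<mu> D" "AE z in M. g z = A w z"
    using assms unfolding T_iff by blast
  have "(\<lambda>z. c * f z, \<lambda>z. c * w z) \<in> amplification n \<mu> D"
    using w(3) D_scale by (auto simp: amplification_def L2_scale)
  moreover have "AE z in M. c * g z = A (\<lambda>z. c * w z) z"
    using w(4) unfolding action_scale by eventually_elim simp
  ultimately show ?thesis unfolding T_iff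
    using w(1,2) cfun.subspace_scale[OF subspace_H] L2_scale by blast
qed

lemma T_null: assumes "f \<in> L2_null M" "g \<in> L2_null M" shows "(f, g) \<in> T"
proof -
  have z: "(\<lambda>x::padic. 0::complex) \<in> L2_null \<mu>" using cfun.subspace_0[OF subspace_L2_null, of \<mu>] by (simp add: zero_fun_def)
  have "(f, 0) \<in> amplification n \<mu> D"
    using assms(1) D_null[OF _ z] L2_zero[of M] by (auto simp: amplification_def L2_null_copies_iff L2_null_def[of M])
      (metis L2_null_copies_iff L2_null_def assms(1))
  moreover have "AE z in M. g z = A 0 z" "g \<in> L2 M" using assms(2) by (auto simp: L2_null_def action_zero)
  ultimately show ?thesis unfolding T_iff using assms(1) null_H by blast
qed

lemma T_single: assumes "(f, g) \<in> T" "f \<in> L2_null M" shows "g \<in> L2_null M"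
proof -
  obtain w where w: "g \<in> L2 M" "(f, w) \<in> amplification n \<mu> D" "AE z in M. g z = A w z"
    using assms(1) unfolding T_iff by blast
  have "\<forall>i<n. (\<lambda>x. w (i, x)) \<in> L2_null \<mu>"
    using w(2) assms(2) D_single by (auto simp: amplification_def L2_null_copies_iff)
  then have wn: "w \<in> L2_null M" by (simp add: L2_null_copies_iff)
  then have wL: "w \<in> L2 M" and "AE z in M. w z = 0 z" by (auto simp: L2_null_def)
  then have "AE z in M. A w z = A 0 z" by (intro action_cong_AE[OF _ L2_zero])
  then have "AE z in M. g z = 0" using w(3) unfolding action_zero by eventually_elim simp
  then show ?thesis using w(1) by (simp add: L2_null_def)
qed

lemma average_coarser: "m \<le> N \<Longrightarrow> average N (average m f) = average m f"
  by (rule average_eqI) (simp_all add: average_component coset_average_coarser, simp add: average_def)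

lemma average_finer:
  assumes f: "f \<in> L2 M" and mN: "m \<le> N"
  shows "average m (average N f) = average m f"
proof (rule average_eqI)
  fix i assume "i < n"
  then show "coset_average p \<mu> (m + r) (\<lambda>x. average N f (i, x)) = (\<lambda>x. average m f (i, x))"
    using mN by (simp add: average_component coset_average_finer[OF component_L2[OF f]])
qed (simp add: average_def)

sublocale approximated_operator M H T average
proof
  show "cfun.subspace H" by (rule subspace_H)
  show "L2_null M \<subseteq> H" by (rule null_H)
  show "cfun.subspace (L2_null M)" by (rule subspace_L2_null)
  show "T \<subseteq> H \<times> H" by blast
  show "\<exists>B. finite B \<and> average N ` H \<subseteq> cfun.span B" for N using average_finite_rank[of N] by blast
  fix f g :: "nat \<times> padic \<Rightarrow> complex" and m N :: nat and c :: complex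
  show "(f, g) \<in> T \<Longrightarrow> (\<lambda>x. c * f x, \<lambda>x. c * g x) \<in> T" by (rule T_scale)
  show "f \<in> L2_null M \<Longrightarrow> g \<in> L2_null M \<Longrightarrow> (f, g) \<in> T" by (rule T_null)
  show "(f, g) \<in> T \<Longrightarrow> f \<in> L2_null M \<Longrightarrow> g \<in> L2_null M" by (rule T_single)
  show "f \<in> H \<Longrightarrow> g \<in> H \<Longrightarrow> average N (f + g) = average N f + average N g"
    by (rule average_add[OF H_L2 H_L2])
  show "average N (\<lambda>x. c * f x) = (\<lambda>x. c * average N f x)" by (rule average_scale)
  show "f \<in> H \<Longrightarrow> average N f \<in> H" by (rule average_H)
  show "f \<in> L2_null M \<Longrightarrow> average N f = 0" by (rule average_null)
  show "average N f \<in> L2_null M \<Longrightarrow> average N f = 0" by (rule average_eq_0)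
  show "m \<le> N \<Longrightarrow> average N (average m f) = average m f" by (rule average_coarser)
  show "f \<in> H \<Longrightarrow> m \<le> N \<Longrightarrow> average m (average N f) = average m f" by (rule average_finer[OF H_L2])
  show "(f, g) \<in> T \<Longrightarrow> (average N f, average N g) \<in> T" by (rule average_commutes)
  show "f \<in> H \<Longrightarrow> average N f \<in> Domain T" by (rule average_domain)
  show "f \<in> H \<Longrightarrow> (\<lambda>n. L2_norm M (average n f - f)) \<longlonglongrightarrow> 0" by (rule average_tendsto)
  show "f \<in> H \<Longrightarrow> L2_norm M f = 0 \<Longrightarrow> f \<in> L2_null M"
    unfolding L2_null_eq using H_L2 by blast
  fix f' g'
  show "(f, g) \<in> T \<Longrightarrow> (f', g') \<in> T \<Longrightarrow> (f + f', g + g') \<in> T" by (rule T_add)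
qed

end

lemma (in equivariant_operator) index_of_projection_eq_0:
  assumes q: "(n, q) \<in> proj_O p" and j: "index_of_projection \<mu> D (n, q) j"
  shows "j = 0"
proof -
  have "\<exists>r. \<forall>x\<in>Zp p. \<forall>y\<in>Zp p. x r = y r \<longrightarrow> q x $$ (i, k) = q y $$ (i, k)" if "i < n" "k < n" for i k
    using q that by (intro O_Zp_locally_constant[OF p_pos]) (auto simp: proj_O_def)
  then obtain R where R: "\<And>i k x y. i < n \<Longrightarrow> k < n \<Longrightarrow> x \<in> Zp p \<Longrightarrow> y \<in> Zp p \<Longrightarrow> x (R i k) = y (R i k) \<Longrightarrow>
      q x $$ (i, k) = q y $$ (i, k)" by metis
  \<comment> \<open>The sum of all levels dominates each of them, and it makes sense for n = 0 as
    well.\<close>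
  define r where "r = (\<Sum>i<n. \<Sum>k<n. R i k)"
  have R_le: "R i k \<le> r" if "i < n" "k < n" for i k
  proof -
    have "R i k \<le> (\<Sum>k<n. R i k)" using that by (intro member_le_sum) auto
    also have "\<dots> \<le> r" unfolding r_def using that by (intro member_le_sum[of i _ "\<lambda>i. \<Sum>k<n. R i k"]) auto
    finally show ?thesis .
  qed
  interpret locally_constant_projection \<mu> p D n r q
  proof unfold_locales
    fix x y i k assume "x \<in> Zp p" "y \<in> Zp p" "x r = y r" "i < n" "k < n"
    then show "q x $$ (i, k) = q y $$ (i, k)" using R[of i k x y] R_le[of i k] Zp_eq_mono[of x p y "R i k" r] by blast
  qed (use q in \<open>auto simp: proj_O_def proj_C_def continuous_entries_def\<close>)
  show ?thesis using j by (intro fredholm_index_zero) (simp add: index_of_projection_def Let_def)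
qed

theorem theorem5p3:
  fixes p :: nat and \<mu> :: "padic measure"
  assumes "prime p" and "haar_measure p \<mu>"
  shows "\<not> (\<exists>D. densely_defined_operator \<mu> D \<and>
           even_spectral_triple (copies 2 \<mu>) (O_Zp p) pi_pi (dirac \<mu> D) grading \<and>
           equivariant p \<mu> D \<and> nontrivial_pairing p \<mu> D)"
proof (rule notI, elim exE conjE)
  fix D assume D: "densely_defined_operator \<mu> D" "equivariant p \<mu> D"
    "even_spectral_triple (copies 2 \<mu>) (O_Zp p) pi_pi (dirac \<mu> D) grading" "nontrivial_pairing p \<mu> D"
  interpret prob_space \<mu> using assms(2) by (simp add: haar_measure_def)
  interpret equivariant_operator \<mu> p D
    by unfold_locales
      (use assms D prime_gt_0_nat in \<open>auto simp: even_spectral_triple_def\<close>)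
  \<comment> \<open>A value of the pairing is a difference of two indices of projections over
    \<open>O_Zp\<close>, and both indices are 0.\<close>
  show False
    using D(4) index_of_projection_eq_0
    by (auto simp: nontrivial_pairing_def index_pairing_def) (metis diff_self surj_pair)
qed

end
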